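(* Let $m\ge3$ and write $\delta_s=\delta_{s;m}$. Let $P(2,1)\subset GL_3(\mathbb F_q)$ be the parabolic subgroup corresponding to the composition $(2,1)$. The set consisting of the following six families of elements forms an $\mathbb F_q$-basis of $\mathcal Q_m(3)^{P(2,1)}$: 1. $Q_{2,1}^{i_1}Q_{2,0}^{i_2}Q_{3,2}^{i}$, with $(i_1,i_2)\in\Delta^m_2$, $0\le i<[m-2]_q$; 2. $Q_{2,1}^{i_1}Q_{2,0}^{i_2}\,\delta_3(1)$, with $(i_1,i_2)\in\Delta^m_2$; 3. $\delta_2(Q_{1,0}^{i_1}Q_{2,1}^{i})$, with $0\le i_1<[m]_q$, $0\le i<[m-1]_q$; 4. $\delta_2(Q_{1,0}^{i_1}\delta_2(1))$, with $0\le i_1<[m]_q$; 5. $\delta_1(\delta_1(Q_{1,0}^{i}))$, with $0\le i<[m]_q$; 6. $\delta_1(\delta_1(\delta_1(1)))$.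
   Context: Let $\mathbb F_q$ be the field with $q$ elements, $q$ a power of a prime. $S(n)=\mathbb F_q[x_1,\ldots,x_n]$, $I_m(n)=(x_1^{q^m},\ldots,x_n^{q^m})$, $\mathcal Q_m(n)=S(n)/I_m(n)$. $GL_n(\mathbb F_q)$ acts on $S(n)$ by linear substitutions of the variables, hence on $\mathcal Q_m(n)$. $P(2,1)$ is the subgroup of $GL_3(\mathbb F_q)$ of substitutions stabilizing $\mathrm{span}(x_1,x_2)$. Polynomials are identified with their classes in $\mathcal Q_m(n)$; the listed elements are polynomials. For $a\ge1$, $[a]_q=(q^a-1)/(q-1)$. Dickson invariants: for $s\ge1$, $Q_{s,i}=Q_{s,i}(x_1,\ldots,x_s)$, $0\le i\le s-1$, are defined by $\prod_{\lambda\in\mathbb F_q^{s}}(X+\lambda_1x_1+\cdots+\lambda_sx_s)=X^{q^s}+\sum_{i=0}^{s-1}(-1)^{s-i}Q_{s,i}X^{q^i}$. So $Q_{1,0}=x_1^{q-1}$. $(i_1,i_2)\in\Delta^m_2$ means that there are integers $m-2\ge\lambda_1\ge\lambda_2\ge0$ with $\frac{q^{\lambda_1}-q^{\lambda_2}}{q-1}\le i_1<\frac{q^{\lambda_1+1}-q^{\lambda_2}}{q-1}$ and $\frac{q^{\lambda_2}-1}{q-1}\le i_2<\frac{q^{\lambda_2+1}-1}{q-1}$. Delta operator: for integers $b\ge1$, $c\ge 0$, $1\le a\le c+1$ and a rational function $f$ in $c$ variables (a constant if $c=0$), $\delta_{a;b}(f)$ is the function of $c+1$ variables $x_1,\dots,x_{c+1}$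 equal to the quotient of two $a\times a$ determinants. The numerator matrix has $(i,j)$ entry $x_j^{q^{i-1}}$ for $1\le i\le a-1$ and $(a,j)$ entry $x_j^{q^b}f(x_1,\ldots,\widehat{x_j},\ldots,x_{c+1})$; the denominator is $\det(x_j^{q^{i-1}})_{1\le i,j\le a}$. Each application increases the number of variables by one. In family 1, 2 the constant $1$ in $\delta_3(1)$ is a function of two variables; in family 3 the argument of $\delta_2$ is a polynomial in $x_1,x_2$; in family 4 the inner $\delta_2(1)$ is a polynomial in $x_1,x_2$ (with $1$ a function of one variable); in family 5 the argument is a polynomial in one variable; in family 6 the constant $1$ is a function of zero variables. *)

theory Defs
  imports
    "HOL-Library.Poly_Mapping"
    "HOL-Library.Cardinality"
    "HOL-Computational_Algebra.Polynomial_Factorial"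
    "HOL-Algebra.QuotRing"
    "HOL-Algebra.Sylow"
    "HOL-Algebra.Multiplicative_Group"
    "Jordan_Normal_Form.VS_Connect"
    "Jordan_Normal_Form.Determinant"
begin

text \<open>
  The field with $q$ elements is a type \<open>'a\<close> of sort \<open>{field, finite}\<close>, with \<open>q = CARD('a)\<close>.
  Variables, rows and columns are numbered from 0: the variable $x_{i+1}$ is \<open>Var i\<close>. All
  polynomial rings $S(n)$ live in one type of polynomials in countably many variables; $S(n)$ is
  the subring of the polynomials in \<open>Var 0, ..., Var (n - 1)\<close>, and rational functions in $c$
  variables are fractions of elements of $S(c)$.
\<close>

section \<open>Polynomials and substitutions\<close>

type_synonym 'a mpoly = "(nat \<Rightarrow>\<^sub>0 nat) \<Rightarrow>\<^sub>0 'a"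

definition Const :: "'a::zero \<Rightarrow> 'a mpoly" where
  "Const c = Poly_Mapping.single 0 c"

definition Var :: "nat \<Rightarrow> 'a::zero_neq_one mpoly" where
  "Var i = Poly_Mapping.single (Poly_Mapping.single i 1) 1"

definition psubst :: "(nat \<Rightarrow> 'a::comm_semiring_1 mpoly) \<Rightarrow> 'a mpoly \<Rightarrow> 'a mpoly" where
  "psubst s p = (\<Sum>t\<in>Poly_Mapping.keys p. Const (Poly_Mapping.lookup p t) * (\<Prod>i\<in>Poly_Mapping.keys t. s i ^ Poly_Mapping.lookup t i))"

lemma psubst_superset:
  assumes "finite T" "Poly_Mapping.keys p \<subseteq> T"
  shows "psubst s p = (\<Sum>t\<in>T. Const (Poly_Mapping.lookup p t) * (\<Prod>i\<in>Poly_Mapping.keys t. s i ^ Poly_Mapping.lookup t i))"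
  unfolding psubst_def
  by (rule sum.mono_neutral_left) (use assms in \<open>auto simp: in_keys_iff Const_def\<close>)

lemma Const_add: "Const (a + b) = Const a + Const b"
  by (simp add: Const_def single_add)

lemma Const_mult: "Const (a * b) = Const a * (Const b :: 'a::comm_semiring_1 mpoly)"
  by (simp add: Const_def mult_single)

lemma Const_0 [simp]: "Const 0 = 0" and Const_1 [simp]: "Const 1 = 1"
  by (simp_all add: Const_def)

lemma Const_power: "Const (a ^ n) = (Const a :: 'a::comm_semiring_1 mpoly) ^ n"
  by (induction n) (simp_all add: Const_mult)

lemma psubst_add: "psubst s (p + q) = psubst s p + psubst s q"
proof -
  let ?T = "Poly_Mapping.keys p \<union> Poly_Mapping.keys q"
  have "Poly_Mapping.keys (p + q) \<subseteq> ?T" by (rule Poly_Mapping.keys_add)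
  then show ?thesis
    by (simp add: psubst_superset[of ?T] lookup_add Const_add distrib_right sum.distrib)
qed

lemma psubst_0 [simp]: "psubst s 0 = 0"
  by (simp add: psubst_def)

lemma psubst_sum: "psubst s (\<Sum>i\<in>A. f i) = (\<Sum>i\<in>A. psubst s (f i))"
  by (induction A rule: infinite_finite_induct) (simp_all add: psubst_add)

lemma psubst_single:
  "psubst s (Poly_Mapping.single t c) = Const c * (\<Prod>i\<in>Poly_Mapping.keys t. s i ^ Poly_Mapping.lookup t i)"
  by (subst psubst_superset[of "{t}"]) auto

lemma expand_mpoly: "p = (\<Sum>t\<in>Poly_Mapping.keys p. Poly_Mapping.single t (Poly_Mapping.lookup p t))"
proof (rule poly_mapping_eqI)
  fix k
  show "Poly_Mapping.lookup p k = Poly_Mapping.lookup (\<Sum>t\<in>Poly_Mapping.keys p. Poly_Mapping.single t (Poly_Mapping.lookup p t)) k"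
    by (simp add: lookup_sum lookup_single when_def in_keys_iff sum.delta')
qed

lemma monomial_add:
  fixes s :: "nat \<Rightarrow> 'a::comm_semiring_1 mpoly" and t u :: "nat \<Rightarrow>\<^sub>0 nat"
  shows "(\<Prod>i\<in>Poly_Mapping.keys (t + u). s i ^ Poly_Mapping.lookup (t + u) i)
       = (\<Prod>i\<in>Poly_Mapping.keys t. s i ^ Poly_Mapping.lookup t i) * (\<Prod>i\<in>Poly_Mapping.keys u. s i ^ Poly_Mapping.lookup u i)"
proof -
  let ?T = "Poly_Mapping.keys t \<union> Poly_Mapping.keys u"
  have *: "(\<Prod>i\<in>Poly_Mapping.keys v. s i ^ Poly_Mapping.lookup v i) = (\<Prod>i\<in>?T. s i ^ Poly_Mapping.lookup v i)"
    if "Poly_Mapping.keys v \<subseteq> ?T" for v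
    by (rule prod.mono_neutral_left) (use that in \<open>auto simp: in_keys_iff\<close>)
  have "(\<Prod>i\<in>Poly_Mapping.keys (t + u). s i ^ Poly_Mapping.lookup (t + u) i)
      = (\<Prod>i\<in>?T. s i ^ Poly_Mapping.lookup (t + u) i)"
    by (rule *[OF Poly_Mapping.keys_add])
  also have "\<dots> = (\<Prod>i\<in>?T. s i ^ Poly_Mapping.lookup t i) * (\<Prod>i\<in>?T. s i ^ Poly_Mapping.lookup u i)"
    by (simp only: lookup_add power_add prod.distrib)
  finally show ?thesis
    by (simp only: *[OF Un_upper1] *[OF Un_upper2])
qed

lemma psubst_mult: "psubst s (p * q) = psubst s p * psubst s q"
proof -
  have "p * q = (\<Sum>t\<in>Poly_Mapping.keys p. \<Sum>u\<in>Poly_Mapping.keys q.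
      Poly_Mapping.single (t + u) (Poly_Mapping.lookup p t * Poly_Mapping.lookup q u))"
    by (subst expand_mpoly[of p], subst expand_mpoly[of q])
       (simp add: sum_product mult_single)
  then show ?thesis
    by (simp add: psubst_sum psubst_single monomial_add Const_mult)
       (simp add: psubst_def sum_product mult_ac)
qed

lemma psubst_Const [simp]: "psubst s (Const c) = Const c"
  unfolding Const_def by (subst psubst_single) (simp add: Const_def)

lemma psubst_1 [simp]: "psubst s 1 = 1"
  using psubst_Const[of s 1] by simp

lemma psubst_Var [simp]: "psubst s (Var i) = s i"
  unfolding Var_def by (subst psubst_single) simp

lemma psubst_power: "psubst s (p ^ n) = psubst s p ^ n"
  by (induction n) (simp_all add: psubst_mult)

lemma psubst_prod: "psubst s (\<Prod>i\<in>A. f i) = (\<Prod>i\<in>A. psubst s (f i))"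
  by (induction A rule: infinite_finite_induct) (simp_all add: psubst_mult)

lemma psubst_psubst: "psubst r (psubst s p) = psubst (\<lambda>i. psubst r (s i)) p"
  by (simp add: psubst_def[of s] psubst_def[of "\<lambda>i. psubst r (s i)"] psubst_sum psubst_mult
      psubst_prod psubst_power)

lemma Var_power: "Var i ^ n = Poly_Mapping.single (Poly_Mapping.single i n) (1::'a::comm_semiring_1)"
  by (induction n) (simp_all add: Var_def mult_single single_add[symmetric])

lemma monomial_Var: "(\<Prod>i\<in>Poly_Mapping.keys t. (Var i :: 'a::comm_semiring_1 mpoly) ^ Poly_Mapping.lookup t i) = Poly_Mapping.single t 1"
proof -
  have *: "(\<Prod>i\<in>A. Poly_Mapping.single (f i) (1::'a)) = Poly_Mapping.single (\<Sum>i\<in>A. f i) 1"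
    for A :: "nat set" and f :: "nat \<Rightarrow> nat \<Rightarrow>\<^sub>0 nat"
    by (induction A rule: infinite_finite_induct) (simp_all add: mult_single)
  show ?thesis
    unfolding Var_power * expand_mpoly[of t, symmetric] ..
qed

lemma psubst_id [simp]: "psubst Var p = p"
  unfolding psubst_def monomial_Var
  by (subst (3) expand_mpoly) (simp add: Const_def mult_single)


section \<open>The delta operator\<close>

definition skip :: "nat \<Rightarrow> nat \<Rightarrow> nat" where
  "skip j k = (if k < j then k else Suc k)"

lemma psubst_skip_eq_0_iff [simp]: "psubst (\<lambda>k. Var (skip j k)) p = 0 \<longleftrightarrow> p = 0"
proof
  let ?u = "\<lambda>k. Var (if k \<le> j then k else k - 1)"
  assume "psubst (\<lambda>k. Var (skip j k)) p = 0"
  then have "psubst ?u (psubst (\<lambda>k. Var (skip j k)) p) = 0" by simp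
  moreover have "psubst ?u (psubst (\<lambda>k. Var (skip j k)) p) = psubst Var p"
    unfolding psubst_psubst by (rule arg_cong[of _ _ "\<lambda>f. psubst f p"]) (auto simp: skip_def fun_eq_iff)
  ultimately show "p = 0" by simp
qed simp

text \<open>
  \<open>drop_var j f\<close> is $f(x_1, \ldots, \widehat{x_{j+1}}, \ldots, x_{c+1})$ for a rational
  function $f$ in $c$ variables. The value does not depend on the representing fraction; see
  \<open>drop_var_Fract\<close>.
\<close>

definition drop_var :: "nat \<Rightarrow> 'a::field mpoly fract \<Rightarrow> 'a mpoly fract" where
  "drop_var j r = (THE r'. \<exists>f g. g \<noteq> 0 \<and> r = Fract f g \<and>
     r' = Fract (psubst (\<lambda>k. Var (skip j k)) f) (psubst (\<lambda>k. Var (skip j k)) g))"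

lemma drop_var_Fract:
  fixes f g :: "'a::field mpoly"
  shows "drop_var j (Fract f g) = Fract (psubst (\<lambda>k. Var (skip j k)) f) (psubst (\<lambda>k. Var (skip j k)) g)"
proof (cases "g = 0")
  case True
  have "drop_var j (0 :: 'a mpoly fract) = 0"
    unfolding drop_var_def
  proof (rule the_equality)
    show "\<exists>f g. g \<noteq> 0 \<and> 0 = Fract f g \<and>
        0 = Fract (psubst (\<lambda>k. Var (skip j k)) f) (psubst (\<lambda>k. Var (skip j k)) g)"
      by (intro exI[of _ 0] exI[of _ 1]) (simp add: fract_collapse)
  next
    fix r' :: "'a mpoly fract"
    assume "\<exists>f g. g \<noteq> 0 \<and> 0 = Fract f g \<and>
        r' = Fract (psubst (\<lambda>k. Var (skip j k)) f) (psubst (\<lambda>k. Var (skip j k)) g)"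
    then obtain f g :: "'a mpoly" where fg: "g \<noteq> 0" "Fract 0 1 = Fract f g"
      "r' = Fract (psubst (\<lambda>k. Var (skip j k)) f) (psubst (\<lambda>k. Var (skip j k)) g)"
      unfolding Zero_fract_def by blast
    then have "f = 0" by (simp add: eq_fract)
    then show "r' = 0" using fg(3) by (simp add: fract_collapse)
  qed
  with True show ?thesis by (simp add: fract_collapse)
next
  case False
  show ?thesis
    unfolding drop_var_def
  proof (rule the_equality)
    fix r' assume "\<exists>f' g'. g' \<noteq> 0 \<and> Fract f g = Fract f' g' \<and>
        r' = Fract (psubst (\<lambda>k. Var (skip j k)) f') (psubst (\<lambda>k. Var (skip j k)) g')"
    then show "r' = Fract (psubst (\<lambda>k. Var (skip j k)) f) (psubst (\<lambda>k. Var (skip j k)) g)"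
      using False by (auto simp: eq_fract simp flip: psubst_mult)
  qed (use False in blast)
qed

text \<open>
  \<open>delta a b f\<close> is $\delta_{a;b}(f)$ for $b \ge 1$ and $1 \le a \le c + 1$, where $f$ is a rational
  function in $c$ variables. The number $c$ is not an argument: it enters neither the two
  determinants nor the renaming of the variables of $f$.
\<close>

definition delta :: "nat \<Rightarrow> nat \<Rightarrow> 'a::{field,finite} mpoly fract \<Rightarrow> 'a mpoly fract" where
  "delta a b f =
     Determinant.det (mat a a (\<lambda>(i, j).
       if i < a - 1 then to_fract (Var j ^ (CARD('a) ^ i))
       else to_fract (Var j ^ (CARD('a) ^ b)) * drop_var j f))
     / Determinant.det (mat a a (\<lambda>(i, j). to_fract (Var j ^ (CARD('a) ^ i))))"


section \<open>Dickson invariants\<close>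

text \<open>
  $Q_{s,i}$, read off as $(-1)^{s-i}$ times the coefficient of $X^{q^i}$ in
  $\prod_\lambda (X + \lambda_1 x_1 + \cdots + \lambda_s x_s)$.
\<close>

definition dickson :: "nat \<Rightarrow> nat \<Rightarrow> 'a::{field,finite} mpoly" where
  "dickson s i = (- 1) ^ (s - i) *
     Polynomial.coeff (\<Prod>l\<in>carrier_vec s. [:(\<Sum>j<s. Const (l $ j) * Var j), 1:]) (CARD('a) ^ i)"


section \<open>The truncated polynomial algebra and its invariants\<close>

definition S_ring :: "nat \<Rightarrow> 'a::field mpoly ring" where
  "S_ring n = \<lparr>carrier = {p. \<forall>t\<in>Poly_Mapping.keys p. Poly_Mapping.keys t \<subseteq> {..<n}},
     monoid.mult = (*), one = 1, zero = 0, add = (+)\<rparr>"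

definition I_ideal :: "nat \<Rightarrow> nat \<Rightarrow> 'a::{field,finite} mpoly set" where
  "I_ideal m n = Idl\<^bsub>S_ring n\<^esub> ((\<lambda>i. Var i ^ (CARD('a) ^ m)) ` {..<n})"

definition Q_class :: "nat \<Rightarrow> nat \<Rightarrow> 'a::{field,finite} mpoly \<Rightarrow> 'a mpoly set" where
  "Q_class m n p = I_ideal m n +>\<^bsub>S_ring n\<^esub> p"

definition Q_ring :: "nat \<Rightarrow> nat \<Rightarrow> 'a::{field,finite} mpoly set ring" where
  "Q_ring m n = S_ring n Quot I_ideal m n"

text \<open>The $\mathbb F_q$-algebra $\mathcal Q_m(n)$; a scalar acts as the class of the constant.\<close>

definition Q_alg :: "nat \<Rightarrow> nat \<Rightarrow> ('a::{field,finite}, 'a mpoly set) module" where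
  "Q_alg m n =
     \<lparr>carrier = carrier (Q_ring m n), monoid.mult = monoid.mult (Q_ring m n), one = one (Q_ring m n),
      zero = zero (Q_ring m n), add = add (Q_ring m n),
      smult = (\<lambda>c A. Q_class m n (Const c) \<otimes>\<^bsub>Q_ring m n\<^esub> A)\<rparr>"

definition GL :: "nat \<Rightarrow> 'a::field mat set" where
  "GL n = {g \<in> carrier_mat n n. invertible_mat g}"

definition lin_subst :: "nat \<Rightarrow> 'a::field mat \<Rightarrow> 'a mpoly \<Rightarrow> 'a mpoly" where
  "lin_subst n g = psubst (\<lambda>j. if j < n then \<Sum>i<n. Const (g $$ (i, j)) * Var i else Var j)"

text \<open>$P(2,1)$, the stabilizer of $\mathrm{span}(x_1, x_2)$.\<close>

definition P21 :: "'a::field mat set" where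
  "P21 = {g \<in> GL 3. lin_subst 3 g ` {Const a * Var 0 + Const b * Var 1 | a b. True}
                   = {Const a * Var 0 + Const b * Var 1 | a b. True}}"

text \<open>The action induced on cosets; see \<open>Q_act_Q_class\<close>.\<close>

definition Q_act :: "nat \<Rightarrow> nat \<Rightarrow> 'a::{field,finite} mat \<Rightarrow> 'a mpoly set \<Rightarrow> 'a mpoly set" where
  "Q_act m n g A = (\<Union>p\<in>A. Q_class m n (lin_subst n g p))"

definition Q_invariants ::
    "nat \<Rightarrow> nat \<Rightarrow> 'a::{field,finite} mat set \<Rightarrow> ('a, 'a mpoly set) module" where
  "Q_invariants m n G =
     Q_alg m n\<lparr>carrier := {A \<in> carrier (Q_alg m n). \<forall>g\<in>G. Q_act m n g A = A}\<rparr>"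

lemma prime_CHAR_finite: "prime CHAR('a::{field,finite})"
  by (rule prime_CHAR_semidom) (simp add: finite_imp_CHAR_pos)

lemma card_power_CHAR: "\<exists>k. CARD('a::{field,finite}) = CHAR('a) ^ k"
proof -
  let ?p = "CHAR('a)"
  let ?G = "add_monoid (class_ring :: 'a ring)"
  have G: "group ?G"
    by (rule groupI) (auto simp: algebra_simps intro: exI[of _ "- x" for x])
  have "r = ?p" if r: "prime r" "r dvd CARD('a)" for r
  proof -
    obtain k where "CARD('a) = r ^ 1 * k" using r(2) by auto
    then obtain H where H: "subgroup H ?G" "card H = r ^ 1"
      using sylow_thm[OF r(1) G, of 1 k] by (auto simp: Coset.order_def)
    interpret H: group "?G\<lparr>carrier := H\<rparr>"
      by (rule group.subgroup_imp_group[OF G H(1)])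
    have "H \<noteq> {0}" using H(2) r(1) by auto
    moreover have "0 \<in> H" using subgroup.one_closed[OF H(1)] by simp
    ultimately obtain h where h: "h \<in> H" "h \<noteq> 0" by auto
    have "h [^]\<^bsub>?G\<lparr>carrier := H\<rparr>\<^esub> card H = \<one>\<^bsub>?G\<lparr>carrier := H\<rparr>\<^esub>"
      using H.pow_order_eq_1[of h] h by (simp add: Coset.order_def)
    moreover have "h [^]\<^bsub>?G\<lparr>carrier := H\<rparr>\<^esub> n = of_nat n * h" for n :: nat
      by (induction n) (simp_all add: H.nat_pow_Suc algebra_simps)
    ultimately have "of_nat (card H) * h = 0" by simp
    then have "of_nat r = (0::'a)" using h H(2) by simp
    then have "?p dvd r" by (simp add: of_nat_eq_0_iff_char_dvd)
    moreover have "prime ?p"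
      by (rule prime_CHAR_semidom) (simp add: finite_imp_CHAR_pos)
    ultimately show "r = ?p"
      using r(1) primes_dvd_imp_eq by blast
  qed
  then have *: "prime_factors CARD('a) \<subseteq> {?p}" by auto
  have "CARD('a) = (\<Prod>p\<in>prime_factors CARD('a). p ^ multiplicity p CARD('a))"
    by (rule prime_factorization_nat) simp
  also have "\<dots> = (\<Prod>p\<in>{?p}. p ^ multiplicity p CARD('a))"
    by (rule prod.mono_neutral_left) (use * prime_CHAR_finite[where 'a='a] in \<open>auto simp: prime_factors_multiplicity\<close>)
  finally show ?thesis by auto
qed

lemma CHAR_mpoly: "CHAR('a::field mpoly) = CHAR('a)"
proof -
  have *: "of_nat k = (Const (of_nat k) :: 'a mpoly)" for k
    by (induction k) (simp_all add: Const_add)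
  have "Const c = 0 \<longleftrightarrow> c = 0" for c :: 'a
    by (metis Const_0 Const_def lookup_single_eq lookup_zero)
  then have "of_nat k = (0 :: 'a mpoly) \<longleftrightarrow> CHAR('a) dvd k" for k
    by (simp add: * of_nat_eq_0_iff_char_dvd)
  then show ?thesis by (intro CHAR_eqI) auto
qed

lemma S_ring_simps [simp]:
  "monoid.mult (S_ring n) = (*)" "one (S_ring n) = 1" "zero (S_ring n) = 0" "add (S_ring n) = (+)"
  by (simp_all add: S_ring_def)

lemma in_S_ring: "p \<in> carrier (S_ring n) \<longleftrightarrow> (\<forall>t\<in>Poly_Mapping.keys p. Poly_Mapping.keys t \<subseteq> {..<n})"
  by (simp add: S_ring_def)

lemma S_add: "p \<in> carrier (S_ring n) \<Longrightarrow> q \<in> carrier (S_ring n) \<Longrightarrow> p + q \<in> carrier (S_ring n)"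
  unfolding in_S_ring using Poly_Mapping.keys_add[of p q] by blast

lemma S_uminus: "p \<in> carrier (S_ring n) \<Longrightarrow> - p \<in> carrier (S_ring n)"
  by (simp add: in_S_ring)

lemma S_mult: "p \<in> carrier (S_ring n) \<Longrightarrow> q \<in> carrier (S_ring n) \<Longrightarrow> p * q \<in> carrier (S_ring n)"
  unfolding in_S_ring
proof
  fix t assume pq: "\<forall>t\<in>Poly_Mapping.keys p. Poly_Mapping.keys t \<subseteq> {..<n}"
      "\<forall>t\<in>Poly_Mapping.keys q. Poly_Mapping.keys t \<subseteq> {..<n}" 
    and "t \<in> Poly_Mapping.keys (p * q)"
  then obtain u v where "t = u + v" "u \<in> Poly_Mapping.keys p" "v \<in> Poly_Mapping.keys q"
    using keys_mult[of p q] by blast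
  then show "Poly_Mapping.keys t \<subseteq> {..<n}"
    using pq Poly_Mapping.keys_add[of u v] by blast
qed

lemma S_Const: "Const c \<in> carrier (S_ring n)"
  by (simp add: in_S_ring Const_def)

lemma S_Var: "i < n \<Longrightarrow> Var i \<in> carrier (S_ring n)"
  by (simp add: in_S_ring Var_def)

lemma S_0: "0 \<in> carrier (S_ring n)" and S_1: "1 \<in> carrier (S_ring n)"
  using S_Const[of 0 n] S_Const[of 1 n] by simp_all

lemma S_sum: "(\<And>i. i \<in> A \<Longrightarrow> f i \<in> carrier (S_ring n)) \<Longrightarrow> sum f A \<in> carrier (S_ring n)"
  by (induction A rule: infinite_finite_induct) (simp_all add: S_0 S_add)

lemma S_prod: "(\<And>i. i \<in> A \<Longrightarrow> f i \<in> carrier (S_ring n)) \<Longrightarrow> prod f A \<in> carrier (S_ring n)"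
  by (induction A rule: infinite_finite_induct) (simp_all add: S_1 S_mult)

lemma S_power: "p \<in> carrier (S_ring n) \<Longrightarrow> p ^ k \<in> carrier (S_ring n)"
  by (induction k) (simp_all add: S_1 S_mult)

lemma cring_S_ring: "cring (S_ring n)"
proof (rule cringI)
  show "abelian_group (S_ring n)"
    by (rule abelian_groupI) (auto simp: S_add S_0 algebra_simps intro!: bexI[of _ "- x" for x] S_uminus)
  show "comm_monoid (S_ring n)"
    by (rule comm_monoidI) (auto simp: S_mult S_1 algebra_simps)
qed (auto simp: algebra_simps)

lemma S_lin_subst: "p \<in> carrier (S_ring n) \<Longrightarrow> lin_subst n g p \<in> carrier (S_ring n)"
  unfolding lin_subst_def psubst_def
  by (intro S_sum S_mult S_Const S_prod S_power) (auto simp: in_S_ring[of p] intro!: S_sum S_mult S_Const S_Var)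

lemma S_minus: assumes "p \<in> carrier (S_ring n)" "q \<in> carrier (S_ring n)"
  shows "p \<ominus>\<^bsub>S_ring n\<^esub> q = p - q"
proof -
  interpret cring "S_ring n" by (rule cring_S_ring)
  have "\<ominus>\<^bsub>S_ring n\<^esub> q = - q"
    by (rule minus_equality) (use assms in \<open>auto simp: S_uminus\<close>)
  then show ?thesis by (simp add: a_minus_def)
qed

lemma lin_subst_add: "lin_subst n g (p + q) = lin_subst n g p + lin_subst n g q"
  and lin_subst_mult: "lin_subst n g (p * q) = lin_subst n g p * lin_subst n g q"
  and lin_subst_Const: "lin_subst n g (Const c) = Const c"
  and lin_subst_0: "lin_subst n g 0 = 0"
  by (simp_all add: lin_subst_def psubst_add psubst_mult)

lemma lin_subst_diff: "lin_subst n g (p - q) = lin_subst n g p - lin_subst n g q"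
  using lin_subst_add[of n g "p - q" q] by (simp add: algebra_simps)

lemma I_gens: "(\<lambda>i. Var i ^ (CARD('a) ^ m)) ` {..<n} \<subseteq> carrier (S_ring n :: 'a::{field,finite} mpoly ring)"
  by (auto intro: S_power S_Var)

lemma ideal_I: "ideal (I_ideal m n) (S_ring n :: 'a::{field,finite} mpoly ring)"
  unfolding I_ideal_def
  by (rule ring.genideal_ideal[OF cring.axioms(1)[OF cring_S_ring] I_gens])

lemma lin_subst_I:
  fixes p :: "'a::{field,finite} mpoly"
  assumes "p \<in> I_ideal m n"
  shows "lin_subst n g p \<in> I_ideal m n"
proof -
  let ?R = "S_ring n :: 'a mpoly ring"
  interpret cring ?R by (rule cring_S_ring)
  interpret I: ideal "I_ideal m n" ?R by (rule ideal_I)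
  let ?J = "{p \<in> carrier ?R. lin_subst n g p \<in> I_ideal m n}"
  have "ideal ?J ?R"
  proof (rule idealI)
    show "subgroup ?J (add_monoid ?R)"
    proof (rule add.subgroupI)
      show "?J \<noteq> {}" using S_0 I.zero_closed by (auto simp: lin_subst_0)
      fix a assume "a \<in> ?J"
      moreover from this have "\<ominus>\<^bsub>?R\<^esub> a = 0 - a" "\<ominus>\<^bsub>?R\<^esub> lin_subst n g a = 0 - lin_subst n g a"
        using S_minus[OF S_0, of a n] S_minus[OF S_0, of "lin_subst n g a" n] by (auto simp: a_minus_def S_lin_subst)
      ultimately show "\<ominus>\<^bsub>?R\<^esub> a \<in> ?J"
        using I.a_inv_closed[of "lin_subst n g a"] a_inv_closed[of a] lin_subst_diff[of n g 0 a] by (auto simp: lin_subst_0)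
    next
      fix a b assume "a \<in> ?J" "b \<in> ?J"
      then show "a \<oplus>\<^bsub>?R\<^esub> b \<in> ?J"
        using I.a_closed[of "lin_subst n g a" "lin_subst n g b"]
        by (simp add: lin_subst_add S_add)
    qed simp
  next
    fix a x assume "a \<in> ?J" "x \<in> carrier ?R"
    then show "x \<otimes>\<^bsub>?R\<^esub> a \<in> ?J" "a \<otimes>\<^bsub>?R\<^esub> x \<in> ?J"
      using I.I_l_closed[of "lin_subst n g a" "lin_subst n g x"]
        I.I_r_closed[of "lin_subst n g a" "lin_subst n g x"]
      by (simp_all add: lin_subst_mult S_mult S_lin_subst)
  qed (rule ring_axioms)
  moreover have "(\<lambda>i. Var i ^ (CARD('a) ^ m)) ` {..<n} \<subseteq> ?J"
  proof clarsimp
    fix i assume i: "i < n"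
    obtain k where k: "CARD('a) = CHAR('a) ^ k" using card_power_CHAR by blast
    have "lin_subst n g (Var i ^ (CARD('a) ^ m)) = (\<Sum>j<n. Const (g $$ (j, i)) * Var j) ^ (CARD('a) ^ m)"
      using i by (simp add: lin_subst_def psubst_power)
    also have "\<dots> = (\<Sum>j<n. (Const (g $$ (j, i)) * Var j) ^ (CARD('a) ^ m))"
      by (rule freshmans_dream_sum'[where n = "k * m"]) (simp_all add: CHAR_mpoly prime_CHAR_finite k power_mult)
    also have "\<dots> \<in> I_ideal m n"
    proof -
      have gen: "(Var j :: 'a mpoly) ^ (CARD('a) ^ m) \<in> I_ideal m n" if "j < n" for j
        unfolding I_ideal_def using genideal_self[OF I_gens[of m n]] that by auto
      have "Const c * Var j ^ (CARD('a) ^ m) \<in> I_ideal m n" if "j < n" for j and c :: 'a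
        using I.I_l_closed[OF gen[OF that] S_Const[of c n]] by simp
      then have t: "(Const (g $$ (j, i)) * Var j) ^ (CARD('a) ^ m) \<in> I_ideal m n" if "j < n" for j
        using that by (simp add: power_mult_distrib flip: Const_power)
      have sum: "sum f A \<in> I_ideal m n" if "\<And>j. j \<in> A \<Longrightarrow> f j \<in> I_ideal m n"
        for f :: "nat \<Rightarrow> 'a mpoly" and A :: "nat set"
        using that by (induction A rule: infinite_finite_induct)
          (use I.zero_closed I.a_closed in auto)
      show ?thesis by (rule sum, rule t) simp
    qed
    finally show "Var i ^ (CARD('a) ^ m) \<in> carrier ?R \<and> lin_subst n g (Var i ^ (CARD('a) ^ m)) \<in> I_ideal m n"
      using i by (simp add: S_power S_Var)
  qed
  ultimately show ?thesis
    using genideal_minimal[of ?J] assms unfolding I_ideal_def by blast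
qed


lemma Q_class_eq_iff:
  fixes p q :: "'a::{field,finite} mpoly"
  assumes "p \<in> carrier (S_ring n)" "q \<in> carrier (S_ring n)"
  shows "Q_class m n p = Q_class m n q \<longleftrightarrow> p - q \<in> I_ideal m n"
  unfolding Q_class_def
  using ring.quotient_eq_iff_same_a_r_cos[OF cring.axioms(1)[OF cring_S_ring] ideal_I assms, of m]
  by (simp add: S_minus assms)

lemma Q_class_hom: "Q_class m n \<in> Ring.ring_hom (S_ring n) (Q_ring m n :: 'a::{field,finite} mpoly set ring)"
  unfolding Q_class_def Q_ring_def by (rule ideal.rcos_ring_hom[OF ideal_I])

lemma cring_Q_ring: "cring (Q_ring m n)"
  unfolding Q_ring_def by (rule ideal.quotient_is_cring[OF ideal_I cring_S_ring])

lemma carrier_Q_ring: "carrier (Q_ring m n :: 'a::{field,finite} mpoly set ring) = Q_class m n ` carrier (S_ring n)"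
  by (auto simp: Q_ring_def FactRing_def A_RCOSETS_def' Q_class_def)

lemma mem_Q_classD:
  fixes p q :: "'a::{field,finite} mpoly"
  assumes "p \<in> Q_class m n q" "q \<in> carrier (S_ring n)"
  shows "p \<in> carrier (S_ring n)" "p - q \<in> I_ideal m n"
proof -
  interpret cring "S_ring n :: 'a mpoly ring" by (rule cring_S_ring)
  interpret I: ideal "I_ideal m n" "S_ring n :: 'a mpoly ring" by (rule ideal_I)
  obtain h where h: "h \<in> I_ideal m n" "p = h + q"
    using assms(1) by (auto simp: Q_class_def a_r_coset_def')
  then show "p \<in> carrier (S_ring n)" "p - q \<in> I_ideal m n"
    using assms(2) I.Icarr[of h] by (auto simp: S_add)
qed

lemma self_mem_Q_class: "(p :: 'a::{field,finite} mpoly) \<in> Q_class m n p"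
proof -
  interpret I: ideal "I_ideal m n" "S_ring n :: 'a mpoly ring" by (rule ideal_I)
  have "0 \<in> (I_ideal m n :: 'a mpoly set)"
    using additive_subgroup.zero_closed[OF ideal.axioms(1)[OF ideal_I]] by simp
  then show ?thesis by (auto simp: Q_class_def a_r_coset_def' intro!: bexI[of _ 0])
qed

lemma Q_act_Q_class:
  fixes p :: "'a::{field,finite} mpoly"
  assumes "p \<in> carrier (S_ring n)"
  shows "Q_act m n g (Q_class m n p) = Q_class m n (lin_subst n g p)"
proof -
  have "Q_class m n (lin_subst n g q) = Q_class m n (lin_subst n g p)" if "q \<in> Q_class m n p" for q
    using mem_Q_classD[OF that assms] assms
    by (subst Q_class_eq_iff) (auto simp: S_lin_subst lin_subst_I simp flip: lin_subst_diff)
  then show ?thesis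
    unfolding Q_act_def using self_mem_Q_class[of p m n] by blast
qed

lemma Q_alg_simps [simp]:
  "carrier (Q_alg m n) = carrier (Q_ring m n)" "add (Q_alg m n) = add (Q_ring m n)"
  "zero (Q_alg m n) = zero (Q_ring m n)" "monoid.mult (Q_alg m n) = monoid.mult (Q_ring m n)"
  "one (Q_alg m n) = one (Q_ring m n)"
  "smult (Q_alg m n) c A = Q_class m n (Const c) \<otimes>\<^bsub>Q_ring m n\<^esub> A"
  by (simp_all add: Q_alg_def)

lemma algebra_Q_alg: "algebra (class_ring :: 'a::{field,finite} ring) (Q_alg m n)"
proof -
  interpret Q: cring "Q_ring m n :: 'a mpoly set ring" by (rule cring_Q_ring)
  have hom: "Q_class m n (Const c) \<in> carrier (Q_ring m n)" for c :: 'a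
    by (rule ring_hom_closed[OF Q_class_hom S_Const])
  have one: "Q_class m n 1 = one (Q_ring m n :: 'a mpoly set ring)"
    by (rule ring_hom_one[OF Q_class_hom, unfolded S_ring_simps])
  let ?V = "Q_alg m n :: ('a, 'a mpoly set) module"
  have "cring ?V"
  proof (rule cringI)
    show "abelian_group ?V"
    proof (rule abelian_groupI)
      fix x assume "x \<in> carrier ?V"
      then show "\<exists>y\<in>carrier ?V. y \<oplus>\<^bsub>?V\<^esub> x = \<zero>\<^bsub>?V\<^esub>"
        by (intro bexI[of _ "\<ominus>\<^bsub>Q_ring m n\<^esub> x"]) (simp_all add: Q.l_neg)
    qed (simp_all add: Q.a_ac)
    show "Group.comm_monoid ?V"
      by (rule comm_monoidI) (simp_all add: Q.m_ac)
  qed (simp add: Q.l_distr)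
  then show ?thesis
  proof (rule algebraI[rotated])
    show "cring (class_ring :: 'a ring)" by (rule class_cring.is_cring)
  next
    fix a b :: 'a and x :: "'a mpoly set" assume x: "x \<in> carrier (Q_alg m n)"
    show "(a \<oplus>\<^bsub>class_ring\<^esub> b) \<odot>\<^bsub>Q_alg m n\<^esub> x = a \<odot>\<^bsub>Q_alg m n\<^esub> x \<oplus>\<^bsub>Q_alg m n\<^esub> b \<odot>\<^bsub>Q_alg m n\<^esub> x"
      using x hom ring_hom_add[OF Q_class_hom S_Const S_Const, of m n a b]
      by (simp add: Const_add Q.l_distr)
    show "(a \<otimes>\<^bsub>class_ring\<^esub> b) \<odot>\<^bsub>Q_alg m n\<^esub> x = a \<odot>\<^bsub>Q_alg m n\<^esub> (b \<odot>\<^bsub>Q_alg m n\<^esub> x)"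
      using x hom ring_hom_mult[OF Q_class_hom S_Const S_Const, of m n a b]
      by (simp add: Const_mult Q.m_assoc)
    show "\<one>\<^bsub>class_ring\<^esub> \<odot>\<^bsub>Q_alg m n\<^esub> x = x"
      using x one by simp
  qed (use hom in \<open>auto simp: Q.r_distr Q.m_assoc\<close>)
qed

lemma vectorspace_Q_invariants:
  "vectorspace (class_ring :: 'a::{field,finite} ring) (Q_invariants m n G)"
proof -
  let ?V = "Q_alg m n :: ('a, 'a mpoly set) module"
  interpret A: algebra "class_ring :: 'a ring" ?V by (rule algebra_Q_alg)
  interpret Q: cring "Q_ring m n :: 'a mpoly set ring" by (rule cring_Q_ring)
  let ?N = "{A \<in> carrier ?V. \<forall>g\<in>G. Q_act m n g A = A}"
  have 0: "zero ?V = Q_class m n 0"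
    unfolding Q_alg_simps
    by (rule ring_hom_zero[OF Q_class_hom cring.axioms(1)[OF cring_S_ring]
          cring.axioms(1)[OF cring_Q_ring], unfolded S_ring_simps, symmetric])
  have fixed: "Q_class m n p \<in> ?N \<longleftrightarrow> (\<forall>g\<in>G. Q_class m n (lin_subst n g p) = Q_class m n p)"
    if "p \<in> carrier (S_ring n)" for p
    using that by (simp add: Q_act_Q_class carrier_Q_ring)
  have repr: "\<exists>p\<in>carrier (S_ring n). v = Q_class m n p" if "v \<in> ?N" for v
    using that by (auto simp: carrier_Q_ring)
  have add: "Q_class m n p \<oplus>\<^bsub>?V\<^esub> Q_class m n q = Q_class m n (p + q)"
    if "p \<in> carrier (S_ring n)" "q \<in> carrier (S_ring n)" for p q
    unfolding Q_alg_simps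
    by (rule ring_hom_add[OF Q_class_hom that, unfolded S_ring_simps, symmetric])
  have smult: "c \<odot>\<^bsub>?V\<^esub> Q_class m n p = Q_class m n (Const c * p)"
    if "p \<in> carrier (S_ring n)" for c p
    unfolding Q_alg_simps
    by (rule ring_hom_mult[OF Q_class_hom S_Const that, unfolded S_ring_simps, symmetric])
  have "submodule class_ring ?N ?V"
  proof (rule submodule.intro)
    show "Module.module class_ring ?V" by (rule A.module_axioms)
    show "?N \<subseteq> carrier ?V" by (rule Collect_restrict)
    show "zero ?V \<in> ?N"
      unfolding 0 by (subst fixed) (simp_all add: S_0 lin_subst_0)
  next
    fix v w assume vw: "v \<in> ?N" "w \<in> ?N"
    from repr[OF vw(1)] repr[OF vw(2)] obtain p q where
      p: "p \<in> carrier (S_ring n)" "v = Q_class m n p" and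
      q: "q \<in> carrier (S_ring n)" "w = Q_class m n q" by blast
    have "Q_class m n (lin_subst n g (p + q)) = Q_class m n (p + q)" if "g \<in> G" for g
      unfolding lin_subst_add add[OF S_lin_subst[OF p(1)] S_lin_subst[OF q(1)], symmetric]
        add[OF p(1) q(1), symmetric]
      using vw that unfolding p(2) q(2) fixed[OF p(1)] fixed[OF q(1)] by simp
    then show "v \<oplus>\<^bsub>?V\<^esub> w \<in> ?N"
      unfolding p(2) q(2) add[OF p(1) q(1)] fixed[OF S_add[OF p(1) q(1)]] by blast
  next
    fix c :: 'a and v assume v: "v \<in> ?N"
    from repr[OF v] obtain p where p: "p \<in> carrier (S_ring n)" "v = Q_class m n p" by blast
    have "Q_class m n (lin_subst n g (Const c * p)) = Q_class m n (Const c * p)" if "g \<in> G" for g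
      unfolding lin_subst_mult lin_subst_Const smult[OF S_lin_subst[OF p(1)], symmetric]
        smult[OF p(1), symmetric]
      using v that unfolding p(2) fixed[OF p(1)] by simp
    then show "c \<odot>\<^bsub>?V\<^esub> v \<in> ?N"
      unfolding p(2) smult[OF p(1)] fixed[OF S_mult[OF S_Const p(1)]] by blast
  qed
  then show ?thesis
    unfolding Q_invariants_def vectorspace_def using A.submodule_is_module class_field by blast
qed


section \<open>The six families\<close>

definition qint :: "nat \<Rightarrow> nat \<Rightarrow> nat" where
  "qint q a = (q ^ a - 1) div (q - 1)"

text \<open>
  $(i_1, i_2) \in \Delta^m_2$, for $m \ge 2$. All divisions are exact, and no difference is truncated.
\<close>

definition Delta2 :: "nat \<Rightarrow> nat \<Rightarrow> (nat \<times> nat) set" where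
  "Delta2 q m = {(i1, i2). \<exists>l1 l2. l1 \<le> m - 2 \<and> l2 \<le> l1 \<and>
     (q ^ l1 - q ^ l2) div (q - 1) \<le> i1 \<and> i1 < (q ^ (l1 + 1) - q ^ l2) div (q - 1) \<and>
     (q ^ l2 - 1) div (q - 1) \<le> i2 \<and> i2 < (q ^ (l2 + 1) - 1) div (q - 1)}"

datatype index = Fam1 nat nat nat | Fam2 nat nat | Fam3 nat nat | Fam4 nat | Fam5 nat | Fam6

definition indices :: "nat \<Rightarrow> nat \<Rightarrow> index set" where
  "indices q m =
     {Fam1 i1 i2 i | i1 i2 i. (i1, i2) \<in> Delta2 q m \<and> i < qint q (m - 2)} \<union>
     {Fam2 i1 i2 | i1 i2. (i1, i2) \<in> Delta2 q m} \<union>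
     {Fam3 i1 i | i1 i. i1 < qint q m \<and> i < qint q (m - 1)} \<union>
     {Fam4 i1 | i1. i1 < qint q m} \<union>
     {Fam5 i | i. i < qint q m} \<union>
     {Fam6}"

fun basis_fun :: "nat \<Rightarrow> index \<Rightarrow> 'a::{field,finite} mpoly fract" where
  "basis_fun m (Fam1 i1 i2 i) = to_fract (dickson 2 1 ^ i1 * dickson 2 0 ^ i2 * dickson 3 2 ^ i)"
| "basis_fun m (Fam2 i1 i2) = to_fract (dickson 2 1 ^ i1 * dickson 2 0 ^ i2) * delta 3 m 1"
| "basis_fun m (Fam3 i1 i) = delta 2 m (to_fract (dickson 1 0 ^ i1 * dickson 2 1 ^ i))"
| "basis_fun m (Fam4 i1) = delta 2 m (to_fract (dickson 1 0 ^ i1) * delta 2 m 1)"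
| "basis_fun m (Fam5 i) = delta 1 m (delta 1 m (to_fract (dickson 1 0 ^ i)))"
| "basis_fun m Fam6 = delta 1 m (delta 1 m (delta 1 m 1))"

text \<open>
  The class in $\mathcal Q_m(3)$ of the polynomial that the fraction \<open>basis_fun m k\<close> is equal to.
\<close>

definition basis_class :: "nat \<Rightarrow> index \<Rightarrow> 'a::{field,finite} mpoly set" where
  "basis_class m k = Q_class m 3 (THE p. to_fract p = basis_fun m k)"

end

theory Submission
  imports Defs
begin

text \<open>
  Write $N = q^m$, $R = \mathcal Q_m(3)$, $P = P(2,1)$, and $X, Y, Z$ for the three variables. The
  proof counts: linear functionals show that $R^P$ has at most $q^d$ elements, where $d$ is the number
  of indices, and the $q^d$ linear combinations of the listed elements are pairwise different. Over a
  finite field the two facts together give a basis.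

  Upper bound. The coefficient $\tau$ of $(XYZ)^{N-1}$ is a functional on $R$ that is invariant under
  all linear substitutions (\<open>top_coeff_elementary_subst\<close>), and $(p, f) \mapsto \tau(pf)$ is
  non-degenerate (\<open>top_coeff_nondegenerate\<close>). So an invariant $p$ is determined by the functional
  $f \mapsto \tau(pf)$, which factors through the coinvariants $R_P$. It suffices that $R_P$ is
  spanned by the classes of as many test polynomials as there are indices. They are, with
  $V_2 = Z^q - X^{q-1}Z$, $W = (Y^q - X^{q-1}Y)^{q-1}$ and $V_3$ the product of all
  $Z + \lambda X + \mu Y$,
  $$Z^{(q-1)i}, \qquad X^{q-1}Y^{q-1}X^{(q-1)i}Z^{q-1}V_2^{(q-1)l}, \qquad
  X^{q-1}Y^{q-1}W X^{(q-1)q}Z^{q^2-1}Q_{2,1}^aQ_{2,0}^bV_3^{(q-1)l}$$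
  with $(a,b) \in \Delta^m_2$ in the last family; \<open>phi_vanishes\<close> says that a coinvariant functional
  that kills these kills everything. The engine is \<open>translation\<close>: averaging over the substitutions
  $A \mapsto A + aB$, $a \in \mathbb F_q$, kills every $e A^k B^{q-1-k}$ with $k < q - 1$ and $e$
  fixed. Together with the torus, which kills monomials whose exponents are not divisible by $q - 1$,
  this leaves only top powers $Y^{q-1}$, $Z^{q-1}$, $V_2^{q-1}$ beside the factors that force them.
  High powers of $V_2$ and $V_3$ are removed by expanding $Z^N = 0$ in them, and the exponents $(a,b)$ are
  brought into $\Delta^m_2$ by the relations that $X^N = Y^N = 0$ impose on the Dickson invariants
  (\<open>reduce_to_Delta2\<close>).

  Independence. Let $L = XY^q - X^qY$. Multiplication by $L$ annihilates families 3 to 6 in $R$, since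
  $L$ is the denominator of $\delta_2$ (\<open>L_annihilates\<close>). In families 1 and 2 the factors
  $Q_{3,2}^i$ and $\delta_3(1)$ are monic in $Z$ with equally spaced degrees below $N$, so that
  comparing leading coefficients leaves a relation between the elements $L Q_{2,1}^aQ_{2,0}^b$ with
  $(a,b) \in \Delta^m_2$ (\<open>Delta2_independent\<close>). Multiplication by $X$ then annihilates families 5
  and 6, and makes the elements of families 3 and 4 equal to explicit products, which are again separated
  by their leading coefficients in $Z$ and then by the coefficient of the largest power of $Y$.
  Families 5 and 6 consist of different monomials.
\<close>

section \<open>The numbers $[a]_q$\<close>

lemma qint_eq: assumes "q \<ge> 2" shows "(q - 1) * qint q n + 1 = q ^ n"
proof -
  have "q - 1 dvd q ^ n - 1"
  proof (induction n)
    case (Suc n)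
    have "q ^ Suc n - 1 = (q - 1) * q ^ n + (q ^ n - 1)"
      using assms by (simp add: diff_mult_distrib)
    then show ?case using Suc by simp
  qed simp
  then have "(q - 1) * qint q n = q ^ n - 1"
    unfolding qint_def by simp
  moreover have "q ^ n \<ge> 1" using assms by simp
  ultimately show ?thesis by linarith
qed

lemma qint_Suc: assumes "q \<ge> 2" shows "qint q (Suc n) = qint q n + q ^ n" "qint q (Suc n) = Suc (q * qint q n)"
proof -
  have "(q - 1) * qint q (Suc n) = (q - 1) * (qint q n + q ^ n)"
  proof -
    have "q ^ Suc n = (q - 1) * q ^ n + q ^ n" using assms by (simp add: diff_mult_distrib)
    then show ?thesis using qint_eq[OF assms, of n] qint_eq[OF assms, of "Suc n"] by (simp add: algebra_simps)
  qed
  then show "qint q (Suc n) = qint q n + q ^ n" using assms by simp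
  have "(q - 1) * qint q (Suc n) + 1 = q * ((q - 1) * qint q n + 1)"
    using qint_eq[OF assms, of n] qint_eq[OF assms, of "Suc n"] by simp
  also have "\<dots> = (q - 1) * Suc (q * qint q n) + 1"
  proof -
    obtain d where "q = Suc d" using assms by (cases q) auto
    then show ?thesis by (simp add: algebra_simps)
  qed
  finally have "(q - 1) * qint q (Suc n) = (q - 1) * Suc (q * qint q n)" by linarith
  then show "qint q (Suc n) = Suc (q * qint q n)" using assms by (simp only: mult_cancel1) simp
qed

lemma qint_0 [simp]: "qint q 0 = 0" by (simp add: qint_def)

lemma qint_1: assumes "q \<ge> 2" shows "qint q (Suc 0) = 1"
  using qint_Suc(1)[OF assms, of 0] by simp

lemma qint_2: assumes "q \<ge> 2" shows "qint q 2 = q + 1"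
  using qint_Suc(2)[OF assms, of "Suc 0"] qint_1[OF assms] by (simp add: numeral_2_eq_2)

lemma qint_mono: assumes "q \<ge> 2" "i \<le> j" shows "qint q i \<le> qint q j"
  using assms(2) by (induction j rule: dec_induct) (simp_all add: qint_Suc(1)[OF assms(1)])

lemma multiple_less_power_iff:
  assumes "q \<ge> 2" shows "(q - 1) * k < q ^ n \<longleftrightarrow> k \<le> qint q n"
proof -
  have "(q - 1) * k < q ^ n \<longleftrightarrow> (q - 1) * k \<le> (q - 1) * qint q n"
    using qint_eq[OF assms, of n] by linarith
  also have "\<dots> \<longleftrightarrow> k \<le> qint q n" using assms by simp
  finally show ?thesis .
qed

lemma Const_uminus: "Const (- c) = - (Const c :: 'a::comm_ring_1 mpoly)"
  by (simp add: Const_def single_uminus)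

lemma Const_diff: "Const (a - b) = Const a - (Const b :: 'a::comm_ring_1 mpoly)"
  using Const_add[of a "- b"] by (simp add: Const_uminus)

section \<open>Frobenius powers and additive polynomials\<close>

text \<open>
  The parameter \<open>field_type\<close> fixes the coefficient field, so that \<open>q\<close> is
  determined by the locale and not by the type of each polynomial.
\<close>

locale finite_field_polynomials =
  fixes q :: nat and field_type :: "'a::{field,finite} itself"
  assumes q_def: "q = CARD('a)"
begin

lemma q_ge2: "q \<ge> 2"
proof -
  have "card {0, 1::'a} \<le> CARD('a)" by (rule card_mono) auto
  then show ?thesis by (simp add: q_def)
qed

lemma q_power_CHAR: "\<exists>k. q ^ n = CHAR('a mpoly) ^ k"
  using card_power_CHAR[where 'a='a] by (metis CHAR_mpoly power_mult q_def)

lemma frob_add: "(A + B) ^ (q ^ n) = A ^ (q ^ n) + (B :: 'a mpoly) ^ (q ^ n)"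
proof -
  obtain k where k: "q ^ n = CHAR('a mpoly) ^ k" using q_power_CHAR by blast
  show ?thesis
    by (rule freshmans_dream'[OF _ k]) (simp add: CHAR_mpoly prime_CHAR_finite)
qed

lemma frob_add1: "(A + B) ^ q = A ^ q + (B :: 'a mpoly) ^ q"
  using frob_add[of A B 1] by simp

lemma frob_diff: "(A - B) ^ (q ^ n) = A ^ (q ^ n) - (B :: 'a mpoly) ^ (q ^ n)"
  using frob_add[of "A - B" B n] by (simp add: algebra_simps)

lemma frob_diff1: "(A - B) ^ q = A ^ q - (B :: 'a mpoly) ^ q"
  using frob_diff[of A B 1] by simp

lemma frob_uminus: "(- B) ^ (q ^ n) = - ((B :: 'a mpoly) ^ (q ^ n))"
  using frob_diff[of 0 B n] q_ge2 by simp

lemma frob_sum: "(\<Sum>i\<in>A. f i :: 'a mpoly) ^ (q ^ n) = (\<Sum>i\<in>A. f i ^ (q ^ n))"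
  using q_ge2 by (induction A rule: infinite_finite_induct) (simp_all add: frob_add)

lemma scalar_power_q1: assumes "c \<noteq> 0" shows "(c::'a) ^ (q - 1) = 1"
proof -
  have "\<Prod>(UNIV - {0}) = (\<Prod>y\<in>UNIV - {0}. c * y)"
    by (rule prod.reindex_bij_witness[of _ "\<lambda>y. c * y" "\<lambda>y. y / c"]) (use assms in auto)
  also have "\<dots> = c ^ (q - 1) * \<Prod>(UNIV - {0})"
    by (simp add: prod.distrib q_def card_Diff_singleton)
  finally show ?thesis by simp
qed

lemma scalar_frob: "(c::'a) ^ (q ^ n) = c"
proof (induction n)
  case (Suc n)
  have "c ^ q = c"
    using scalar_power_q1[of c] q_ge2 by (cases "c = 0"; cases q) auto
  then show ?case using Suc by (simp add: power_mult)
qed simp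

lemma Const_frob [simp]: "Const c ^ (q ^ n) = (Const c :: 'a mpoly)"
  by (simp add: scalar_frob flip: Const_power)

lemma Const_frob1 [simp]: "Const c ^ q = (Const c :: 'a mpoly)"
  using Const_frob[of c 1] by simp

text \<open>
  The binomial coefficients $\binom{q-1}{k}$ are $(-1)^k$ in characteristic $p$. Dividing $(A -
  B)^q = A^q - B^q$ by $A - B$ gives this without computing any of them.
\<close>

lemma geometric_power:
  "(A - B) ^ (q - 1) = (\<Sum>k<q. A ^ k * (B :: 'a mpoly) ^ (q - 1 - k))"
proof (cases "A = B")
  case True
  have "(of_nat CHAR('a mpoly) :: 'a mpoly) = 0" by simp
  moreover obtain k where "q ^ 1 = CHAR('a mpoly) ^ k" using q_power_CHAR by blast
  moreover from this q_ge2 have "k \<noteq> 0" by (cases k) auto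
  ultimately have "(of_nat q :: 'a mpoly) = 0" by simp
  moreover have "A ^ k * A ^ (q - 1 - k) = A ^ (q - 1)" if "k < q" for k
    using that by (simp flip: power_add)
  ultimately show ?thesis using True q_ge2 by simp
next
  case False
  have "(A - B) * (A - B) ^ (q - 1) = A ^ q - B ^ q"
    using q_ge2 frob_diff1[of A B] by (metis Suc_diff_1 gr0I not_numeral_le_zero power_Suc)
  also have "\<dots> = (A - B) * (\<Sum>k<q. A ^ k * B ^ (q - 1 - k))"
    using diff_power_eq_sum[of A "q - 1" B] q_ge2 by (simp add: algebra_simps)
  finally show ?thesis using False by simp
qed

text \<open>
  On the span of $a$ and $b$ every Frobenius power is a combination $t^{q^n} = \alpha_n t^q +
  \beta_n t$ with coefficients that depend only on $a$, $b$ (\<open>power_qn_linear_left\<close>,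
  \<open>power_qn_linear_right\<close>). By Cramer's rule $\alpha_n = (ab^{q^n} - a^{q^n}b) /
  (ab^q - a^qb)$, which for the first two variables is $\delta_{2;n}(1)$; the sum below is this
  quotient carried out.
\<close>

definition alpha :: "nat \<Rightarrow> 'a mpoly \<Rightarrow> 'a mpoly \<Rightarrow> 'a mpoly" where
  "alpha n a b = (\<Sum>k<qint q n. (b ^ (q - 1)) ^ (qint q n - 1 - k) * (a ^ (q - 1)) ^ k)"

text \<open>
  The Moore determinant of $a$, $b$. Up to scalars it is the product of one linear form from each
  line in the span of $a$ and $b$.
\<close>

definition L2 :: "'a mpoly \<Rightarrow> 'a mpoly \<Rightarrow> 'a mpoly" where
  "L2 a b = a * b ^ q - a ^ q * b"

text \<open>
  The product of all $b + \lambda a$ with $\lambda \in \mathbb F_q$, see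
  \<open>prod_scalar_translates\<close>.
\<close>

definition V2 :: "'a mpoly \<Rightarrow> 'a mpoly \<Rightarrow> 'a mpoly" where
  "V2 a b = b ^ q - a ^ (q - 1) * b"

text \<open>
  \<open>D1\<close> and \<open>D0\<close> are the Dickson invariants $Q_{2,1}$ and $Q_{2,0}$ with
  $a$, $b$ substituted for the variables (\<open>dickson_2\<close>), written in terms of
  \<open>V2\<close> as they arise when the product over the plane is taken line by line.
\<close>

definition D1 :: "'a mpoly \<Rightarrow> 'a mpoly \<Rightarrow> 'a mpoly" where
  "D1 a b = V2 a b ^ (q - 1) + (a ^ (q - 1)) ^ q"

definition D0 :: "'a mpoly \<Rightarrow> 'a mpoly \<Rightarrow> 'a mpoly" where
  "D0 a b = a ^ (q - 1) * V2 a b ^ (q - 1)"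

text \<open>
  The coefficient $\beta_n$ of $t$ in $t^{q^n} = \alpha_n t^q + \beta_n t$. The formula is the
  right one for $n \ge 1$; the coefficient for $n = 0$ would be $1$.
\<close>

definition beta :: "nat \<Rightarrow> 'a mpoly \<Rightarrow> 'a mpoly \<Rightarrow> 'a mpoly" where
  "beta n a b = - D0 a b * alpha (n - 1) a b ^ q"

text \<open>
  The product of all $c + \lambda a + \mu b$ with $\lambda, \mu \in \mathbb F_q$, see
  \<open>dickson_prod_2\<close>.
\<close>

definition V3 :: "'a mpoly \<Rightarrow> 'a mpoly \<Rightarrow> 'a mpoly \<Rightarrow> 'a mpoly" where
  "V3 a b c = c ^ (q\<^sup>2) - D1 a b * c ^ q + D0 a b * c"

lemma power_q: "(a :: 'a mpoly) ^ q = a ^ (q - 1) * a"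
  using q_ge2 by (metis Suc_diff_1 gr0I mult.commute not_numeral_le_zero power_Suc)

lemma power_qn: "(a :: 'a mpoly) ^ (q ^ n) = (a ^ (q - 1)) ^ qint q n * a"
  using qint_eq[OF q_ge2, of n] by (metis Suc_eq_plus1 mult.commute power_Suc power_mult)

lemma L2_eq_V2: "L2 a b = a * V2 a b"
  unfolding L2_def V2_def by (simp add: power_q algebra_simps)

lemma L2_eq: "L2 a b = a * b * (b ^ (q - 1) - a ^ (q - 1))"
  unfolding L2_def by (simp add: power_q algebra_simps)

lemma D0_eq_L2: "D0 a b = L2 a b ^ (q - 1)"
  by (simp add: D0_def L2_eq_V2 power_mult_distrib)

text \<open>
  Since $q^n - 1 = (q - 1)[n]_q$, the right-hand side is $ab$ times the difference of the
  $[n]_q$-th powers of $b^{q-1}$ and $a^{q-1}$, a geometric sum.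
\<close>

lemma L2_alpha: "L2 a b * alpha n a b = a * b ^ (q ^ n) - a ^ (q ^ n) * b"
proof -
  have "(b ^ (q - 1) - a ^ (q - 1)) * alpha n a b
      = (b ^ (q - 1)) ^ qint q n - (a ^ (q - 1)) ^ qint q n"
  proof (cases "qint q n")
    case 0 then show ?thesis by (simp add: alpha_def)
  next
    case (Suc k)
    have "alpha n a b = (\<Sum>j<Suc k. (a ^ (q - 1)) ^ j * (b ^ (q - 1)) ^ (k - j))"
      by (simp add: alpha_def Suc mult.commute)
    then show ?thesis
      using diff_power_eq_sum[of "a ^ (q - 1)" k "b ^ (q - 1)"] Suc
      by (simp add: algebra_simps)
  qed
  then have "a * b * ((b ^ (q - 1) - a ^ (q - 1)) * alpha n a b)
      = a * b * ((b ^ (q - 1)) ^ qint q n - (a ^ (q - 1)) ^ qint q n)" by simp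
  then show ?thesis by (simp add: L2_eq power_qn algebra_simps)
qed

lemma alpha_1: "alpha (Suc 0) a b = 1"
  by (simp add: alpha_def qint_1[OF q_ge2])

lemma alpha_0: "alpha 0 a b = 0"
  by (simp add: alpha_def)

lemma D1_sum: "D1 a b = (\<Sum>k\<le>q. (b ^ (q - 1)) ^ (q - k) * (a ^ (q - 1)) ^ k)"
proof -
  let ?u = "b ^ (q - 1)" and ?v = "a ^ (q - 1)"
  have "V2 a b ^ (q - 1) = ?u * (?u - ?v) ^ (q - 1)"
    by (simp add: V2_def power_q power_mult_distrib[symmetric] algebra_simps)
  also have "(?u - ?v) ^ (q - 1) = (-1) ^ (q - 1) * (?v - ?u) ^ (q - 1)"
    by (simp flip: power_mult_distrib)
  also have "(- 1 :: 'a mpoly) ^ (q - 1) = 1"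
    using scalar_power_q1[of "- 1"] Const_power[of "- 1 :: 'a" "q - 1"] by (simp add: Const_uminus)
  also have "?u * (1 * (?v - ?u) ^ (q - 1)) = (\<Sum>k<q. ?u ^ (q - k) * ?v ^ k)"
    unfolding mult_1 geometric_power sum_distrib_left
  proof (rule sum.cong)
    fix k assume "k \<in> {..<q}"
    then have "q - k = Suc (q - 1 - k)" by auto
    then show "?u * (?v ^ k * ?u ^ (q - 1 - k)) = ?u ^ (q - k) * ?v ^ k" by simp
  qed simp
  finally have "V2 a b ^ (q - 1) = (\<Sum>k<q. ?u ^ (q - k) * ?v ^ k)" .
  then show ?thesis by (simp add: D1_def flip: lessThan_Suc_atMost)
qed

lemma D1_eq_alpha: "D1 a b = alpha 2 a b"
  by (simp add: D1_sum alpha_def qint_2[OF q_ge2] flip: lessThan_Suc_atMost)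

lemma L2_D1: "L2 a b * D1 a b = a * b ^ (q\<^sup>2) - a ^ (q\<^sup>2) * b"
  unfolding D1_eq_alpha by (rule L2_alpha)

text \<open>
  Cramer's rule for $\alpha_n$ and $\beta_n$. The determinant for $\beta_n$ is $a^{q^n}b^q -
  a^qb^{q^n}$, minus the $q$-th power of the one for $\alpha_{n-1}$; this is why $\beta_n$ is
  expressed by $\alpha_{n-1}^q$.
\<close>

lemma power_qn_linear_left:
  assumes "L2 a b \<noteq> 0" "n \<ge> 1"
  shows "a ^ (q ^ n) = alpha n a b * a ^ q + beta n a b * a"
proof -
  let ?L = "L2 a b"
  obtain k where k: "n = Suc k" using assms(2) by (cases n) auto
  have "?L * (alpha n a b * a ^ q - a ^ (q ^ n)) = a ^ q * (?L * alpha n a b) - ?L * a ^ (q ^ n)"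
    by (simp add: algebra_simps)
  also have "\<dots> = a * (a ^ q * b ^ (q ^ n) - a ^ (q ^ n) * b ^ q)"
    unfolding L2_alpha by (simp add: L2_def algebra_simps)
  also have "a ^ q * b ^ (q ^ n) - a ^ (q ^ n) * b ^ q = (?L * alpha k a b) ^ q"
    unfolding L2_alpha frob_diff1 by (simp add: k power_mult_distrib power_mult[symmetric] mult.commute)
  also have "a * (?L * alpha k a b) ^ q = ?L * (D0 a b * alpha k a b ^ q * a)"
    by (simp add: D0_eq_L2 power_mult_distrib power_q[of ?L] algebra_simps)
  finally have "alpha n a b * a ^ q - a ^ (q ^ n) = D0 a b * alpha k a b ^ q * a"
    using assms(1) by simp
  then show ?thesis by (simp add: beta_def k algebra_simps)
qed

lemma L2_swap: "L2 b a = - L2 a b" by (simp add: L2_def)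

lemma alpha_swap: "alpha n b a = alpha n a b"
proof -
  have "alpha n a b = (\<Sum>k<qint q n. (a ^ (q - 1)) ^ (qint q n - Suc k) * (b ^ (q - 1)) ^ k)"
    unfolding alpha_def by (subst sum.nat_diff_reindex[symmetric]) (auto intro!: sum.cong)
  then show ?thesis by (simp add: alpha_def)
qed

lemma D1_swap: "D1 b a = D1 a b" by (simp add: D1_eq_alpha alpha_swap)

lemma D0_swap: "D0 b a = D0 a b"
proof -
  have "(- 1 :: 'a mpoly) ^ (q - 1) = 1"
    using scalar_power_q1[of "- 1"] Const_power[of "- 1 :: 'a" "q - 1"] by (simp add: Const_uminus)
  then show ?thesis by (simp add: D0_eq_L2 L2_swap[of b a] power_minus[of "L2 a b"])
qed

lemma beta_swap: "beta n b a = beta n a b" by (simp add: beta_def D0_swap alpha_swap)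

lemma power_qn_linear_right:
  assumes "L2 a b \<noteq> 0" "n \<ge> 1"
  shows "b ^ (q ^ n) = alpha n a b * b ^ q + beta n a b * b"
  using power_qn_linear_left[of b a n] assms by (simp add: L2_swap[of b a] alpha_swap[of n b a] beta_swap[of n b a])

lemma L2_beta:
  assumes "L2 a b \<noteq> 0" "n \<ge> 1"
  shows "L2 a b * beta n a b = a ^ (q ^ n) * b ^ q - a ^ q * b ^ (q ^ n)"
  unfolding power_qn_linear_left[OF assms] power_qn_linear_right[OF assms] L2_def
  by (simp add: algebra_simps)

text \<open>
  Raise $t^{q^{n+1}} = \alpha_{n+1} t^q + \beta_{n+1} t$ to the power $q$, replace $t^{q^2}$ by
  $Q_{2,1}t^q - Q_{2,0}t$ and compare the coefficients of $t^q$.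
\<close>

lemma alpha_rec:
  assumes "L2 a b \<noteq> 0"
  shows "alpha (Suc (Suc n)) a b = D1 a b * alpha (Suc n) a b ^ q - D0 a b ^ q * alpha n a b ^ (q\<^sup>2)"
proof -
  let ?A = "alpha (Suc n) a b" and ?B = "beta (Suc n) a b"
  have pow: "c ^ (q ^ Suc (Suc n)) = ?A ^ q * c ^ (q\<^sup>2) + ?B ^ q * c ^ q"
    if "c ^ (q ^ Suc n) = ?A * c ^ q + ?B * c" for c :: "'a mpoly"
  proof -
    have "c ^ (q ^ Suc (Suc n)) = (?A * c ^ q + ?B * c) ^ q"
      unfolding that[symmetric] by (simp add: mult.commute flip: power_mult)
    then show ?thesis
      by (simp add: frob_add1 power_mult_distrib power2_eq_square flip: power_mult)
  qed
  have "L2 a b * alpha (Suc (Suc n)) a b = ?A ^ q * (a * b ^ q\<^sup>2 - a ^ q\<^sup>2 * b) + ?B ^ q * L2 a b"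
    unfolding L2_alpha pow[OF power_qn_linear_left[OF assms]] pow[OF power_qn_linear_right[OF assms]]
    by (subst pow, rule power_qn_linear_right[OF assms], simp, subst pow, rule power_qn_linear_left[OF assms], simp)
       (simp add: L2_def algebra_simps)
  also have "\<dots> = L2 a b * (D1 a b * ?A ^ q + ?B ^ q)"
    unfolding L2_D1[symmetric] by (simp add: algebra_simps)
  finally have "alpha (Suc (Suc n)) a b = D1 a b * ?A ^ q + ?B ^ q" using assms by simp
  moreover have "?B ^ q = - (D0 a b ^ q * alpha n a b ^ (q\<^sup>2))"
    using frob_uminus[of "D0 a b * alpha n a b ^ q" 1]
    by (simp add: beta_def power_mult_distrib power2_eq_square flip: power_mult)
  ultimately show ?thesis by simp
qed

lemma V3_eq_V2: "V3 a b c = V2 a c ^ q - V2 a b ^ (q - 1) * V2 a c"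
proof -
  have "V2 a c ^ q = c ^ q\<^sup>2 - (a ^ (q - 1)) ^ q * c ^ q"
    by (simp add: V2_def frob_diff1 power_mult_distrib power2_eq_square flip: power_mult)
  then show ?thesis by (simp add: V3_def D1_def D0_def V2_def algebra_simps)
qed

lemma V2_add: "V2 a (b + c) = V2 a b + V2 a c"
  by (simp add: V2_def frob_add1 algebra_simps)

lemma V2_smult: "V2 a (Const k * b) = Const k * V2 a b"
  by (simp add: V2_def power_mult_distrib algebra_simps)

lemma V2_self: "V2 a a = 0" by (simp add: V2_def power_q)

lemma V3_add: "V3 a b (c + d) = V3 a b c + V3 a b d"
  using frob_add[of c d 2] by (simp add: V3_def frob_add1 algebra_simps)

lemma V3_smult: "V3 a b (Const k * c) = Const k * V3 a b c"
  using Const_frob[of k 2] by (simp add: V3_def power_mult_distrib algebra_simps del: Const_frob)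

lemma V3_left: "V3 a b a = 0"
  using q_ge2 by (simp add: V3_eq_V2 V2_self)

lemma V3_swap: "V3 b a c = V3 a b c"
  by (simp add: V3_def D1_swap[of b a] D0_swap[of b a])

lemma V3_right: "V3 a b b = 0"
  using V3_left[of b a] by (simp add: V3_swap[of b a])

end

section \<open>The truncation ideal and the top coefficient\<close>

lemma lookup_mult_single:
  fixes p :: "'b::{cancel_comm_monoid_add} \<Rightarrow>\<^sub>0 'a::comm_semiring_1"
  shows "Poly_Mapping.lookup (p * Poly_Mapping.single s c) (t + s) = Poly_Mapping.lookup p t * c"
proof -
  have "p = (\<Sum>u\<in>Poly_Mapping.keys p. Poly_Mapping.single u (Poly_Mapping.lookup p u))"
    by (rule poly_mapping_eqI) (simp add: lookup_sum lookup_single when_def in_keys_iff sum.delta')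
  then have "p * Poly_Mapping.single s c
      = (\<Sum>u\<in>Poly_Mapping.keys p. Poly_Mapping.single (u + s) (Poly_Mapping.lookup p u * c))"
    by (metis (no_types, lifting) mult_single sum.cong sum_distrib_right)
  then have "Poly_Mapping.lookup (p * Poly_Mapping.single s c) (t + s)
      = (\<Sum>u\<in>Poly_Mapping.keys p. if u = t then Poly_Mapping.lookup p u * c else 0)"
    by (simp add: lookup_sum lookup_single when_def)
  then show ?thesis
    by (simp add: sum.delta in_keys_iff)
qed

lemma lookup_Const_mult:
  "Poly_Mapping.lookup (Const c * f) t = c * Poly_Mapping.lookup (f :: 'a::comm_semiring_1 mpoly) t"
  using lookup_mult_single[of f 0 c t] by (simp add: Const_def mult.commute)

lemma single_eq_Var_mult:
  fixes t :: "nat \<Rightarrow>\<^sub>0 nat"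
  assumes "k \<le> Poly_Mapping.lookup t i"
  shows "Poly_Mapping.single t (c::'a::comm_semiring_1)
       = Var i ^ k * Poly_Mapping.single (t - Poly_Mapping.single i k) c"
proof -
  have "Poly_Mapping.single i k + (t - Poly_Mapping.single i k) = t"
    by (rule poly_mapping_eqI) (use assms in \<open>auto simp: lookup_add lookup_minus lookup_single when_def\<close>)
  then show ?thesis by (simp add: Var_power mult_single)
qed

lemma mpoly_induct [case_names zero add single]:
  fixes f :: "'a::comm_semiring_1 mpoly"
  assumes "P 0" "\<And>f g. P f \<Longrightarrow> P g \<Longrightarrow> P (f + g)" "\<And>t c. t \<in> Poly_Mapping.keys f \<Longrightarrow> P (Poly_Mapping.single t c)"
  shows "P f"
proof -
  have "P (\<Sum>t\<in>A. Poly_Mapping.single t (Poly_Mapping.lookup f t))" if "A \<subseteq> Poly_Mapping.keys f" for A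
    using that by (induction A rule: infinite_finite_induct) (use assms in auto)
  then show ?thesis using expand_mpoly[of f] by (metis order_refl)
qed

text \<open>
  $x_i \mapsto c x_i + a x_j$. The case $a = 0$ gives the diagonal substitutions, so that
  \<open>j\<close> is then irrelevant.
\<close>

definition elementary_subst :: "nat \<Rightarrow> 'a \<Rightarrow> nat \<Rightarrow> 'a \<Rightarrow> nat \<Rightarrow> 'a::comm_ring_1 mpoly" where
  "elementary_subst i c j a = Var(i := Const c * Var i + Const a * Var j)"

text \<open>
  The ideal generated by the $N$-th powers of the first three variables, taken in the ring of
  polynomials in all variables. It cuts out $I_m(3)$ in $S(3)$ (\<open>I_ideal_eq\<close>), and
  congruences modulo it need no proof that the polynomials involved lie in $S(3)$.
\<close>

definition truncation_ideal :: "nat \<Rightarrow> 'a::comm_ring_1 mpoly set" where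
  "truncation_ideal N = {f. \<forall>t\<in>Poly_Mapping.keys f. \<exists>i<3. N \<le> Poly_Mapping.lookup t i}"

lemma J_0 [simp]: "0 \<in> truncation_ideal N" by (simp add: truncation_ideal_def)

lemma J_add: "f \<in> truncation_ideal N \<Longrightarrow> g \<in> truncation_ideal N \<Longrightarrow> f + g \<in> truncation_ideal N"
  unfolding truncation_ideal_def using Poly_Mapping.keys_add[of f g] by auto

lemma J_mult:
  assumes "f \<in> truncation_ideal N" shows "g * f \<in> truncation_ideal N"
  unfolding truncation_ideal_def
proof safe
  fix t assume "t \<in> Poly_Mapping.keys (g * f)"
  then obtain u v where "t = u + v" "v \<in> Poly_Mapping.keys f"
    using keys_mult[of g f] by blast
  moreover from this obtain i where "i < 3" "N \<le> Poly_Mapping.lookup v i"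
    using assms by (auto simp: truncation_ideal_def)
  ultimately show "\<exists>i<3. N \<le> Poly_Mapping.lookup t i"
    by (intro exI[of _ i]) (simp add: lookup_add)
qed

lemma J_mult_right: "f \<in> truncation_ideal N \<Longrightarrow> f * g \<in> truncation_ideal N"
  using J_mult[of f N g] by (simp add: mult.commute)

lemma J_uminus: "f \<in> truncation_ideal N \<Longrightarrow> - f \<in> truncation_ideal N"
  by (simp add: truncation_ideal_def)

lemma J_diff: "f \<in> truncation_ideal N \<Longrightarrow> g \<in> truncation_ideal N \<Longrightarrow> f - g \<in> truncation_ideal N"
  using J_add[of f N "- g"] J_uminus[of g N] by simp

lemma J_sum: "(\<And>i. i \<in> A \<Longrightarrow> f i \<in> truncation_ideal N) \<Longrightarrow> sum f A \<in> truncation_ideal N"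
  by (induction A rule: infinite_finite_induct) (auto intro: J_add)

lemma J_Var: "i < 3 \<Longrightarrow> N \<le> k \<Longrightarrow> Var i ^ k \<in> truncation_ideal N"
  by (auto simp: truncation_ideal_def Var_power lookup_single)

lemma J_lookup:
  assumes "f \<in> truncation_ideal N" "\<And>i. i < 3 \<Longrightarrow> Poly_Mapping.lookup t i < N"
  shows "Poly_Mapping.lookup f t = 0"
  using assms by (force simp: truncation_ideal_def in_keys_iff)

text \<open>
  A monomial in the ideal contains some $x_i^N$, and the hypothesis says where this factor goes.
\<close>

lemma psubst_J:
  assumes "f \<in> truncation_ideal N" "\<And>i. i < 3 \<Longrightarrow> s i ^ N \<in> truncation_ideal N"
  shows "psubst s f \<in> truncation_ideal N"
proof (induction f rule: mpoly_induct)
  case (single t c)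
  then obtain i where i: "i < 3" "N \<le> Poly_Mapping.lookup t i"
    using assms(1) by (auto simp: truncation_ideal_def)
  show ?case
    unfolding single_eq_Var_mult[OF i(2)] psubst_mult psubst_power psubst_Var
    using assms(2)[OF i(1)] by (rule J_mult_right)
qed (simp_all add: psubst_add J_add)

lemma I_ideal_eq:
  "I_ideal m 3 = truncation_ideal (CARD('a) ^ m) \<inter> (carrier (S_ring 3) :: 'a::{field,finite} mpoly set)"
    (is "_ = ?J \<inter> ?S")
proof
  let ?R = "S_ring 3 :: 'a mpoly ring"
  interpret cring ?R by (rule cring_S_ring)
  interpret I: ideal "I_ideal m 3" ?R by (rule ideal_I)
  have "ideal (?J \<inter> ?S) ?R"
  proof (rule idealI)
    show "subgroup (?J \<inter> ?S) (add_monoid ?R)"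
    proof (rule add.subgroupI)
      show "?J \<inter> ?S \<noteq> {}" using S_0[of 3] J_0 by blast
      fix a assume a: "a \<in> ?J \<inter> ?S"
      then have "\<ominus>\<^bsub>?R\<^esub> a = 0 - a" using S_minus[OF S_0, of a 3] by (auto simp: a_minus_def)
      then show "\<ominus>\<^bsub>?R\<^esub> a \<in> ?J \<inter> ?S" using a by (auto intro: J_uminus S_uminus)
    qed (auto intro: J_add S_add)
  qed (auto intro: J_mult J_mult_right S_mult ring_axioms)
  moreover have "(\<lambda>i. Var i ^ (CARD('a) ^ m)) ` {..<3} \<subseteq> ?J \<inter> ?S"
    by (auto intro!: J_Var S_power S_Var)
  ultimately show "I_ideal m 3 \<subseteq> ?J \<inter> ?S"
    unfolding I_ideal_def by (rule genideal_minimal)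
  show "?J \<inter> ?S \<subseteq> I_ideal m 3"
  proof safe
    fix f :: "'a mpoly" assume f: "f \<in> ?J" "f \<in> ?S"
    show "f \<in> I_ideal m 3"
    proof (induction f rule: mpoly_induct)
      case zero then show ?case using I.zero_closed by simp
    next
      case (add f g) then show ?case using I.a_closed[of f g] by simp
    next
      case (single t c)
      then obtain i where i: "i < 3" "CARD('a) ^ m \<le> Poly_Mapping.lookup t i"
        using f(1) by (auto simp: truncation_ideal_def)
      have "Poly_Mapping.keys t \<subseteq> {..<3}" using single f(2) by (auto simp: in_S_ring)
      then have "Poly_Mapping.keys (t - Poly_Mapping.single i (CARD('a) ^ m)) \<subseteq> {..<3}"
        by (auto simp: in_keys_iff lookup_minus subset_iff)
      then have s: "Poly_Mapping.single (t - Poly_Mapping.single i (CARD('a) ^ m)) c \<in> ?S"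
        by (simp add: in_S_ring)
      have "(Var i :: 'a mpoly) ^ (CARD('a) ^ m) \<in> I_ideal m 3"
        unfolding I_ideal_def using genideal_self[OF I_gens[of m 3]] i by auto
      then show ?case
        unfolding single_eq_Var_mult[OF i(2)] using I.I_r_closed[OF _ s] by simp
    qed
  qed
qed

definition top_monomial :: "nat \<Rightarrow> nat \<Rightarrow>\<^sub>0 nat" where
  "top_monomial N = (\<Sum>i<3. Poly_Mapping.single i (N - 1))"

lemma lookup_top_monomial: "Poly_Mapping.lookup (top_monomial N) i = (if i < 3 then N - 1 else 0)"
  by (simp add: top_monomial_def lookup_sum lookup_single when_def sum.delta)

text \<open>
  The functional $\tau$ that makes the truncated algebra a Poincare duality algebra.
\<close>

definition top_coeff :: "nat \<Rightarrow> 'a::comm_ring_1 mpoly \<Rightarrow> 'a" where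
  "top_coeff N f = Poly_Mapping.lookup f (top_monomial N)"

lemma top_coeff_add: "top_coeff N (f + g) = top_coeff N f + top_coeff N g"
  by (simp add: top_coeff_def lookup_add)

lemma top_coeff_Const: "top_coeff N (Const c * f) = c * top_coeff N f"
  by (simp add: top_coeff_def lookup_Const_mult)

lemma top_coeff_0 [simp]: "top_coeff N 0 = 0" by (simp add: top_coeff_def)

lemma top_coeff_sum: "top_coeff N (sum f A) = (\<Sum>i\<in>A. top_coeff N (f i))"
  by (induction A rule: infinite_finite_induct) (simp_all add: top_coeff_add)

lemma top_coeff_J: "N > 0 \<Longrightarrow> f \<in> truncation_ideal N \<Longrightarrow> top_coeff N f = 0"
  unfolding top_coeff_def by (rule J_lookup) (auto simp: lookup_top_monomial)

text \<open>
  A monomial $t$ that is not in the ideal divides the top monomial; multiplying $p$ by the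
  cofactor puts the coefficient of $t$ in $p$ at the top monomial.
\<close>

lemma top_coeff_nondegenerate:
  fixes p :: "'a::field mpoly"
  assumes p: "p \<in> carrier (S_ring 3)" and *: "\<And>f. f \<in> carrier (S_ring 3) \<Longrightarrow> top_coeff N (p * f) = 0"
  shows "p \<in> truncation_ideal N"
  unfolding truncation_ideal_def
proof safe
  fix t assume t: "t \<in> Poly_Mapping.keys p"
  show "\<exists>i<3. N \<le> Poly_Mapping.lookup t i"
  proof (rule ccontr)
    assume "\<not> ?thesis"
    then have less: "Poly_Mapping.lookup t i < N" if "i < 3" for i using that by auto
    let ?s = "top_monomial N - t"
    have keys: "Poly_Mapping.keys t \<subseteq> {..<3}" using t p by (auto simp: in_S_ring)
    have "t + ?s = top_monomial N"
    proof (rule poly_mapping_eqI)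
      fix i
      show "Poly_Mapping.lookup (t + ?s) i = Poly_Mapping.lookup (top_monomial N) i"
        using less[of i] keys
        by (cases "i < 3") (auto simp: lookup_add lookup_minus lookup_top_monomial in_keys_iff subset_iff)
    qed
    moreover have "Poly_Mapping.single ?s 1 \<in> (carrier (S_ring 3) :: 'a mpoly set)"
      by (auto simp: in_S_ring in_keys_iff lookup_minus lookup_top_monomial split: if_splits)
    ultimately have "Poly_Mapping.lookup p t = 0"
      using *[of "Poly_Mapping.single ?s 1"] lookup_mult_single[of p ?s 1 t] by (simp add: top_coeff_def)
    then show False using t by (simp add: in_keys_iff)
  qed
qed

context finite_field_polynomials
begin

lemma elementary_subst_J:
  assumes "f \<in> truncation_ideal (q ^ m)" "j < 3"
  shows "psubst (elementary_subst i c j a) f \<in> (truncation_ideal (q ^ m) :: 'a mpoly set)"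
proof (rule psubst_J[OF assms(1)])
  fix k :: nat assume k: "k < 3"
  show "elementary_subst i c j a k ^ q ^ m \<in> truncation_ideal (q ^ m)"
    using k assms(2) by (auto simp: elementary_subst_def frob_add power_mult_distrib intro!: J_add J_mult J_Var)
qed

text \<open>
  The substitution can only lower the exponent of $x_i$. So a monomial outside the ideal
  contributes to the top monomial only if its exponent of $x_i$ is $N - 1$ and is kept; then it is
  the top monomial itself, which is reproduced with the factor $c^{N-1} = 1$. Monomials in the
  ideal stay in it.
\<close>

lemma top_coeff_elementary_subst:
  fixes f :: "'a mpoly"
  assumes ij: "i < 3" "j < 3" "i \<noteq> j" and c: "c \<noteq> 0"
  shows "top_coeff (q ^ m) (psubst (elementary_subst i c j a) f) = top_coeff (q ^ m) f"
proof (induction f rule: mpoly_induct)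
  case (single t b)
  let ?N = "q ^ m"
  let ?n = "Poly_Mapping.lookup t i"
  define r where "r = t - Poly_Mapping.single i ?n"
  have N: "?N > 0" using q_ge2 by simp
  have r: "Poly_Mapping.lookup r i = 0" by (simp add: r_def lookup_minus)
  have t: "Poly_Mapping.single t b = Var i ^ ?n * Poly_Mapping.single r b"
    using single_eq_Var_mult[of ?n t i b] by (simp add: r_def)
  have fix_r: "psubst (elementary_subst i c j a) (Poly_Mapping.single r b) = Poly_Mapping.single r b"
  proof -
    have "(\<Prod>k\<in>Poly_Mapping.keys r. elementary_subst i c j a k ^ Poly_Mapping.lookup r k)
        = (\<Prod>k\<in>Poly_Mapping.keys r. Var k ^ Poly_Mapping.lookup r k)"
      by (rule prod.cong) (use r in \<open>auto simp: elementary_subst_def in_keys_iff\<close>)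
    then show ?thesis
      unfolding psubst_single by (simp add: monomial_Var Const_def mult_single)
  qed
  show ?case
  proof (cases "?n < ?N")
    case False
    then have "Poly_Mapping.single t b \<in> truncation_ideal ?N"
      unfolding t using ij by (intro J_mult_right J_Var) auto
    then show ?thesis using elementary_subst_J[of "Poly_Mapping.single t b" m j i c a] ij
      by (simp add: top_coeff_J[OF N])
  next
    case True
    have "psubst (elementary_subst i c j a) (Poly_Mapping.single t b)
        = (Const c * Var i + Const a * Var j) ^ ?n * Poly_Mapping.single r b"
      unfolding t psubst_mult fix_r psubst_power psubst_Var by (simp add: elementary_subst_def)
    also have "\<dots> = (\<Sum>k\<le>?n. of_nat (?n choose k) * (Const c * Var i) ^ k * (Const a * Var j) ^ (?n - k)
        * Poly_Mapping.single r b)"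
      by (simp add: binomial_ring sum_distrib_right)
    also have "top_coeff ?N \<dots> = (\<Sum>k\<le>?n. if k = ?n then top_coeff ?N (Poly_Mapping.single t b) else 0)"
      unfolding top_coeff_sum
    proof (rule sum.cong)
      fix k assume k: "k \<in> {..?n}"
      have of_nat: "of_nat l = (Const (of_nat l) :: 'a mpoly)" for l
        by (induction l) (simp_all add: Const_add)
      let ?e = "Poly_Mapping.single i k + (Poly_Mapping.single j (?n - k) + r)"
      have eq: "of_nat (?n choose k) * (Const c * Var i) ^ k * (Const a * Var j) ^ (?n - k) * Poly_Mapping.single r b
         = Const (of_nat (?n choose k) * c ^ k * a ^ (?n - k)) * Poly_Mapping.single ?e b"
        by (simp add: of_nat power_mult_distrib Const_mult Const_power Var_power mult_single
            mult.assoc mult.left_commute mult.commute add.left_commute add.commute add.assoc)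
      show "top_coeff ?N (of_nat (?n choose k) * (Const c * Var i) ^ k * (Const a * Var j) ^ (?n - k) * Poly_Mapping.single r b)
          = (if k = ?n then top_coeff ?N (Poly_Mapping.single t b) else 0)"
      proof (cases "k = ?n")
        case True2: True
        have e: "?e = t" unfolding True2 r_def
          by (rule poly_mapping_eqI) (auto simp: lookup_add lookup_minus lookup_single when_def)
        show ?thesis
        proof (cases "t = top_monomial ?N")
          case True
          then have "?n = q ^ m - 1" using ij by (simp add: lookup_top_monomial)
          moreover have "c ^ (q ^ m - 1) = 1"
            using scalar_frob[of c m] c N by (metis Suc_diff_1 mult_cancel_left2 power_Suc)
          ultimately show ?thesis unfolding eq e using True2 by (simp add: top_coeff_Const)
        next
          case False
          then show ?thesis unfolding eq e using True2 by (simp add: top_coeff_Const) (simp add: top_coeff_def lookup_single)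
        qed
      next
        case False
        have "Poly_Mapping.lookup ?e i = k" using r ij by (simp add: lookup_add lookup_single)
        then have "?e \<noteq> top_monomial ?N" using False k True ij by (auto simp: lookup_top_monomial)
        then show ?thesis unfolding eq using False by (simp add: top_coeff_Const) (simp add: top_coeff_def lookup_single)
      qed
    qed simp
    finally show ?thesis by simp
  qed
qed (simp_all add: psubst_add top_coeff_add)

end

section \<open>Generators of the parabolic subgroup\<close>

lemma less_3_cases: "(i::nat) < 3 \<longleftrightarrow> i = 0 \<or> i = 1 \<or> i = 2" by auto

lemma sum_3: "(\<Sum>i<3. f i) = f 0 + f 1 + f (2::nat)" for f :: "nat \<Rightarrow> 'b::comm_monoid_add"
  by (simp add: numeral_3_eq_3 eval_nat_numeral)

text \<open>
  The general linear substitution under which the span of the first two variables is stable. It is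
  in $P(2,1)$ if and only if $ad - bc \ne 0$ and $h \ne 0$.
\<close>

definition P21_subst :: "'a \<Rightarrow> 'a \<Rightarrow> 'a \<Rightarrow> 'a \<Rightarrow> 'a \<Rightarrow> 'a \<Rightarrow> 'a \<Rightarrow> nat \<Rightarrow> 'a::comm_ring_1 mpoly" where
  "P21_subst a b c d e f h = Var(0 := Const a * Var 0 + Const b * Var 1, 1 := Const c * Var 0 + Const d * Var 1,
     2 := Const e * Var 0 + Const f * Var 1 + Const h * Var 2)"

lemma lookup_Var_1: "Poly_Mapping.lookup (Var i :: 'a::zero_neq_one mpoly) (Poly_Mapping.single j 1) = (if i = j then 1 else 0)"
proof -
  have "Poly_Mapping.single i (1::nat) = Poly_Mapping.single j 1 \<longleftrightarrow> i = j"
    by (metis lookup_single_eq lookup_single_not_eq zero_neq_one)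
  then show ?thesis by (auto simp: Var_def lookup_single when_def)
qed

lemma linear_form_eqD:
  fixes a b c a' b' c' :: "'a::comm_ring_1"
  assumes "Const a * Var 0 + Const b * Var 1 + Const c * Var 2 = Const a' * Var 0 + Const b' * Var 1 + Const c' * Var 2"
  shows "a = a'" "b = b'" "c = c'"
proof -
  have "Poly_Mapping.lookup (Const a * Var 0 + Const b * Var 1 + Const c * Var 2) (Poly_Mapping.single j 1)
      = Poly_Mapping.lookup (Const a' * Var 0 + Const b' * Var 1 + Const c' * Var 2) (Poly_Mapping.single j 1)" for j :: nat
    by (simp only: assms)
  from this[of 0] this[of 1] this[of 2] show "a = a'" "b = b'" "c = c'"
    by (simp_all only: lookup_add lookup_Const_mult lookup_Var_1) simp_all
qed

lemma lin_subst_3: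
  "lin_subst 3 g = psubst (Var(0 := Const (g $$ (0,0)) * Var 0 + Const (g $$ (1,0)) * Var 1 + Const (g $$ (2,0)) * Var 2,
     1 := Const (g $$ (0,1)) * Var 0 + Const (g $$ (1,1)) * Var 1 + Const (g $$ (2,1)) * Var 2,
     2 := Const (g $$ (0,2)) * Var 0 + Const (g $$ (1,2)) * Var 1 + Const (g $$ (2,2)) * Var 2))"
  unfolding lin_subst_def
  by (rule arg_cong[of _ _ psubst]) (auto simp: fun_eq_iff sum_3 less_3_cases)

lemma P21_imp_P21_subst:
  fixes g :: "'a::field mat"
  assumes "g \<in> P21"
  obtains a b c d e f h where "lin_subst 3 g = psubst (P21_subst a b c d e f h)" "a * d - b * c \<noteq> 0" "h \<noteq> 0"
proof -
  let ?W = "{Const a * Var 0 + Const b * Var 1 | a b :: 'a. True}"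
  from assms have g: "g \<in> carrier_mat 3 3" "invertible_mat g" "lin_subst 3 g ` ?W = ?W"
    by (auto simp: P21_def GL_def)
  have "Const 1 * Var 0 + Const 0 * Var 1 \<in> ?W" "Const 0 * Var 0 + Const 1 * Var 1 \<in> ?W" by blast+
  then have "lin_subst 3 g (Var 0) \<in> ?W" "lin_subst 3 g (Var 1) \<in> ?W"
    using g(3) by (metis (no_types, lifting) Const_0 Const_1 add.left_neutral add.right_neutral image_eqI mult_1 mult_zero_left)+
  then obtain a b c d where "lin_subst 3 g (Var 0) = Const a * Var 0 + Const b * Var 1 + Const 0 * Var 2"
     "lin_subst 3 g (Var 1) = Const c * Var 0 + Const d * Var 1 + Const 0 * Var 2" by auto
  then have 0: "g $$ (2,0) = 0" "g $$ (2,1) = 0"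
    unfolding lin_subst_3 psubst_Var fun_upd_apply
    using linear_form_eqD(3)[of "g $$ (0,0)" "g $$ (1,0)" "g $$ (2,0)" a b 0]
      linear_form_eqD(3)[of "g $$ (0,1)" "g $$ (1,1)" "g $$ (2,1)" c d 0] by simp_all
  let ?a = "g $$ (0,0)" and ?b = "g $$ (1,0)" and ?c = "g $$ (0,1)" and ?d = "g $$ (1,1)"
    and ?e = "g $$ (0,2)" and ?f = "g $$ (1,2)" and ?h = "g $$ (2,2)"
  obtain B where B: "g * B = 1\<^sub>m 3" "B \<in> carrier_mat 3 3"
  proof -
    obtain B where "g * B = 1\<^sub>m (dim_row g)" "B * g = 1\<^sub>m (dim_row B)"
      using g(2) unfolding invertible_mat_def inverts_mat_def by blast
    moreover from this(2) have "dim_row B = 3"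
      using g(1) by (metis carrier_matD(2) index_mult_mat(3) index_one_mat(3))
    moreover from calculation(1) have "dim_col B = 3"
      using g(1) by (metis carrier_matD(1) index_mult_mat(3) index_one_mat(3))
    ultimately show ?thesis using that[of B] g(1) by auto
  qed
  have entry: "g $$ (i,0) * B $$ (0,j) + g $$ (i,1) * B $$ (1,j) + g $$ (i,2) * B $$ (2,j) = (if i = j then 1 else 0)"
    if "i < 3" "j < 3" for i j
  proof -
    have "(g * B) $$ (i,j) = (\<Sum>k<3. g $$ (i,k) * B $$ (k,j))"
      using g(1) B(2) that by (simp add: scalar_prod_def atLeast0LessThan)
    then show ?thesis using B(1) that by (simp add: sum_3)
  qed
  have h: "?h \<noteq> 0" using entry[of 2 2] 0 by auto
  then have B0: "B $$ (2,0) = 0" "B $$ (2,1) = 0" using entry[of 2 0] entry[of 2 1] 0 by auto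
  have "(?a * ?d - ?b * ?c) * (B $$ (0,0) * B $$ (1,1) - B $$ (0,1) * B $$ (1,0))
     = (?a * B $$ (0,0) + ?c * B $$ (1,0)) * (?b * B $$ (0,1) + ?d * B $$ (1,1))
     - (?a * B $$ (0,1) + ?c * B $$ (1,1)) * (?b * B $$ (0,0) + ?d * B $$ (1,0))"
    by (simp add: algebra_simps)
  also have "\<dots> = 1" using entry[of 0 0] entry[of 0 1] entry[of 1 0] entry[of 1 1] B0 by simp
  finally have "?a * ?d - ?b * ?c \<noteq> 0" by auto
  moreover have "lin_subst 3 g = psubst (P21_subst ?a ?b ?c ?d ?e ?f ?h)"
    unfolding lin_subst_3 P21_subst_def 0 by simp
  ultimately show ?thesis using h that by blast
qed

lemma P21_subst_imp_P21:
  fixes a b c d e f h :: "'a::field"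
  assumes D: "a * d - b * c \<noteq> 0" and h: "h \<noteq> 0"
  obtains g where "g \<in> P21" "lin_subst 3 g = psubst (P21_subst a b c d e f h)"
proof -
  define g where "g = mat 3 3 (\<lambda>(i, j). [[a, c, e], [b, d, f], [0, 0, h]] ! i ! j)"
  define k where "k = inverse (a * d - b * c)"
  define l where "l = inverse h"
  have kl: "k * (a * d - b * c) = 1" "l * h = 1" using assms by (simp_all add: k_def l_def)
  define B where "B = mat 3 3 (\<lambda>(i, j). [[d * k, - c * k, (c * f - d * e) * k * l],
     [- b * k, a * k, (b * e - a * f) * k * l], [0, 0, l]] ! i ! j)"
  have g_entries: "g $$ (0,0) = a" "g $$ (0,1) = c" "g $$ (0,2) = e" "g $$ (1,0) = b" "g $$ (1,1) = d"
    "g $$ (1,2) = f" "g $$ (2,0) = 0" "g $$ (2,1) = 0" "g $$ (2,2) = h"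
    by (simp_all add: g_def)
  have B_entries: "B $$ (0,0) = d * k" "B $$ (0,1) = - c * k" "B $$ (0,2) = (c * f - d * e) * k * l"
    "B $$ (1,0) = - b * k" "B $$ (1,1) = a * k"
    "B $$ (1,2) = (b * e - a * f) * k * l" "B $$ (2,0) = 0" "B $$ (2,1) = 0" "B $$ (2,2) = l"
    by (simp_all add: B_def)
  have dims: "g \<in> carrier_mat 3 3" "B \<in> carrier_mat 3 3"
    unfolding g_def B_def by (rule mat_carrier)+
  have entry: "(g * B) $$ (i,j) = g $$ (i,0) * B $$ (0,j) + g $$ (i,1) * B $$ (1,j) + g $$ (i,2) * B $$ (2,j)"
    if "i < 3" "j < 3" for i j
    using dims that by (simp add: scalar_prod_def atLeast0LessThan sum_3)
  have gB: "g * B = 1\<^sub>m 3"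
  proof (rule eq_matI)
    have "a * (d * k) + c * (- b * k) + e * 0 = 1" "a * (- c * k) + c * (a * k) + e * 0 = 0"
      "a * ((c * f - d * e) * k * l) + c * ((b * e - a * f) * k * l) + e * l = 0"
      "b * (d * k) + d * (- b * k) + f * 0 = 0" "b * (- c * k) + d * (a * k) + f * 0 = 1"
      "b * ((c * f - d * e) * k * l) + d * ((b * e - a * f) * k * l) + f * l = 0"
      "0 * (d * k) + 0 * (- b * k) + h * 0 = 0" "0 * (- c * k) + 0 * (a * k) + h * 0 = 0"
      "0 * ((c * f - d * e) * k * l) + 0 * ((b * e - a * f) * k * l) + h * l = 1"
    proof -
      have "a * (d * k) + c * (- b * k) + e * 0 = k * (a * d - b * c)"
        "b * (- c * k) + d * (a * k) + f * 0 = k * (a * d - b * c)"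
        "a * ((c * f - d * e) * k * l) + c * ((b * e - a * f) * k * l) + e * l
           = e * l * (1 - k * (a * d - b * c))"
        "b * ((c * f - d * e) * k * l) + d * ((b * e - a * f) * k * l) + f * l
           = f * l * (1 - k * (a * d - b * c))"
        by (simp_all add: algebra_simps)
      then show "a * (d * k) + c * (- b * k) + e * 0 = 1" "b * (- c * k) + d * (a * k) + f * 0 = 1"
        "a * ((c * f - d * e) * k * l) + c * ((b * e - a * f) * k * l) + e * l = 0"
        "b * ((c * f - d * e) * k * l) + d * ((b * e - a * f) * k * l) + f * l = 0"
        unfolding kl(1) by simp_all
    qed (use kl(2) in \<open>simp_all add: mult.commute\<close>)
    note eqs = this
    fix i j assume "i < dim_row (1\<^sub>m 3 :: 'a mat)" "j < dim_col (1\<^sub>m 3 :: 'a mat)"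
    then have ij: "i < 3" "j < 3" by auto
    from ij(1)[unfolded less_3_cases] ij(2)[unfolded less_3_cases]
    show "(g * B) $$ (i,j) = 1\<^sub>m 3 $$ (i,j)"
      unfolding entry[OF ij]
      by (elim disjE; simp only: g_entries B_entries eqs; simp)
  qed (use dims in auto)
  have Bg: "B * g = 1\<^sub>m 3"
    using mat_mult_left_right_inverse[OF dims gB] .
  have inv: "invertible_mat g"
    unfolding invertible_mat_def inverts_mat_def using dims gB Bg by (auto intro!: exI[of _ B])
  have lin: "lin_subst 3 g = psubst (P21_subst a b c d e f h)"
    unfolding lin_subst_3 P21_subst_def g_entries by simp
  let ?W = "{Const a * Var 0 + Const b * Var 1 | a b :: 'a. True}"
  have lin_W: "lin_subst 3 g (Const s * Var 0 + Const t * Var 1)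
     = Const (s * a + t * c) * Var 0 + Const (s * b + t * d) * Var 1" for s t
    unfolding lin by (simp add: psubst_add psubst_mult P21_subst_def Const_add Const_mult algebra_simps)
  have "lin_subst 3 g ` ?W = ?W"
  proof (rule subset_antisym; rule subsetI)
    fix p assume "p \<in> lin_subst 3 g ` ?W"
    then obtain s t where "p = lin_subst 3 g (Const s * Var 0 + Const t * Var 1)" by blast
    then show "p \<in> ?W" unfolding lin_W by blast
  next
    fix p assume "p \<in> ?W"
    then obtain s t where p: "p = Const s * Var 0 + Const t * Var 1" by auto
    let ?s = "(s * d - t * c) * k" and ?t = "(t * a - s * b) * k"
    have "?s * a + ?t * c = s * (k * (a * d - b * c))" "?s * b + ?t * d = t * (k * (a * d - b * c))"
      by (simp_all add: algebra_simps)
    then have "?s * a + ?t * c = s" "?s * b + ?t * d = t" unfolding kl(1) by simp_all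
    then have "p = lin_subst 3 g (Const ?s * Var 0 + Const ?t * Var 1)"
      unfolding p lin_W by simp
    then show "p \<in> lin_subst 3 g ` ?W" by blast
  qed
  then have "g \<in> P21" using dims inv by (simp add: P21_def GL_def)
  then show ?thesis using lin that by blast
qed

definition swap_subst :: "nat \<Rightarrow> 'a::comm_ring_1 mpoly" where
  "swap_subst = Var(0 := Var 1, 1 := Var 0)"

definition fixes_mod :: "nat \<Rightarrow> 'a::comm_ring_1 mpoly \<Rightarrow> (nat \<Rightarrow> 'a mpoly) \<Rightarrow> bool" where
  "fixes_mod N p s \<longleftrightarrow> psubst s p - p \<in> truncation_ideal N"

context finite_field_polynomials
begin

lemma swap_subst_J: "f \<in> truncation_ideal N \<Longrightarrow> psubst swap_subst f \<in> (truncation_ideal N :: 'a mpoly set)"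
  by (erule psubst_J) (auto simp: swap_subst_def intro!: J_Var)

lemma fixes_mod_comp:
  assumes "fixes_mod N p s" "fixes_mod N p r" "\<And>f. f \<in> truncation_ideal N \<Longrightarrow> psubst r f \<in> truncation_ideal N"
  shows "fixes_mod N p (\<lambda>i. psubst r (s i))"
proof -
  have diff: "psubst r (f - g) = psubst r f - psubst r g" for f g
    using psubst_add[of r "f - g" g] by (simp add: algebra_simps)
  have "psubst r (psubst s p - p) + (psubst r p - p) \<in> truncation_ideal N"
    using assms by (intro J_add) (auto simp: fixes_mod_def)
  then show ?thesis by (simp add: fixes_mod_def diff psubst_psubst)
qed

text \<open>
  $P(2,1)$ is generated by the interchange of the first two variables and the substitutions $Y
  \mapsto cY + aX$, $Z \mapsto cZ + aX$: conjugation with the interchange provides $X \mapsto cX +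
  aY$ and $Z \mapsto cZ + aY$, and a $2 \times 2$ matrix with $a \ne 0$ is a product of a lower
  and an upper triangular one.
\<close>

lemma fixes_mod_P21_subst:
  fixes p :: "'a mpoly"
  assumes swap: "fixes_mod (q ^ m) p swap_subst"
    and T: "\<And>c a. c \<noteq> 0 \<Longrightarrow> fixes_mod (q ^ m) p (elementary_subst 1 c 0 a)"
    and U: "\<And>c a. c \<noteq> 0 \<Longrightarrow> fixes_mod (q ^ m) p (elementary_subst 2 c 0 a)"
    and D: "a * d - b * c \<noteq> 0" and h: "h \<noteq> 0"
  shows "fixes_mod (q ^ m) p (P21_subst a b c d e f h)"
proof -
  let ?J = "truncation_ideal (q ^ m) :: 'a mpoly set"
  define good where "good s \<longleftrightarrow> fixes_mod (q ^ m) p s \<and> (\<forall>f\<in>?J. psubst s f \<in> ?J)" for s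
  have comp: "good t" if "good s" "good r" "t = (\<lambda>i. psubst r (s i))" for s r t
    using that fixes_mod_comp[of "q ^ m" p s r] unfolding good_def by (auto simp flip: psubst_psubst)
  have sw: "good swap_subst" using swap swap_subst_J by (auto simp: good_def)
  have T: "good (elementary_subst 1 c 0 a)" if "c \<noteq> 0" for c a
    using T[OF that] elementary_subst_J[of _ m 0 1 c a] by (auto simp: good_def)
  have U: "good (elementary_subst 2 c 0 a)" if "c \<noteq> 0" for c a
    using U[OF that] elementary_subst_J[of _ m 0 2 c a] by (auto simp: good_def)
  note [simp] = elementary_subst_def swap_subst_def fun_eq_iff psubst_add psubst_mult
  have U': "good (elementary_subst 2 c 1 a)" if "c \<noteq> 0" for c a
    by (rule comp[OF comp[OF sw U[OF that, of a] refl] sw]) simp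
  have T': "good (elementary_subst 0 c 1 a)" if "c \<noteq> 0" for c a
    by (rule comp[OF comp[OF sw T[OF that, of a] refl] sw]) simp
  have G: "good (Var(0 := Const a * Var 0 + Const b * Var 1, 1 := Const c * Var 0 + Const d * Var 1))"
    if "a * d - b * c \<noteq> 0" "a \<noteq> 0" for a b c d
  proof (rule comp[OF T T'[OF that(2)]])
    \<comment> \<open>$Y \mapsto (d - cb/a)Y + (c/a)X$ followed by $X \mapsto aX + bY$.\<close>
    show "d - c * b / a \<noteq> 0" using that by (auto simp: field_simps)
    have "Const (d - c * b / a) + Const (c / a) * Const b = Const d" "Const (c / a) * Const a = Const c"
      using that by (simp_all add: mult.commute flip: Const_mult Const_add)
    then have "Const (d - c * b / a) * Var 1 + Const (c / a) * (Const a * Var 0 + Const b * Var 1)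
       = Const c * Var 0 + Const d * Var 1"
      by (simp add: distrib_left distrib_right mult.assoc[symmetric] add.left_commute add.commute) (simp add: distrib_right[symmetric] add.commute)
    then show "Var(0 := Const a * Var 0 + Const b * Var 1, 1 := Const c * Var 0 + Const d * Var 1)
        = (\<lambda>i. psubst (elementary_subst 0 a 1 b) (elementary_subst 1 (d - c * b / a) 0 (c / a) i))"
      by simp
  qed
  have G: "good (Var(0 := Const a * Var 0 + Const b * Var 1, 1 := Const c * Var 0 + Const d * Var 1))"
  proof (cases "a = 0")
    case False then show ?thesis using G D by blast
  next
    case True
    then have "c * b - d * a \<noteq> 0" "c \<noteq> 0" using D by auto
    from G[OF this] show ?thesis by (rule comp[OF sw]) simp
  qed
  have UU: "good (Var(2 := Const e * Var 0 + Const f * Var 1 + Const h * Var 2))"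
    by (rule comp[OF U'[of 1 f] U[OF h, of e]]) simp_all
  have "good (P21_subst a b c d e f h)"
    by (rule comp[OF G UU]) (simp add: P21_subst_def)
  then show ?thesis by (simp add: good_def)
qed

text \<open>
  This turns invariance of a class into congruences for the generators; conversely each generator
  is itself the substitution of an element of $P(2,1)$.
\<close>

lemma Q_class_invariant_iff:
  fixes p :: "'a mpoly"
  assumes p: "p \<in> carrier (S_ring 3)"
  shows "(\<forall>g\<in>P21. Q_act m 3 g (Q_class m 3 p) = Q_class m 3 p) \<longleftrightarrow>
    fixes_mod (q ^ m) p swap_subst \<and>
    (\<forall>c a. c \<noteq> 0 \<longrightarrow> fixes_mod (q ^ m) p (elementary_subst 1 c 0 a)) \<and>
    (\<forall>c a. c \<noteq> 0 \<longrightarrow> fixes_mod (q ^ m) p (elementary_subst 2 c 0 a))"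
proof -
  have *: "Q_act m 3 g (Q_class m 3 p) = Q_class m 3 p \<longleftrightarrow> fixes_mod (q ^ m) p s"
    if "lin_subst 3 g = psubst s" for g s
  proof -
    have "psubst s p \<in> carrier (S_ring 3)" using S_lin_subst[OF p, of g] by (simp add: that)
    then show ?thesis
      using p S_uminus[OF p] S_add[of "psubst s p" 3 "- p"]
      by (auto simp: Q_act_Q_class Q_class_eq_iff I_ideal_eq that fixes_mod_def q_def)
  qed
  have gen: "\<exists>g\<in>P21. lin_subst 3 g = psubst (P21_subst a b c d e f h)" if "a * d - b * c \<noteq> 0" "h \<noteq> 0" for a b c d e f h :: 'a
    using P21_subst_imp_P21[OF that] by metis
  have sw: "swap_subst = (P21_subst 0 1 1 0 0 0 1 :: nat \<Rightarrow> 'a mpoly)"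
    and T: "elementary_subst 1 c 0 a = (P21_subst 1 0 a c 0 0 1 :: nat \<Rightarrow> 'a mpoly)"
    and U: "elementary_subst 2 c 0 a = (P21_subst 1 0 0 1 a 0 c :: nat \<Rightarrow> 'a mpoly)" for c a
    by (auto simp: swap_subst_def elementary_subst_def P21_subst_def fun_eq_iff)
  show ?thesis
  proof (intro iffI conjI allI impI ballI)
    assume inv: "\<forall>g\<in>P21. Q_act m 3 g (Q_class m 3 p) = Q_class m 3 p"
    have "fixes_mod (q ^ m) p (P21_subst a b c d e f h)" if "a * d - b * c \<noteq> 0" "h \<noteq> 0" for a b c d e f h
      using gen[OF that, of e f] * inv by blast
    note 1 = this
    show "fixes_mod (q ^ m) p swap_subst"
      unfolding sw by (rule 1) simp_all
    fix c a :: 'a assume "c \<noteq> 0"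
    then show "fixes_mod (q ^ m) p (elementary_subst 1 c 0 a)" "fixes_mod (q ^ m) p (elementary_subst 2 c 0 a)"
      unfolding T U by (intro 1; simp)+
  next
    fix g :: "'a mat" assume "g \<in> P21"
    then obtain a b c d e f h where g: "lin_subst 3 g = psubst (P21_subst a b c d e f h)" "a * d - b * c \<noteq> 0" "h \<noteq> 0"
      by (rule P21_imp_P21_subst)
    assume "fixes_mod (q ^ m) p swap_subst \<and>
      (\<forall>c a. c \<noteq> 0 \<longrightarrow> fixes_mod (q ^ m) p (elementary_subst 1 c 0 a)) \<and>
      (\<forall>c a. c \<noteq> 0 \<longrightarrow> fixes_mod (q ^ m) p (elementary_subst 2 c 0 a))"
    then show "Q_act m 3 g (Q_class m 3 p) = Q_class m 3 p"
      unfolding *[OF g(1)] using fixes_mod_P21_subst[OF _ _ _ g(2,3)] by blast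
  qed
qed

end

section \<open>Dickson invariants modulo the truncation ideal\<close>

text \<open>
  Rewriting \<open>1\<close> to \<open>Suc 0\<close> would spoil \<open>Var 1\<close> and
  exponents like \<open>q - 1\<close>.
\<close>

declare One_nat_def [simp del]

lemma psubst_diff: "psubst s (f - g) = psubst s f - psubst s (g :: 'a::comm_ring_1 mpoly)"
  using psubst_add[of s "f - g" g] by (simp add: algebra_simps)

lemma psubst_uminus: "psubst s (- g) = - psubst s (g :: 'a::comm_ring_1 mpoly)"
  using psubst_diff[of s 0 g] by simp

lemma exists_interval:
  fixes f :: "nat \<Rightarrow> nat"
  assumes "f 0 \<le> x" "x < f n"
  shows "\<exists>l<n. f l \<le> x \<and> x < f (Suc l)"
  using assms(2)
proof (induction n)
  case 0 then show ?case using assms(1) by simp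
next
  case (Suc n)
  then show ?case
    by (cases "x < f n") (auto intro: less_SucI)
qed

lemma Delta2_iff:
  assumes q: "q \<ge> 2"
  shows "(a, b) \<in> Delta2 q m \<longleftrightarrow> (\<exists>l1 l2. l1 \<le> m - 2 \<and> l2 \<le> l1 \<and>
     qint q l1 - qint q l2 \<le> a \<and> a < qint q (Suc l1) - qint q l2 \<and> qint q l2 \<le> b \<and> b < qint q (Suc l2))"
proof -
  have *: "(q ^ i - q ^ j) div (q - 1) = qint q i - qint q j" for i j
  proof -
    have "q ^ i - q ^ j = (q - 1) * (qint q i - qint q j)"
      using qint_eq[OF q, of i] qint_eq[OF q, of j] by (simp add: diff_mult_distrib2)
    then show ?thesis using q by simp
  qed
  have **: "(q ^ i - 1) div (q - 1) = qint q i" for i by (simp add: qint_def)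
  show ?thesis unfolding Delta2_def * ** Suc_eq_plus1 by simp
qed

text \<open>
  $\Delta^m_2$ is a staircase: since $b$ determines $\lambda_2$ and then $a$ determines
  $\lambda_1$, its complement is the union of the quadrants with the corners $([m-1]_q - [l]_q,
  [l]_q)$, $0 \le l < m$. These corners are the exponents of the leading monomials of the
  relations in \<open>L_relation_in_J\<close>.
\<close>

lemma not_in_Delta2:
  assumes q: "q \<ge> 2" and m: "m \<ge> 2" and "(a, b) \<notin> Delta2 q m"
  obtains l where "l < m" "qint q (m - 1) - qint q l \<le> a" "qint q l \<le> b"
proof (cases "b < qint q (m - 1)")
  case False
  then show ?thesis using m by (intro that[of "m - 1"]) auto
next
  case True
  then obtain l where l: "l < m - 1" "qint q l \<le> b" "b < qint q (Suc l)"
    using exists_interval[of "qint q" b "m - 1"] by auto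
  have "qint q (m - 1) - qint q l \<le> a"
  proof (rule ccontr)
    assume "\<not> ?thesis"
    then have "a + qint q l < qint q (m - 1)" by simp
    then obtain k where k: "k < m - 1" "qint q k \<le> a + qint q l" "a + qint q l < qint q (Suc k)"
      using exists_interval[of "qint q" "a + qint q l" "m - 1"] by auto
    have "l \<le> k"
    proof (rule ccontr)
      assume "\<not> l \<le> k"
      then have "qint q (Suc k) \<le> qint q l" by (intro qint_mono[OF q]) simp
      then show False using k by simp
    qed
    then have "(a, b) \<in> Delta2 q m"
      using k l m unfolding Delta2_iff[OF q] by (intro exI[of _ k] exI[of _ l]) auto
    then show False using assms(3) by simp
  qed
  then show ?thesis using l by (intro that[of l]) auto
qed

context finite_field_polynomials
begin

text \<open>
  \<open>v\<close> marks $(q-1)$-st powers of variables; \<open>E1\<close>, \<open>E0\<close> are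
  $Q_{2,1}$, $Q_{2,0}$, and \<open>VV\<close> is the orbit product of $Z$ over the span of $X$ and
  $Y$.
\<close>

abbreviation X :: "'a mpoly" where "X \<equiv> Var 0"
abbreviation Y :: "'a mpoly" where "Y \<equiv> Var 1"
abbreviation Z :: "'a mpoly" where "Z \<equiv> Var 2"
abbreviation vX :: "'a mpoly" where "vX \<equiv> X ^ (q - 1)"
abbreviation vY :: "'a mpoly" where "vY \<equiv> Y ^ (q - 1)"
abbreviation VY :: "'a mpoly" where "VY \<equiv> V2 X Y"
abbreviation VZ :: "'a mpoly" where "VZ \<equiv> V2 X Z"
abbreviation WY :: "'a mpoly" where "WY \<equiv> VY ^ (q - 1)"
abbreviation E1 :: "'a mpoly" where "E1 \<equiv> D1 X Y"
abbreviation E0 :: "'a mpoly" where "E0 \<equiv> D0 X Y"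
abbreviation VV :: "'a mpoly" where "VV \<equiv> V3 X Y Z"
abbreviation L :: "'a mpoly" where "L \<equiv> L2 X Y"

lemma psubst_V2: "psubst s (V2 a b) = V2 (psubst s a) (psubst s b)"
  by (simp add: V2_def psubst_diff psubst_mult psubst_power)
lemma psubst_L2: "psubst s (L2 a b) = L2 (psubst s a) (psubst s b)"
  by (simp add: L2_def psubst_diff psubst_mult psubst_power)
lemma psubst_D1: "psubst s (D1 a b) = D1 (psubst s a) (psubst s b)"
  by (simp add: D1_def psubst_V2 psubst_add psubst_mult psubst_power)
lemma psubst_D0: "psubst s (D0 a b) = D0 (psubst s a) (psubst s b)"
  by (simp add: D0_def psubst_V2 psubst_mult psubst_power)
lemma psubst_alpha: "psubst s (alpha n a b) = alpha n (psubst s a) (psubst s b)"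
  by (simp add: alpha_def psubst_sum psubst_mult psubst_power)
lemma psubst_V3: "psubst s (V3 a b c) = V3 (psubst s a) (psubst s b) (psubst s c)"
  by (simp add: V3_def psubst_diff psubst_add psubst_mult psubst_power psubst_D1 psubst_D0)

lemmas psubst_simps = psubst_V2 psubst_L2 psubst_D1 psubst_D0 psubst_alpha psubst_V3
  psubst_add psubst_diff psubst_mult psubst_power psubst_uminus

lemma Var_neq_0: "(Var i :: 'a mpoly) \<noteq> 0"
  using lookup_Var_1[of i i, where ?'a = 'a] by auto

lemma L2_neq_0:
  assumes "i \<noteq> j"
  shows "L2 (Var i) (Var j :: 'a mpoly) \<noteq> 0"
proof
  assume *: "L2 (Var i) (Var j :: 'a mpoly) = 0"
  let ?t = "Poly_Mapping.single i 1 + Poly_Mapping.single j q"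
  have "L2 (Var i) (Var j :: 'a mpoly) = Poly_Mapping.single ?t 1 - Poly_Mapping.single (Poly_Mapping.single i q + Poly_Mapping.single j 1) 1"
    by (simp add: L2_def Var_power mult_single) (simp add: Var_def mult_single)
  moreover have "Poly_Mapping.single i q + Poly_Mapping.single j 1 \<noteq> ?t"
  proof
    assume "Poly_Mapping.single i q + Poly_Mapping.single j 1 = ?t"
    then have "Poly_Mapping.lookup (Poly_Mapping.single i q + Poly_Mapping.single j 1) i = Poly_Mapping.lookup ?t i" by simp
    then show False using assms q_ge2 by (simp add: lookup_add lookup_single when_def)
  qed
  ultimately have "Poly_Mapping.lookup (L2 (Var i) (Var j :: 'a mpoly)) ?t = 1"
    by (simp add: lookup_minus lookup_single when_def)
  then show False using * by simp
qed

lemma Const_power_q1: "c \<noteq> 0 \<Longrightarrow> Const c ^ (q - 1) = (1 :: 'a mpoly)"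
  by (simp add: scalar_power_q1 flip: Const_power)

lemma Const_q1: "c \<noteq> 0 \<Longrightarrow> (Const c * a) ^ (q - 1) = (a :: 'a mpoly) ^ (q - 1)"
  by (simp add: power_mult_distrib Const_power_q1)

lemma V2_smult_left: "c \<noteq> 0 \<Longrightarrow> V2 (Const c * a) b = V2 a b"
  by (simp add: V2_def Const_q1)

lemma V2_smult_1: "c \<noteq> 0 \<Longrightarrow> V2 a (Const c * b) ^ (q - 1) = V2 a b ^ (q - 1)"
  by (simp add: V2_smult Const_q1)

lemma frob_sum1: "(\<Sum>i\<in>A. f i :: 'a mpoly) ^ q = (\<Sum>i\<in>A. f i ^ q)"
  using frob_sum[of f A 1] by simp

lemma V2_translate: "c \<noteq> 0 \<Longrightarrow> V2 a (Const c * b + Const d * a) ^ (q - 1) = V2 a b ^ (q - 1)"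
  by (simp add: V2_add V2_smult[of _ d] V2_self V2_smult_1)

lemma D1_translate: "c \<noteq> 0 \<Longrightarrow> D1 a (Const c * b + Const d * a) = D1 a b"
  and D0_translate: "c \<noteq> 0 \<Longrightarrow> D0 a (Const c * b + Const d * a) = D0 a b"
  by (simp_all add: D1_def D0_def V2_translate)

lemma V3_translate: "c \<noteq> 0 \<Longrightarrow> V3 a (Const c * b + Const d * a) e = V3 a b e"
  by (simp add: V3_def D1_translate D0_translate)

lemma D1_smult: "c \<noteq> 0 \<Longrightarrow> D1 (Const c * a) b = D1 a b" "c \<noteq> 0 \<Longrightarrow> D1 a (Const c * b) = D1 a b"
  by (simp_all add: D1_def Const_q1 V2_smult_left V2_smult_1)

lemma D0_smult: "c \<noteq> 0 \<Longrightarrow> D0 (Const c * a) b = D0 a b" "c \<noteq> 0 \<Longrightarrow> D0 a (Const c * b) = D0 a b"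
  by (simp_all add: D0_def Const_q1 V2_smult_left V2_smult_1)

lemma V3_smult_left: "c \<noteq> 0 \<Longrightarrow> V3 (Const c * a) b e = V3 a b e" "c \<noteq> 0 \<Longrightarrow> V3 a (Const c * b) e = V3 a b e"
  by (simp_all add: V3_def D1_smult D0_smult)

text \<open>
  The multiplicative group of the field has exponent exactly $q - 1$: otherwise $t^r - 1$ with $0
  < r < q - 1$ would have $q - 1$ roots.
\<close>

lemma exists_scalar:
  assumes "\<not> (q - 1) dvd k" shows "\<exists>c::'a. c \<noteq> 0 \<and> c ^ k \<noteq> 1"
proof (rule ccontr)
  assume "\<not> ?thesis"
  then have *: "c ^ k = 1" if "c \<noteq> 0" for c :: 'a using that by auto
  let ?r = "k mod (q - 1)"
  have r: "0 < ?r" "?r < q - 1" using assms q_ge2 by (auto simp: dvd_eq_mod_eq_0)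
  have "c ^ ?r = 1" if "c \<noteq> 0" for c :: 'a
  proof -
    have "c ^ k = (c ^ (q - 1)) ^ (k div (q - 1)) * c ^ ?r"
      by (simp flip: power_mult power_add)
    then show ?thesis using *[OF that] that by (simp add: scalar_power_q1)
  qed
  then have "UNIV - {0} \<subseteq> {c :: 'a. poly (monom 1 ?r - 1) c = 0}"
    by (auto simp: poly_monom)
  moreover have "monom 1 ?r - 1 \<noteq> (0 :: 'a poly)"
  proof
    assume "monom 1 ?r - 1 = (0 :: 'a poly)"
    then have "coeff (monom 1 ?r - 1 :: 'a poly) 0 = 0" by simp
    then show False using r(1) by simp
  qed
  ultimately have "card (UNIV - {0 :: 'a}) \<le> degree (monom (1::'a) ?r - 1)"
    by (intro order.trans[OF card_mono card_poly_roots_bound]) simp_all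
  also have "\<dots> \<le> ?r" by (intro degree_diff_le degree_monom_le) simp
  finally show False using r(2) by (simp add: q_def)
qed

text \<open>
  The three rewriting rules that lower exponents in everything that follows.
\<close>

lemma VZ_rule: "Z ^ q = VZ + vX * Z" by (simp add: V2_def)
lemma VY_rule: "Y ^ q = VY + vX * Y" by (simp add: V2_def)
lemma VV_rule: "VZ ^ q = VV + WY * VZ" by (simp add: V3_eq_V2)

text \<open>
  Iterating $b^q = V_2(a,b) + a^{q-1}b$. For $b = Z$ and $q^n = N$ the left-hand side is $0$ in
  $R$, so that the highest power of $V_2$ is expressed by lower ones.
\<close>

lemma power_qn_V2:
  "b ^ (q ^ n) = (\<Sum>j<n. a ^ (q ^ n - q ^ Suc j) * V2 a b ^ (q ^ j)) + a ^ (q ^ n - 1) * b"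
proof (induction n)
  case (Suc n)
  have "b ^ q ^ Suc n = (b ^ q ^ n) ^ (q ^ 1)" by (simp add: mult.commute flip: power_mult)
  also have "\<dots> = (\<Sum>j<n. (a ^ (q ^ n - q ^ Suc j) * V2 a b ^ (q ^ j)) ^ q) + (a ^ (q ^ n - 1) * b) ^ q"
    by (subst Suc) (simp only: frob_add1 frob_sum1 power_one_right)
  also have "(\<Sum>j<n. (a ^ (q ^ n - q ^ Suc j) * V2 a b ^ (q ^ j)) ^ q)
     = (\<Sum>j<n. a ^ (q ^ Suc n - q ^ Suc (Suc j)) * V2 a b ^ (q ^ Suc j))"
    by (simp add: power_mult_distrib diff_mult_distrib2 mult.commute flip: power_mult)
  also have "(a ^ (q ^ n - 1) * b) ^ q = a ^ (q ^ Suc n - q) * V2 a b + a ^ (q ^ Suc n - 1) * b"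
  proof -
    have "q \<le> q ^ Suc n" using q_ge2 by simp
    then have "q ^ Suc n - 1 = (q ^ Suc n - q) + (q - 1)" using q_ge2 by linarith
    then have *: "a ^ (q ^ Suc n - q) * a ^ (q - 1) = a ^ (q ^ Suc n - 1)" by (simp flip: power_add)
    have "(a ^ (q ^ n - 1) * b) ^ q = a ^ (q ^ Suc n - q) * b ^ q"
      by (simp add: power_mult_distrib diff_mult_distrib2 mult.commute flip: power_mult)
    then show ?thesis unfolding V2_def *[symmetric] by (simp only: algebra_simps)
  qed
  finally show ?case by (simp add: sum.lessThan_Suc_shift del: sum.lessThan_Suc)
qed simp

text \<open>
  The analogue of \<open>power_qn_V2\<close> one rank higher: iterating $c^{q^2} = V_3 +
  Q_{2,1}c^q - Q_{2,0}c$. The part without $V_3$ must be $\alpha c^q + \beta c$ because $V_3$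
  vanishes on the span of $a$ and $b$.
\<close>

lemma power_qn_V3:
  assumes "L2 a b \<noteq> 0"
  shows "c ^ (q ^ Suc n) = (\<Sum>j<n. alpha (n - j) a b ^ (q ^ Suc j) * V3 a b c ^ (q ^ j))
    + alpha (Suc n) a b * c ^ q + beta (Suc n) a b * c"
proof (induction n)
  case 0 then show ?case by (simp add: alpha_1 beta_def alpha_0 power_0_left)
     (use q_ge2 in auto)
next
  case (Suc n)
  have "c ^ q ^ Suc (Suc n) = (c ^ q ^ Suc n) ^ (q ^ 1)" by (simp add: mult.commute flip: power_mult)
  also have "\<dots> = (\<Sum>j<n. (alpha (n - j) a b ^ (q ^ Suc j) * V3 a b c ^ (q ^ j)) ^ q)
      + (alpha (Suc n) a b * c ^ q) ^ q + (beta (Suc n) a b * c) ^ q"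
    by (subst Suc) (simp only: frob_add1 frob_sum1 power_one_right)
  also have "(\<Sum>j<n. (alpha (n - j) a b ^ (q ^ Suc j) * V3 a b c ^ (q ^ j)) ^ q)
    = (\<Sum>j<n. alpha (n - j) a b ^ (q ^ Suc (Suc j)) * V3 a b c ^ (q ^ Suc j))"
    by (simp add: power_mult_distrib mult.commute flip: power_mult)
  also have "(alpha (Suc n) a b * c ^ q) ^ q = alpha (Suc n) a b ^ q * (V3 a b c + D1 a b * c ^ q - D0 a b * c)"
    by (simp add: V3_def power_mult_distrib power2_eq_square flip: power_mult)
  also have "(beta (Suc n) a b * c) ^ q = (alpha (Suc (Suc n)) a b - D1 a b * alpha (Suc n) a b ^ q) * c ^ q"
  proof -
    have "beta (Suc n) a b ^ q = - (D0 a b ^ q * alpha n a b ^ (q\<^sup>2))"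
      using frob_uminus[of "D0 a b * alpha n a b ^ q" 1]
      by (simp add: beta_def power_mult_distrib power2_eq_square flip: power_mult)
    then show ?thesis by (simp add: alpha_rec[OF assms] power_mult_distrib)
  qed
  finally show ?case
    by (simp add: sum.lessThan_Suc_shift beta_def algebra_simps del: sum.lessThan_Suc)
qed

text \<open>
  The span of the monomials $Q_{2,1}^aQ_{2,0}^b$ with $a < K$. Only the exponent of $Q_{2,1}$ is
  recorded: it is the one by which \<open>reduce_to_Delta2\<close> inducts.
\<close>

inductive_set dickson_span :: "nat \<Rightarrow> 'a mpoly set" for K where
  zero: "0 \<in> dickson_span K"
| step: "h \<in> dickson_span K \<Longrightarrow> a < K \<Longrightarrow> Const c * E1 ^ a * E0 ^ b + h \<in> dickson_span K"

lemma dickson_span_monomial: "a < K \<Longrightarrow> Const c * E1 ^ a * E0 ^ b \<in> dickson_span K"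
  using dickson_span.step[OF dickson_span.zero] by fastforce

lemma dickson_span_add: "h \<in> dickson_span K \<Longrightarrow> g \<in> dickson_span K \<Longrightarrow> h + g \<in> dickson_span K"
  by (induction h rule: dickson_span.induct) (simp_all add: add.assoc dickson_span.step)

lemma dickson_span_mono: "h \<in> dickson_span K \<Longrightarrow> K \<le> K' \<Longrightarrow> h \<in> dickson_span K'"
  by (induction h rule: dickson_span.induct) (auto intro: dickson_span.intros)

lemma dickson_span_mult_monomial:
  "h \<in> dickson_span K \<Longrightarrow> K + a \<le> K' \<Longrightarrow> Const c * E1 ^ a * E0 ^ b * h \<in> dickson_span K'"
proof (induction h rule: dickson_span.induct)
  case (step h a' c' b')
  have "Const c * E1 ^ a * E0 ^ b * (Const c' * E1 ^ a' * E0 ^ b' + h)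
     = Const (c * c') * E1 ^ (a + a') * E0 ^ (b + b') + Const c * E1 ^ a * E0 ^ b * h"
    by (simp add: Const_mult power_add algebra_simps)
  then show ?case using step by (simp add: dickson_span.step)
qed (simp add: dickson_span.zero)

lemma dickson_span_frob:
  "h \<in> dickson_span K \<Longrightarrow> (\<And>a. a < K \<Longrightarrow> q ^ n * a < K') \<Longrightarrow> h ^ (q ^ n) \<in> dickson_span K'"
proof (induction h rule: dickson_span.induct)
  case zero
  have "0 ^ (q ^ n) = (0 :: 'a mpoly)" using q_ge2 by simp
  then show ?case using dickson_span.zero by (simp only:)

next
  case (step h a c b)
  have "(Const c * E1 ^ a * E0 ^ b + h) ^ (q ^ n) = Const c * E1 ^ (q ^ n * a) * E0 ^ (q ^ n * b) + h ^ (q ^ n)"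
    by (simp add: frob_add power_mult_distrib mult.commute flip: power_mult)
  then show ?case using step by (simp add: dickson_span.step)
qed

text \<open>
  In the recursion \<open>alpha_rec\<close> the first term contributes $Q_{2,1} \cdot
  Q_{2,1}^{q[n-1]}$ and $[n] = 1 + q[n-1]$, while the second one has the smaller degree $q^2[n-2]
  = [n] - 1 - q$ in $Q_{2,1}$.
\<close>

lemma alpha_leading: "alpha (Suc n) X Y - E1 ^ qint q n \<in> dickson_span (qint q n)"
proof (induction n rule: less_induct)
  case (less n)
  consider "n = 0" | "n = 1" | k where "n = Suc (Suc k)" by (metis One_nat_def not0_implies_Suc)
  then show ?case
  proof cases
    case 1 then show ?thesis by (simp add: alpha_1 dickson_span.zero)
  next
    case 2 then show ?thesis
      using qint_1[OF q_ge2] D1_eq_alpha[of X Y] by (simp add: dickson_span.zero numeral_2_eq_2 One_nat_def)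
  next
    case 3
    let ?Q = "qint q"
    define r where "r = alpha (Suc (Suc k)) X Y - E1 ^ ?Q (Suc k)"
    define s where "s = alpha (Suc k) X Y - E1 ^ ?Q k"
    have r: "r \<in> dickson_span (?Q (Suc k))" and s: "s \<in> dickson_span (?Q k)"
      using less[of "Suc k"] less[of k] by (auto simp: r_def s_def 3)
    have Q: "?Q n = Suc (q * ?Q (Suc k))" "?Q (Suc k) = Suc (q * ?Q k)" by (simp_all add: 3 qint_Suc(2)[OF q_ge2])
    have "alpha (Suc n) X Y = E1 * (E1 ^ ?Q (Suc k) + r) ^ q - E0 ^ q * (E1 ^ ?Q k + s) ^ (q\<^sup>2)"
      by (simp add: 3 alpha_rec[OF L2_neq_0] r_def s_def)
    also have "(E1 ^ ?Q (Suc k) + r) ^ q = E1 ^ (q * ?Q (Suc k)) + r ^ (q ^ 1)"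
      by (simp add: frob_add1 mult.commute flip: power_mult)
    also have "(E1 ^ ?Q k + s) ^ (q\<^sup>2) = E1 ^ (q\<^sup>2 * ?Q k) + s ^ (q ^ 2)"
      by (simp add: frob_add mult.commute flip: power_mult)
    finally have eq: "alpha (Suc n) X Y - E1 ^ ?Q n = Const 1 * E1 ^ 1 * E0 ^ 0 * r ^ (q ^ 1) +
        (Const (- 1) * E1 ^ (q\<^sup>2 * ?Q k) * E0 ^ q + Const (- 1) * E1 ^ 0 * E0 ^ q * s ^ (q ^ 2))"
      by (simp add: Q(1) Const_uminus algebra_simps)
    show ?thesis unfolding eq
    proof (intro dickson_span_add dickson_span_mult_monomial dickson_span_monomial)
      show "r ^ (q ^ 1) \<in> dickson_span (q * ?Q (Suc k))"
        using q_ge2 by (intro dickson_span_frob[OF r]) simp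
      show "q\<^sup>2 * ?Q k < ?Q n" by (simp add: Q power2_eq_square)
      show "s ^ (q ^ 2) \<in> dickson_span (q\<^sup>2 * ?Q k)"
        using q_ge2 by (intro dickson_span_frob[OF s]) simp
      show "q\<^sup>2 * ?Q k + 0 \<le> ?Q n" by (simp add: Q power2_eq_square)
    qed (simp add: Q)
  qed
qed

lemma alpha_in_dickson_span: "alpha n X Y \<in> dickson_span (Suc (qint q n))"
proof (cases n)
  case 0 then show ?thesis by (simp add: alpha_0 dickson_span.zero)
next
  case (Suc k)
  have "alpha n X Y = Const 1 * E1 ^ qint q k * E0 ^ 0 + (alpha (Suc k) X Y - E1 ^ qint q k)"
    by (simp add: Suc)
  also have "\<dots> \<in> dickson_span (Suc (qint q n))"
    using qint_mono[OF q_ge2, of k n] Suc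
    by (intro dickson_span.step dickson_span_mono[OF alpha_leading]) auto
  finally show ?thesis .
qed

lemma L_alpha_in_J: "L * alpha m X Y \<in> truncation_ideal (q ^ m)"
  unfolding L2_alpha by (intro J_diff J_mult J_mult_right J_Var) auto

lemma L_beta_in_J: "m \<ge> 1 \<Longrightarrow> L * beta m X Y \<in> truncation_ideal (q ^ m)"
  unfolding L2_beta[OF L2_neq_0[of 0 1, simplified]] by (intro J_diff J_mult_right[OF J_Var] J_mult[OF J_Var]) auto

text \<open>
  For $l = 0$ and $l = 1$ these are the Moore determinants of $X$, $Y$ in which one row consists
  of $N$-th powers. The others follow by the recursion for $\alpha$, read backwards: it expresses
  the $l$-th relation by the two before it.
\<close>

lemma L_relation_in_J:
  assumes "l < m"
  shows "L * (E0 ^ qint q l * alpha (m - l) X Y ^ (q ^ l)) \<in> truncation_ideal (q ^ m)"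
  using assms
proof (induction l rule: less_induct)
  case (less l)
  consider "l = 0" | "l = 1" | k where "l = Suc (Suc k)" by (metis One_nat_def not0_implies_Suc)
  then show ?case
  proof cases
    case 1 then show ?thesis using L_alpha_in_J[of m] by simp
  next
    case 2
    then have "L * (E0 ^ qint q l * alpha (m - l) X Y ^ (q ^ l)) = - (L * beta m X Y)"
      by (simp add: beta_def One_nat_def qint_1[OF q_ge2])
    then show ?thesis using L_beta_in_J[of m] less.prems by (simp add: J_uminus)
  next
    case 3
    define n where "n = m - l"
    have n: "m - k = Suc (Suc n)" "m - Suc k = Suc n" "m - l = n" using less.prems 3 by (auto simp: n_def)
    have "alpha (Suc (Suc n)) X Y ^ (q ^ k) = (E1 * alpha (Suc n) X Y ^ q - E0 ^ q * alpha n X Y ^ (q\<^sup>2)) ^ (q ^ k)"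
      by (simp add: alpha_rec[OF L2_neq_0])
    also have "\<dots> = E1 ^ (q ^ k) * alpha (Suc n) X Y ^ (q ^ Suc k) - E0 ^ (q ^ Suc k) * alpha n X Y ^ (q ^ l)"
      by (simp add: frob_diff power_mult_distrib 3 power2_eq_square mult.assoc flip: power_mult)
    finally have eq: "alpha (Suc (Suc n)) X Y ^ (q ^ k) =
      E1 ^ (q ^ k) * alpha (Suc n) X Y ^ (q ^ Suc k) - E0 ^ (q ^ Suc k) * alpha n X Y ^ (q ^ l)" .
    have eq': "E0 ^ qint q l * alpha n X Y ^ (q ^ l) =
       E1 ^ (q ^ k) * (E0 ^ qint q (Suc k) * alpha (Suc n) X Y ^ (q ^ Suc k)) - E0 ^ (q ^ k) * (E0 ^ qint q k * alpha (Suc (Suc n)) X Y ^ (q ^ k))"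
      unfolding eq by (simp add: 3 qint_Suc(1)[OF q_ge2] power_add algebra_simps)
    have k: "L * (E0 ^ qint q k * alpha (Suc (Suc n)) X Y ^ (q ^ k)) \<in> truncation_ideal (q ^ m)"
      "L * (E0 ^ qint q (Suc k) * alpha (Suc n) X Y ^ (q ^ Suc k)) \<in> truncation_ideal (q ^ m)"
      using less.IH[of k] less.IH[of "Suc k"] less.prems 3 n by simp_all
    have "L * (E0 ^ qint q l * alpha n X Y ^ (q ^ l)) =
       E1 ^ (q ^ k) * (L * (E0 ^ qint q (Suc k) * alpha (Suc n) X Y ^ (q ^ Suc k))) - E0 ^ (q ^ k) * (L * (E0 ^ qint q k * alpha (Suc (Suc n)) X Y ^ (q ^ k)))"
      unfolding eq' by (simp add: algebra_simps)
    also have "\<dots> \<in> truncation_ideal (q ^ m)"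
      by (intro J_diff J_mult[OF k(1)] J_mult[OF k(2)])
    finally show ?thesis using n by simp
  qed
qed

text \<open>
  By \<open>not_in_Delta2\<close> a monomial outside $\Delta^m_2$ is a multiple of the leading
  monomial $Q_{2,1}^{[m-1]-[l]}Q_{2,0}^{[l]}$ of one of the relations, which replaces it by
  monomials with a smaller exponent of $Q_{2,1}$; that of $Q_{2,0}$ may grow without harm. The
  predicate \<open>P\<close> stands for any property that is stable under linear combinations and
  holds on the ideal: it will be the kernel of a functional and, in the proof of independence,
  membership in a span.
\<close>

lemma reduce_to_Delta2:
  assumes m: "m \<ge> 2"
    and add: "\<And>f g. P f \<Longrightarrow> P g \<Longrightarrow> P (f + g)" and scale: "\<And>c f. P f \<Longrightarrow> P (Const c * f)"
    and J: "\<And>f. f \<in> truncation_ideal (q ^ m) \<Longrightarrow> P f"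
    and Delta: "\<And>a b. (a, b) \<in> Delta2 q m \<Longrightarrow> P (L * g * (E1 ^ a * E0 ^ b))"
  shows "P (L * g * (E1 ^ a * E0 ^ b))"
proof (induction a arbitrary: b rule: less_induct)
  case (less a)
  have span: "P (L * g * h)" if "h \<in> dickson_span a" for h
    using that
  proof (induction h rule: dickson_span.induct)
    case zero then show ?case using J by simp
  next
    case (step h a' c b')
    have "L * g * (Const c * E1 ^ a' * E0 ^ b' + h) = Const c * (L * g * (E1 ^ a' * E0 ^ b')) + L * g * h"
      by (simp add: algebra_simps)
    then show ?case using step less.IH[of a' b'] by (simp add: add scale)
  qed
  show ?case
  proof (cases "(a, b) \<in> Delta2 q m")
    case True then show ?thesis by (rule Delta)
  next
    case False
    then obtain l where l: "l < m" "qint q (m - 1) - qint q l \<le> a" "qint q l \<le> b"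
      using not_in_Delta2[OF q_ge2 m] by blast
    \<comment> \<open>The leading monomial of the $l$-th relation has the exponent $q^l[n]_q = [m-1]_q - [l]_q$ of $Q_{2,1}$.\<close>
    define n where "n = m - 1 - l"
    have n: "m - l = Suc n" using l by (simp add: n_def)
    have E: "q ^ l * qint q n + qint q l = qint q (m - 1)"
    proof -
      have "(q - 1) * (q ^ l * qint q n + qint q l) + 1 = q ^ l * ((q - 1) * qint q n + 1) - q ^ l + ((q - 1) * qint q l + 1)"
        by (simp add: algebra_simps)
      also have "\<dots> = q ^ (l + n) - q ^ l + q ^ l"
        unfolding qint_eq[OF q_ge2] by (simp add: power_add)
      also have "\<dots> = q ^ (m - 1)"
        using l q_ge2 by (simp add: n_def power_increasing)
      also have "\<dots> = (q - 1) * qint q (m - 1) + 1" using qint_eq[OF q_ge2] by simp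
      finally have "(q - 1) * (q ^ l * qint q n + qint q l) = (q - 1) * qint q (m - 1)" by linarith
      then show ?thesis using q_ge2 by (simp only: mult_cancel1) simp
    qed
    define r where "r = alpha (Suc n) X Y - E1 ^ qint q n"
    let ?e = "q ^ l * qint q n"
    have ea: "?e \<le> a" using l(2) E by linarith
    have r: "r ^ (q ^ l) \<in> dickson_span ?e"
      using q_ge2 alpha_leading[of n] unfolding r_def by (rule_tac dickson_span_frob) auto
    have "E0 ^ qint q l * alpha (m - l) X Y ^ (q ^ l) = E0 ^ qint q l * (E1 ^ qint q n + r) ^ (q ^ l)"
      by (simp add: n r_def)
    also have "\<dots> = E0 ^ qint q l * (E1 ^ ?e + r ^ (q ^ l))"
      by (simp add: frob_add mult.commute flip: power_mult)
    finally have eq: "E0 ^ qint q l * alpha (m - l) X Y ^ (q ^ l) = E0 ^ qint q l * (E1 ^ ?e + r ^ (q ^ l))" .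
    have "E1 ^ a = E1 ^ (a - ?e) * E1 ^ ?e" "E0 ^ b = E0 ^ (b - qint q l) * E0 ^ qint q l"
      using ea l(3) by (simp_all flip: power_add)
    then have eq': "E1 ^ a * E0 ^ b = E1 ^ (a - ?e) * E0 ^ (b - qint q l) * (E0 ^ qint q l * alpha (m - l) X Y ^ (q ^ l))
       - E1 ^ (a - ?e) * E0 ^ b * r ^ (q ^ l)"
      unfolding eq by (simp add: distrib_left ac_simps)
    have "L * g * (E1 ^ a * E0 ^ b) = g * E1 ^ (a - ?e) * E0 ^ (b - qint q l) * (L * (E0 ^ qint q l * alpha (m - l) X Y ^ (q ^ l)))
       + L * g * (Const (-1) * E1 ^ (a - ?e) * E0 ^ b * r ^ (q ^ l))"
      unfolding eq' by (simp add: algebra_simps Const_uminus)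
    also have "P \<dots>"
      using ea by (intro add J[OF J_mult[OF L_relation_in_J[OF l(1)]]] span dickson_span_mult_monomial[OF r]) simp
    finally show ?thesis .
  qed
qed

end

section \<open>Functionals on the coinvariants\<close>

text \<open>
  Linear functionals on $R$ that are constant on the orbits of $P(2,1)$; by
  \<open>fixes_mod_P21_subst\<close> the three kinds of generators are enough.
\<close>

locale coinvariant_functional = finite_field_polynomials q field_type
  for q :: nat and field_type :: "'a::{field,finite} itself" +
  fixes m :: nat and \<phi> :: "'a mpoly \<Rightarrow> 'a"
  assumes m3: "m \<ge> 3"
    and phi_add: "\<phi> (f + g) = \<phi> f + \<phi> g"
    and phi_Const: "\<phi> (Const c * f) = c * \<phi> f"
    and phi_J: "f \<in> truncation_ideal (q ^ m) \<Longrightarrow> \<phi> f = 0"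
    and phi_swap: "\<phi> (psubst swap_subst f) = \<phi> f"
    and phi_T: "c \<noteq> 0 \<Longrightarrow> \<phi> (psubst (elementary_subst 1 c 0 a) f) = \<phi> f"
    and phi_U: "c \<noteq> 0 \<Longrightarrow> \<phi> (psubst (elementary_subst 2 c 0 a) f) = \<phi> f"
begin

lemma phi_0 [simp]: "\<phi> 0 = 0" using phi_J[of 0] by simp
lemma phi_uminus: "\<phi> (- f) = - \<phi> f" using phi_add[of f "- f"] by (simp add: eq_neg_iff_add_eq_0 add.commute)
lemma phi_diff: "\<phi> (f - g) = \<phi> f - \<phi> g" using phi_add[of f "- g"] by (simp add: phi_uminus)
lemma phi_sum: "\<phi> (\<Sum>i\<in>A. f i) = (\<Sum>i\<in>A. \<phi> (f i))"
  by (induction A rule: infinite_finite_induct) (simp_all add: phi_add)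

lemma phi_U': "c \<noteq> 0 \<Longrightarrow> \<phi> (psubst (elementary_subst 2 c 1 a) f) = \<phi> f"
proof -
  assume c: "c \<noteq> 0"
  have "psubst (elementary_subst 2 c 1 a) f = psubst swap_subst (psubst (elementary_subst 2 c 0 a) (psubst swap_subst f))"
    unfolding psubst_psubst
    by (rule arg_cong[of _ _ "\<lambda>s. psubst s f"]) (simp add: fun_eq_iff elementary_subst_def swap_subst_def psubst_simps)
  then show ?thesis by (simp add: phi_swap phi_U[OF c])
qed

lemma phi_X: "c \<noteq> 0 \<Longrightarrow> \<phi> (psubst (elementary_subst 0 c 1 a) f) = \<phi> f"
proof -
  assume c: "c \<noteq> 0"
  have "psubst (elementary_subst 0 c 1 a) f = psubst swap_subst (psubst (elementary_subst 1 c 0 a) (psubst swap_subst f))"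
    unfolding psubst_psubst
    by (rule arg_cong[of _ _ "\<lambda>s. psubst s f"]) (simp add: fun_eq_iff elementary_subst_def swap_subst_def psubst_simps)
  then show ?thesis by (simp add: phi_swap phi_T[OF c])
qed

text \<open>
  If a substitution multiplies $f$ by $c^k$ then $\phi(f) = c^k\phi(f)$, and some scalar has $c^k
  \ne 1$.
\<close>

lemma torus:
  assumes "\<And>c f. c \<noteq> 0 \<Longrightarrow> \<phi> (psubst (s c) f) = \<phi> f"
    and "\<And>c. c \<noteq> 0 \<Longrightarrow> psubst (s c) f = Const (c ^ k) * f" and "\<not> (q - 1) dvd k"
  shows "\<phi> f = 0"
proof -
  obtain c :: 'a where c: "c \<noteq> 0" "c ^ k \<noteq> 1" using exists_scalar[OF assms(3)] by auto
  have "c ^ k * \<phi> f = \<phi> f" using assms(1)[OF c(1), of f] assms(2)[OF c(1)] by (simp add: phi_Const)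
  then show ?thesis using c(2) by simp
qed

text \<open>
  The difference of the two sides of the hypothesis is a polynomial in $a$ of degree at most $q -
  1$ that vanishes on the whole field, hence is zero. By \<open>geometric_power\<close> all
  binomial coefficients in its expansion are units, so each coefficient gives one of the values
  claimed to vanish.
\<close>

lemma translation:
  assumes *: "\<And>a. \<phi> (e * (A + Const a * B) ^ (q - 1)) = \<phi> (e * A ^ (q - 1))" and k: "k < q - 1"
  shows "\<phi> (e * A ^ k * B ^ (q - 1 - k)) = 0"
proof -
  define P where "P = (\<Sum>k<q - 1. monom (\<phi> (e * A ^ k * B ^ (q - 1 - k))) (q - 1 - k))"
  have q: "{..<q} = insert (q - 1) {..<q - 1}" using q_ge2 by auto
  have "poly P a = 0" for a
  proof -
    have "(A + Const (- a) * B) ^ (q - 1) = (\<Sum>k<q. A ^ k * (Const a * B) ^ (q - 1 - k))"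
      using geometric_power[of A "Const a * B"] by (simp add: Const_uminus)
    then have "e * (A + Const (- a) * B) ^ (q - 1)
        = e * A ^ (q - 1) + (\<Sum>k<q-1. Const (a ^ (q - 1 - k)) * (e * A ^ k * B ^ (q - 1 - k)))"
      unfolding q by (simp add: distrib_left sum_distrib_left power_mult_distrib Const_power mult_ac)
    then have "\<phi> (e * (A + Const (- a) * B) ^ (q - 1)) = \<phi> (e * A ^ (q - 1)) + poly P a"
      by (simp add: phi_add phi_sum phi_Const P_def poly_sum poly_monom mult.commute)
    then show ?thesis using * by simp
  qed
  then have roots: "{a. poly P a = 0} = UNIV" by auto
  have "degree P \<le> q - 1"
    unfolding P_def by (intro degree_sum_le) (auto intro: order.trans[OF degree_monom_le])
  then have "degree P < card {a. poly P a = 0}" unfolding roots using q_ge2 by (simp add: q_def[symmetric])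
  then have "P = 0" using card_poly_roots_bound[of P] by linarith
  then have "0 = coeff P (q - 1 - k)" by simp
  also have "\<dots> = (\<Sum>j<q-1. if j = k then \<phi> (e * A ^ j * B ^ (q - 1 - j)) else 0)"
    unfolding P_def coeff_sum by (rule sum.cong) (use k in auto)
  finally show ?thesis using k by simp
qed

text \<open>
  Invariance under the unipotent substitutions $Y \mapsto Y + aX$, $Z \mapsto Z + aX$ and $Z
  \mapsto Z + aY$, respectively.
\<close>

definition T_fixed :: "'a mpoly \<Rightarrow> bool" where
  "T_fixed e \<longleftrightarrow> (\<forall>a. psubst (elementary_subst 1 1 0 a) e = e)"
definition U_fixed :: "'a mpoly \<Rightarrow> bool" where
  "U_fixed e \<longleftrightarrow> (\<forall>a. psubst (elementary_subst 2 1 0 a) e = e)"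
definition U'_fixed :: "'a mpoly \<Rightarrow> bool" where
  "U'_fixed e \<longleftrightarrow> (\<forall>a. psubst (elementary_subst 2 1 1 a) e = e)"

lemma V2_translate1: "V2 a (b + Const d * a) = V2 a b"
  by (simp add: V2_add V2_smult V2_self)

lemma T_fixed_simps [simp]:
  "T_fixed e \<Longrightarrow> T_fixed f \<Longrightarrow> T_fixed (e * f)" "T_fixed e \<Longrightarrow> T_fixed f \<Longrightarrow> T_fixed (e + f)"
  "T_fixed e \<Longrightarrow> T_fixed (e ^ n)" "T_fixed X" "T_fixed Z" "T_fixed VY" "T_fixed VZ" "T_fixed E1" "T_fixed E0" "T_fixed VV"
  using D1_translate[of 1 X Y] D0_translate[of 1 X Y] V3_translate[of 1 X Y _ Z]
  by (simp_all add: T_fixed_def psubst_simps elementary_subst_def V2_translate1)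

lemma U_fixed_simps [simp]:
  "U_fixed e \<Longrightarrow> U_fixed f \<Longrightarrow> U_fixed (e * f)" "U_fixed e \<Longrightarrow> U_fixed f \<Longrightarrow> U_fixed (e + f)"
  "U_fixed e \<Longrightarrow> U_fixed (e ^ n)" "U_fixed X" "U_fixed Y" "U_fixed VY" "U_fixed VZ" "U_fixed E1" "U_fixed E0" "U_fixed VV"
  "U_fixed (Const c)" "U_fixed 1" "U_fixed e \<Longrightarrow> U_fixed (- e)"
  by (simp_all add: U_fixed_def psubst_simps elementary_subst_def V2_translate1 V3_add V3_smult V3_left)

lemma U'_fixed_simps [simp]:
  "U'_fixed e \<Longrightarrow> U'_fixed f \<Longrightarrow> U'_fixed (e * f)" "U'_fixed e \<Longrightarrow> U'_fixed f \<Longrightarrow> U'_fixed (e + f)"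
  "U'_fixed e \<Longrightarrow> U'_fixed (e ^ n)" "U'_fixed X" "U'_fixed Y" "U'_fixed VY" "U'_fixed E1" "U'_fixed E0" "U'_fixed VV"
  "U'_fixed 1" "U'_fixed e \<Longrightarrow> U'_fixed (- e)"
  by (simp_all add: U'_fixed_def psubst_simps elementary_subst_def V3_add V3_smult V3_right)

lemma power_split: "k < q - 1 \<Longrightarrow> (a :: 'a mpoly) ^ k * a ^ (q - 1 - k) = a ^ (q - 1)"
  by (simp flip: power_add)

text \<open>
  \<open>translation\<close> for $Y \mapsto Y + aX$: of the factor $X^{q-1}$ the part $X^k$ is
  needed to keep the power of $Y$ general, the rest $X^{q-1-k}$ is what the expansion of $(Y +
  aX)^{q-1}$ produces.
\<close>

lemma low_Y_vanish:
  assumes "T_fixed e" "k < q - 1" shows "\<phi> (vX * e * Y ^ k) = 0"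
proof -
  have "\<phi> (e * X ^ k * Y ^ k * X ^ (q - 1 - k)) = 0"
  proof (rule translation[OF _ assms(2)])
    fix a
    have "psubst (elementary_subst 1 1 0 a) (e * X ^ k * Y ^ (q - 1)) = e * X ^ k * (Y + Const a * X) ^ (q - 1)"
      using assms(1) by (simp add: T_fixed_def psubst_simps elementary_subst_def)
    then show "\<phi> (e * X ^ k * (Y + Const a * X) ^ (q - 1)) = \<phi> (e * X ^ k * Y ^ (q - 1))"
      using phi_T[of 1 a "e * X ^ k * Y ^ (q - 1)"] by simp
  qed
  moreover have "vX * e * Y ^ k = e * X ^ k * Y ^ k * X ^ (q - 1 - k)"
    unfolding power_split[OF assms(2), symmetric] by (simp only: mult_ac)
  ultimately show ?thesis by (simp only:)
qed

lemma low_Z_vanish: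
  assumes "U_fixed e" "k < q - 1" shows "\<phi> (vX * e * Z ^ k) = 0"
proof -
  have "\<phi> (e * X ^ k * Z ^ k * X ^ (q - 1 - k)) = 0"
  proof (rule translation[OF _ assms(2)])
    fix a
    have "psubst (elementary_subst 2 1 0 a) (e * X ^ k * Z ^ (q - 1)) = e * X ^ k * (Z + Const a * X) ^ (q - 1)"
      using assms(1) by (simp add: U_fixed_def psubst_simps elementary_subst_def)
    then show "\<phi> (e * X ^ k * (Z + Const a * X) ^ (q - 1)) = \<phi> (e * X ^ k * Z ^ (q - 1))"
      using phi_U[of 1 a "e * X ^ k * Z ^ (q - 1)"] by simp
  qed
  moreover have "vX * e * Z ^ k = e * X ^ k * Z ^ k * X ^ (q - 1 - k)"
    unfolding power_split[OF assms(2), symmetric] by (simp only: mult_ac)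
  ultimately show ?thesis by (simp only:)
qed

text \<open>
  \<open>translation\<close> for $Z \mapsto Z + aY$, under which $V_2(X,Z)$ becomes $V_2(X,Z) +
  aV_2(X,Y)$. The factor $Z^{q-1}$ is not fixed, but the lower powers of $Z$ that it produces are
  killed by \<open>low_Z_vanish\<close>.
\<close>

lemma low_VZ_vanish:
  assumes e: "U_fixed e" "U'_fixed e" and k: "k < q - 1"
  shows "\<phi> (vX * WY * e * Z ^ (q - 1) * VZ ^ k) = 0"
proof -
  let ?e = "vX * (e * VY ^ k) * Z ^ (q - 1)"
  have "\<phi> (?e * VZ ^ k * VY ^ (q - 1 - k)) = 0"
  proof (rule translation[OF _ k])
    fix a
    let ?W = "VZ + Const a * VY"
    have "\<phi> (?e * VZ ^ (q - 1)) = \<phi> (psubst (elementary_subst 2 1 1 a) (?e * VZ ^ (q - 1)))"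
      by (simp add: phi_U')
    also have "psubst (elementary_subst 2 1 1 a) (?e * VZ ^ (q - 1))
      = vX * (e * VY ^ k) * ?W ^ (q - 1) * (Z - Const (- a) * Y) ^ (q - 1)"
      using e(2) by (simp add: U'_fixed_def psubst_simps elementary_subst_def V2_add V2_smult Const_uminus mult_ac)
    also have "\<dots> = (\<Sum>j<q. vX * (e * VY ^ k * ?W ^ (q - 1) * (Const (- a) * Y) ^ (q - 1 - j)) * Z ^ j)"
      unfolding geometric_power sum_distrib_left by (rule sum.cong) (simp_all only: mult_ac)
    also have "\<phi> \<dots> = (\<Sum>j<q. \<phi> (vX * (e * VY ^ k * ?W ^ (q - 1) * (Const (- a) * Y) ^ (q - 1 - j)) * Z ^ j))"
      by (rule phi_sum)
    also have "\<dots> = (\<Sum>j<q. if j = q - 1 then \<phi> (vX * (e * VY ^ k * ?W ^ (q - 1) * (Const (- a) * Y) ^ (q - 1 - j)) * Z ^ j) else 0)"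
      by (rule sum.cong) (use e in \<open>auto intro!: low_Z_vanish\<close>)
    also have "\<dots> = \<phi> (?e * ?W ^ (q - 1))"
      using q_ge2 by (simp add: mult_ac)
    finally show "\<phi> (?e * (VZ + Const a * VY) ^ (q - 1)) = \<phi> (?e * VZ ^ (q - 1))" by simp
  qed
  moreover have "vX * WY * e * Z ^ (q - 1) * VZ ^ k = ?e * VZ ^ k * VY ^ (q - 1 - k)"
    unfolding power_split[OF k, of VY, symmetric] by (simp only: mult_ac)
  ultimately show ?thesis by (simp only:)
qed

text \<open>
  Expand $Z^{q(q-1)} = (V_2 + X^{q-1}Z)^{q-1}$ with $V_2 = V_2(X,Z)$. In every term but
  $V_2^{q-1}$ a power of $Z$ or of $V_2$ is too low and the previous lemmas kill it.
\<close>

lemma replace_top_Z_power: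
  assumes e: "U_fixed e" "U'_fixed e"
  shows "\<phi> (vX * WY * e * Z ^ (q\<^sup>2 - 1)) = \<phi> (vX * WY * e * Z ^ (q - 1) * VZ ^ (q - 1))"
proof -
  let ?f = "vX * WY * e"
  have q: "{..<q} = insert (q - 1) {..<q - 1}" using q_ge2 by auto
  have "q\<^sup>2 - 1 = (q - 1) + q * (q - 1)"
    using q_ge2 by (cases q) (auto simp: power2_eq_square)
  then have "Z ^ (q\<^sup>2 - 1) = Z ^ (q - 1) * (VZ - (- vX * Z)) ^ (q - 1)"
    by (simp add: power_add power_mult VZ_rule)
  also have "\<dots> = Z ^ (q - 1) * (\<Sum>k<q. VZ ^ k * (- vX * Z) ^ (q - 1 - k))"
    by (simp only: geometric_power)
  finally have eq: "?f * Z ^ (q\<^sup>2 - 1) = ?f * Z ^ (q - 1) * VZ ^ (q - 1)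
     + (\<Sum>k<q - 1. ?f * Z ^ (q - 1) * VZ ^ k * (- vX * Z) ^ (q - 1 - k))"
    unfolding q by (simp add: algebra_simps sum_distrib_left)
  \<comment> \<open>Each of these terms has a factor $Z^{q-1+t}$ with $t \ge 1$; one more use of $Z^q = V_2 + X^{q-1}Z$ leaves $Z^{t-1}$ and $Z^t$.\<close>
  have "(\<Sum>k<q - 1. \<phi> (?f * Z ^ (q - 1) * VZ ^ k * (- vX * Z) ^ (q - 1 - k))) = 0"
  proof (rule sum.neutral, rule ballI)
    fix k assume "k \<in> {..<q - 1}"
    then have k: "k < q - 1" by simp
    let ?t = "q - 1 - k"
    obtain t where t: "?t = Suc t" using k by (cases ?t) auto
    have "(q - 1) + ?t = t + q" using t q_ge2 by linarith
    then have "Z ^ (q - 1) * Z ^ ?t = Z ^ t * Z ^ q" by (simp only: power_add[symmetric])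
    also have "\<dots> = VZ * Z ^ t + vX * Z ^ ?t"
      unfolding VZ_rule t by (simp add: algebra_simps)
    finally have eq: "Z ^ (q - 1) * Z ^ ?t = VZ * Z ^ t + vX * Z ^ ?t" .
    have "?f * Z ^ (q - 1) * VZ ^ k * (- vX * Z) ^ ?t = ?f * VZ ^ k * (- vX) ^ ?t * (Z ^ (q - 1) * Z ^ ?t)"
      by (simp only: power_mult_distrib mult_ac)
    also have "\<dots> = vX * (WY * e * VZ ^ k * (- vX) ^ ?t * VZ) * Z ^ t
        + vX * (WY * e * VZ ^ k * (- vX) ^ ?t * vX) * Z ^ ?t"
      unfolding eq by (simp only: algebra_simps)
    finally have "\<phi> (?f * Z ^ (q - 1) * VZ ^ k * (- vX * Z) ^ ?t)
        = \<phi> (vX * (WY * e * VZ ^ k * (- vX) ^ ?t * VZ) * Z ^ t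
        + vX * (WY * e * VZ ^ k * (- vX) ^ ?t * vX) * Z ^ ?t)" by (rule arg_cong)
    also have "\<dots> = \<phi> (vX * (WY * e * VZ ^ k * (- vX) ^ ?t * vX) * Z ^ ?t)"
      using e t k by (subst phi_add, subst low_Z_vanish) auto
    also have "\<dots> = 0"
    proof (cases "?t < q - 1")
      case True then show ?thesis using e by (intro low_Z_vanish) auto
    next
      case False
      then have "k = 0" using k by simp
      moreover have "\<phi> (vX * WY * (e * (- vX) ^ ?t * vX) * Z ^ (q - 1) * VZ ^ 0) = 0"
        using e q_ge2 by (intro low_VZ_vanish) auto
      ultimately show ?thesis by (simp add: mult_ac)
    qed
    finally show "\<phi> (?f * Z ^ (q - 1) * VZ ^ k * (- vX * Z) ^ (q - 1 - k)) = 0" .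
  qed
  then show ?thesis unfolding eq phi_add phi_sum by simp
qed

end

section \<open>A spanning set of the coinvariants\<close>

text \<open>
  The test polynomials have rank 0, 1 or 2 according to their last factor, a power of $Z$, of
  $V_2(X,Z)$ or of $V_3$: these are the orbit products of $Z$ over the zero space, over the span
  of $X$ and over the span of $X$ and $Y$.
\<close>

locale vanishing_functional = coinvariant_functional q field_type m \<phi>
  for q :: nat and field_type :: "'a::{field,finite} itself" and m and \<phi> :: "'a mpoly \<Rightarrow> 'a" +
  assumes test_0: "i \<le> qint q m \<Longrightarrow> \<phi> (Z ^ ((q - 1) * i)) = 0"
    and test_1: "i < qint q m \<Longrightarrow> l \<le> qint q (m - 1) \<Longrightarrow>
      \<phi> (vY * vX * vX ^ i * Z ^ (q - 1) * VZ ^ ((q - 1) * l)) = 0"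
    and test_2: "(a, b) \<in> Delta2 q m \<Longrightarrow> l \<le> qint q (m - 2) \<Longrightarrow>
      \<phi> (vY * vX * WY * vX ^ q * Z ^ (q\<^sup>2 - 1) * (E1 ^ a * E0 ^ b) * VV ^ ((q - 1) * l)) = 0"
begin

lemma torus_X:
  assumes "\<And>c. c \<noteq> 0 \<Longrightarrow> psubst (elementary_subst 0 c 1 0) f = Const (c ^ k) * f" "\<not> (q - 1) dvd k"
  shows "\<phi> f = 0"
  by (rule torus[where s = "\<lambda>c. elementary_subst 0 c 1 0", OF phi_X assms])

lemma torus_Y:
  assumes "\<And>c. c \<noteq> 0 \<Longrightarrow> psubst (elementary_subst 1 c 0 0) f = Const (c ^ k) * f" "\<not> (q - 1) dvd k"
  shows "\<phi> f = 0"
  by (rule torus[where s = "\<lambda>c. elementary_subst 1 c 0 0", OF phi_T assms])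

lemma torus_Z:
  assumes "\<And>c. c \<noteq> 0 \<Longrightarrow> psubst (elementary_subst 2 c 0 0) f = Const (c ^ k) * f" "\<not> (q - 1) dvd k"
  shows "\<phi> f = 0"
  by (rule torus[where s = "\<lambda>c. elementary_subst 2 c 0 0", OF phi_U assms])

lemmas torus_simps = psubst_simps elementary_subst_def V2_smult_left V2_smult_1 V2_smult
  V3_smult_left V3_smult D1_smult D0_smult Const_q1 power_mult_distrib Const_power Const_mult power_add

lemma N_le: "q ^ m \<le> (q - 1) * Suc (qint q m)"
  using qint_eq[OF q_ge2, of m] q_ge2 by simp

text \<open>
  The exponents covered by \<open>test_1\<close> are reached as follows: $V_2(X,Z)^{q^{m-1}}$ is
  removed by $Z^N = 0$ (\<open>power_qn_V2\<close>), exponents that are not multiples of $q - 1$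
  are killed by the torus, and large powers of $X$ lie in the ideal.
\<close>

lemma rank1_vanish: "\<phi> (vY * vX * X ^ i * Z ^ (q - 1) * VZ ^ c) = 0"
proof (induction c arbitrary: i rule: less_induct)
  case (less c)
  let ?n = "m - 1"
  have m: "m = Suc ?n" "?n = Suc (m - 2)" using m3 by auto
  show ?case
  proof (cases "q ^ ?n \<le> c")
    case True
    let ?c = "c - q ^ ?n"
    let ?e = "vY * vX * X ^ i * Z ^ (q - 1) * VZ ^ ?c"
    have "Z ^ (q ^ m) = (\<Sum>j<?n. X ^ (q ^ m - q ^ Suc j) * VZ ^ (q ^ j)) + VZ ^ (q ^ ?n) + X ^ (q ^ m - 1) * Z"
    proof -
      have "{..<m} = insert ?n {..<?n}" using m by auto
      moreover have "q ^ m - q ^ Suc ?n = 0" using m by simp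
      ultimately show ?thesis using power_qn_V2[of Z m X] by (simp add: add.commute)
    qed
    then have V: "VZ ^ (q ^ ?n) = Z ^ (q ^ m) - X ^ (q ^ m - 1) * Z - (\<Sum>j<?n. X ^ (q ^ m - q ^ Suc j) * VZ ^ (q ^ j))"
      by simp
    have "vY * vX * X ^ i * Z ^ (q - 1) * VZ ^ c = ?e * VZ ^ (q ^ ?n)"
      using True by (simp add: mult.assoc flip: power_add)
    also have "\<dots> = ?e * Z ^ (q ^ m) - X ^ (q - 1 + (q ^ m - 1)) * (vY * X ^ i * Z ^ (q - 1) * VZ ^ ?c * Z)
       - (\<Sum>j<?n. vY * vX * X ^ (i + (q ^ m - q ^ Suc j)) * Z ^ (q - 1) * VZ ^ (?c + q ^ j))"
      unfolding V by (simp add: right_diff_distrib sum_distrib_left power_add mult_ac)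
    finally have eq: "vY * vX * X ^ i * Z ^ (q - 1) * VZ ^ c = \<dots>" .
    have "\<phi> (?e * Z ^ (q ^ m)) = 0" by (intro phi_J J_mult J_Var) auto
    moreover have "\<phi> (X ^ (q - 1 + (q ^ m - 1)) * (vY * X ^ i * Z ^ (q - 1) * VZ ^ ?c * Z)) = 0"
      using q_ge2 by (intro phi_J J_mult_right J_Var) auto
    moreover have "\<phi> (vY * vX * X ^ (i + (q ^ m - q ^ Suc j)) * Z ^ (q - 1) * VZ ^ (?c + q ^ j)) = 0" if "j < ?n" for j
    proof (rule less)
      have "q ^ j < q ^ ?n" using that q_ge2 by (intro power_strict_increasing) auto
      then show "?c + q ^ j < c" using True by linarith
    qed
    ultimately show ?thesis unfolding eq phi_diff phi_sum by simp
  next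
    case False
    show ?thesis
    proof (cases "(q - 1) dvd i")
      case ndvd: False
      then have "\<not> (q - 1) dvd (q - 1) + i" by simp
      then show ?thesis by (rule torus_X[rotated]) (simp add: torus_simps mult_ac)
    next
      case dvd: True
      then obtain i' where i: "i = (q - 1) * i'" by blast
      show ?thesis
      proof (cases "(q - 1) dvd c")
        case ndvd: False
        then have "\<not> (q - 1) dvd (q - 1) + c" by simp
        then show ?thesis by (rule torus_Z[rotated]) (simp add: torus_simps mult_ac)
      next
        case dvd: True
        then obtain l where l: "c = (q - 1) * l" by blast
        then have "l \<le> qint q ?n" using False multiple_less_power_iff[OF q_ge2] by (simp add: not_le)
        show ?thesis
        proof (cases "i' < qint q m")
          case True
          then show ?thesis using test_1[OF True \<open>l \<le> _\<close>] by (simp add: i l power_mult)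
        next
          case False
          then have "(q - 1) * Suc (qint q m) \<le> (q - 1) * Suc i'" by (intro mult_le_mono2) simp
          with N_le have "q ^ m \<le> (q - 1) * Suc i'" by (rule order.trans)
          then have "q ^ m \<le> (q - 1) + i" by (simp add: i)
          then have "X ^ ((q - 1) + i) * (vY * Z ^ (q - 1) * VZ ^ c) \<in> truncation_ideal (q ^ m)"
            by (intro J_mult_right J_Var) auto
          moreover have "vY * vX * X ^ i * Z ^ (q - 1) * VZ ^ c = X ^ ((q - 1) + i) * (vY * Z ^ (q - 1) * VZ ^ c)"
            by (simp only: power_add mult_ac)
          ultimately show ?thesis by (simp only: phi_J)
        qed
      qed
    qed
  qed
qed

lemma WY_sum: "WY = (\<Sum>k<q. vY ^ (q - k) * vX ^ k)"
  using D1_sum[of X Y] by (simp add: D1_def flip: lessThan_Suc_atMost)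

text \<open>
  Use $Y^q = V_2(X,Y) + X^{q-1}Y$ repeatedly. Each term with a factor $V_2(X,Y)$ ends with too low
  a power of $Y$, so only the second summand survives.
\<close>

lemma phi_lower_Y:
  assumes "n + r \<le> q - 1" "T_fixed g"
  shows "\<phi> (vX * g * Y ^ (q * n + r)) = \<phi> (vX * (g * vX ^ n) * Y ^ (n + r))"
  using assms
proof (induction n arbitrary: r g)
  case (Suc n)
  have "Y ^ (q * Suc n + r) = Y ^ (q * n + r) * Y ^ q"
    by (simp add: algebra_simps flip: power_add)
  also have "\<dots> = VY * Y ^ (q * n + r) + vX * Y ^ (q * n + Suc r)"
    unfolding VY_rule by (simp add: algebra_simps)
  finally have eq: "vX * g * Y ^ (q * Suc n + r)
    = vX * (g * VY) * Y ^ (q * n + r) + vX * (g * vX) * Y ^ (q * n + Suc r)"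
    by (simp add: algebra_simps)
  have "\<phi> (vX * (g * VY) * Y ^ (q * n + r)) = \<phi> (vX * (g * VY * vX ^ n) * Y ^ (n + r))"
    using Suc.prems by (intro Suc.IH) auto
  also have "\<dots> = 0" using Suc.prems by (intro low_Y_vanish) auto
  finally have 1: "\<phi> (vX * (g * VY) * Y ^ (q * n + r)) = 0" .
  have "\<phi> (vX * (g * vX) * Y ^ (q * n + Suc r)) = \<phi> (vX * (g * vX * vX ^ n) * Y ^ (n + Suc r))"
    using Suc.prems by (intro Suc.IH) auto
  with 1 show ?case unfolding eq phi_add by (simp add: mult_ac)
qed simp

lemma phi_vY_power:
  assumes "n \<le> q - 1" "T_fixed g"
  shows "\<phi> (vY * vX * (vY ^ n * g)) = \<phi> (vY * vX * (vX ^ n * g))"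
proof -
  have "(q - 1) * Suc n = q * n + (q - 1 - n)"
    using assms(1) q_ge2 by (simp add: diff_mult_distrib)
  moreover have "vY * vY ^ n = Y ^ ((q - 1) * Suc n)" by (simp only: power_mult power_Suc)
  ultimately have "vY * vY ^ n = Y ^ (q * n + (q - 1 - n))" by (simp only:)
  then have "vY * vX * (vY ^ n * g) = vX * g * Y ^ (q * n + (q - 1 - n))"
    by (simp add: mult_ac)
  also have "\<phi> \<dots> = \<phi> (vX * (g * vX ^ n) * Y ^ (n + (q - 1 - n)))"
    using assms by (intro phi_lower_Y) auto
  also have "n + (q - 1 - n) = q - 1" using assms(1) by simp
  finally show ?thesis by (simp only: mult_ac)
qed

lemma of_nat_q: "(of_nat q :: 'a) = 0"
proof -
  obtain k where k: "CARD('a) = CHAR('a) ^ k" using card_power_CHAR by blast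
  with q_ge2 have "k \<noteq> 0" by (cases k) (auto simp: q_def)
  then show ?thesis unfolding q_def k by simp
qed

text \<open>
  Write $W = \sum_{k<q} Y^{(q-1)(q-k)}X^{(q-1)k}$. By \<open>phi_vY_power\<close>, and for $k = 0$
  by the interchange of $X$ and $Y$, all $q$ terms have the same value, so they add up to $0$.
\<close>

lemma low_power_vanish:
  assumes i: "i < q" and g: "T_fixed g" "psubst swap_subst g = g"
  shows "\<phi> (vY * vX * WY * vX ^ i * g) = 0"
proof -
  let ?c = "\<phi> (vY * vX * (vX ^ (q + i) * g))"
  have "vY * vX * WY * vX ^ i * g = (\<Sum>k<q. vY * vX * (vY ^ (q - k) * (vX ^ (k + i) * g)))"
    unfolding WY_sum by (simp add: sum_distrib_left sum_distrib_right power_add mult_ac)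
  moreover have "\<phi> (vY * vX * (vY ^ (q - k) * (vX ^ (k + i) * g))) = ?c" if "k < q" for k
  proof (cases "k = 0")
    case False
    then have "\<phi> (vY * vX * (vY ^ (q - k) * (vX ^ (k + i) * g))) = \<phi> (vY * vX * (vX ^ (q - k) * (vX ^ (k + i) * g)))"
      using g by (intro phi_vY_power) auto
    also have "vX ^ (q - k) * (vX ^ (k + i) * g) = vX ^ (q + i) * g"
      using that by (simp add: mult.assoc[symmetric] power_add[symmetric])
    finally show ?thesis .
  next
    case True
    have "\<phi> (vY * vX * (vY ^ q * (vX ^ i * g))) = \<phi> (psubst swap_subst (vY * vX * (vY ^ q * (vX ^ i * g))))"
      by (simp add: phi_swap)
    also have "psubst swap_subst (vY * vX * (vY ^ q * (vX ^ i * g))) = vY * vX * (vY ^ i * (vX ^ q * g))"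
      using g(2) by (simp add: psubst_simps swap_subst_def mult_ac)
    also have "\<phi> \<dots> = \<phi> (vY * vX * (vX ^ i * (vX ^ q * g)))"
      using i g by (intro phi_vY_power) auto
    finally show ?thesis using True by (simp add: power_add mult_ac)
  qed
  ultimately have "\<phi> (vY * vX * WY * vX ^ i * g) = (\<Sum>k<q. ?c)"
    by (simp add: phi_sum)
  also have "\<dots> = 0" by (simp add: of_nat_q)
  finally show ?thesis .
qed

text \<open>
  Like \<open>rank1_vanish\<close>, now with \<open>power_qn_V3\<close> to remove high powers of
  $V_3$ and \<open>reduce_to_Delta2\<close> to bring the exponents of the Dickson invariants into
  $\Delta^m_2$. Both are available because the product contains the factor $L$.
\<close>

lemma test_2_extended: "\<phi> (vY * vX * WY * vX ^ q * Z ^ (q\<^sup>2 - 1) * (E1 ^ a * E0 ^ b) * VV ^ c) = 0"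
proof -
  \<comment> \<open>$X^{q-1}W = (X V_2(X,Y))^{q-1} = L^{q-1}$, so one factor $L$ can be split off.\<close>
  define G where "G = vY * X ^ (q - 2) * VY ^ (q - 2) * vX ^ q * Z ^ (q\<^sup>2 - 1)"
  have G: "L * G = vY * vX * WY * vX ^ q * Z ^ (q\<^sup>2 - 1)"
  proof -
    have "q - 1 = Suc (q - 2)" using q_ge2 by simp
    then show ?thesis unfolding G_def L2_eq_V2 by (simp add: mult_ac)
  qed
  have "\<phi> (L * (G * VV ^ c) * (E1 ^ a * E0 ^ b)) = 0" for a b
  proof (induction c arbitrary: a b rule: less_induct)
    case (less c)
    let ?n = "m - 2"
    have m: "m = Suc (Suc ?n)" using m3 by simp
    show ?case
    proof (cases "c < q ^ ?n")
      case True
      show ?thesis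
      proof (rule reduce_to_Delta2[where P = "\<lambda>f. \<phi> f = 0" and m = m])
        fix a b assume D: "(a, b) \<in> Delta2 q m"
        have eq: "L * (G * VV ^ c) * (E1 ^ a * E0 ^ b) = L * G * (E1 ^ a * E0 ^ b) * VV ^ c" by (simp add: mult_ac)
        show "\<phi> (L * (G * VV ^ c) * (E1 ^ a * E0 ^ b)) = 0"
        proof (cases "(q - 1) dvd c")
          case True
          then obtain l where l: "c = (q - 1) * l" by blast
          then have "l \<le> qint q ?n" using \<open>c < q ^ ?n\<close> multiple_less_power_iff[OF q_ge2] by simp
          then show ?thesis unfolding eq G unfolding l by (rule test_2[OF D])
        next
          case False
          have "q\<^sup>2 - 1 = (q - 1) * (q + 1)" using q_ge2 by (simp add: power2_eq_square algebra_simps)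
          then have "\<not> (q - 1) dvd (q\<^sup>2 - 1) + c" using False by (simp add: dvd_add_right_iff)
          then show ?thesis unfolding eq G by (rule torus_Z[rotated]) (simp add: torus_simps mult_ac)
        qed
      qed (use m3 in \<open>auto simp: phi_add phi_Const phi_J\<close>)
    next
      case False
      let ?c = "c - q ^ ?n"
      have span: "\<phi> (L * (G * VV ^ k) * h) = 0" if "k < c" "h \<in> dickson_span K" for k h K
        using that(2)
      proof (induction h rule: dickson_span.induct)
        case (step h a' c' b')
        have "L * (G * VV ^ k) * (Const c' * E1 ^ a' * E0 ^ b' + h)
           = Const c' * (L * (G * VV ^ k) * (E1 ^ a' * E0 ^ b')) + L * (G * VV ^ k) * h"
          by (simp add: algebra_simps)
        then show ?case using step less[OF that(1)] by (simp add: phi_add phi_Const)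
      qed simp
      have "Z ^ (q ^ m) = (\<Sum>j<?n. alpha (Suc ?n - j) X Y ^ (q ^ Suc j) * VV ^ (q ^ j)) + VV ^ (q ^ ?n) + alpha m X Y * Z ^ q + beta m X Y * Z"
        using power_qn_V3[of X Y Z "Suc ?n"] L2_neq_0[of 0 1] m by (simp add: alpha_1)
      then have V: "VV ^ (q ^ ?n) = Z ^ (q ^ m) - alpha m X Y * Z ^ q - beta m X Y * Z
          - (\<Sum>j<?n. alpha (Suc ?n - j) X Y ^ (q ^ Suc j) * VV ^ (q ^ j))"
        by simp
      let ?e = "G * VV ^ ?c * (E1 ^ a * E0 ^ b)"
      have "L * (G * VV ^ c) * (E1 ^ a * E0 ^ b) = L * ?e * VV ^ (q ^ ?n)"
        using False by (simp add: mult_ac flip: power_add)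
      also have "\<dots> = L * ?e * Z ^ (q ^ m) - ?e * Z ^ q * (L * alpha m X Y) - ?e * Z * (L * beta m X Y)
          - (\<Sum>j<?n. L * (G * VV ^ (?c + q ^ j)) * (Const 1 * E1 ^ a * E0 ^ b * alpha (Suc ?n - j) X Y ^ (q ^ Suc j)))"
        unfolding V by (simp add: right_diff_distrib sum_distrib_left power_add mult_ac)
      finally have eq: "L * (G * VV ^ c) * (E1 ^ a * E0 ^ b) = \<dots>" .
      have "\<phi> (L * ?e * Z ^ (q ^ m)) = 0" by (intro phi_J J_mult J_Var) auto
      moreover have "\<phi> (?e * Z ^ q * (L * alpha m X Y)) = 0" by (intro phi_J J_mult L_alpha_in_J)
      moreover have "\<phi> (?e * Z * (L * beta m X Y)) = 0" using m3 by (intro phi_J J_mult L_beta_in_J) auto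
      moreover have "\<phi> (L * (G * VV ^ (?c + q ^ j)) * (Const 1 * E1 ^ a * E0 ^ b * alpha (Suc ?n - j) X Y ^ (q ^ Suc j))) = 0"
        if "j < ?n" for j
      proof (rule span)
        have "q ^ j < q ^ ?n" using that q_ge2 by (intro power_strict_increasing) auto
        then show "?c + q ^ j < c" using False by linarith
        let ?K = "Suc (q ^ Suc j * qint q (Suc ?n - j))"
        show "Const 1 * E1 ^ a * E0 ^ b * alpha (Suc ?n - j) X Y ^ (q ^ Suc j) \<in> dickson_span (?K + a)"
          by (rule dickson_span_mult_monomial[where K = ?K, OF dickson_span_frob[OF alpha_in_dickson_span]])
            (simp_all only: less_Suc_eq_le mult_le_mono2 add.commute order.refl)
      qed
      ultimately show ?thesis unfolding eq phi_diff phi_sum by simp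
    qed
  qed
  moreover have "vY * vX * WY * vX ^ q * Z ^ (q\<^sup>2 - 1) * (E1 ^ a * E0 ^ b) * VV ^ c
      = L * (G * VV ^ c) * (E1 ^ a * E0 ^ b)"
    unfolding G[symmetric] by (simp only: mult_ac)
  ultimately show ?thesis by (simp only:)
qed

lemma swap_fixed: "psubst swap_subst (Z ^ n * (E1 ^ a * E0 ^ b) * VV ^ c) = Z ^ n * (E1 ^ a * E0 ^ b) * VV ^ c"
  using D1_swap[of Y X] D0_swap[of Y X] V3_swap[of Y X Z] by (simp add: psubst_simps swap_subst_def)

text \<open>
  $W = Q_{2,1} - X^{(q-1)q}$ removes the powers of $W$, and $X^{(q-1)(q+1)} = Q_{2,1}X^{q-1} -
  Q_{2,0}$ lowers the power of $X^{q-1}$ to at most $q$. The value $q$ is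
  \<open>test_2_extended\<close>, smaller ones vanish by \<open>low_power_vanish\<close>.
\<close>

lemma rank2_aux: "\<phi> (vY * vX * WY * vX ^ i * WY ^ j * (Z ^ (q\<^sup>2 - 1) * (E1 ^ a * E0 ^ b) * VV ^ c)) = 0"
proof (induction j arbitrary: i a b)
  case 0
  show ?case
  proof (induction i arbitrary: a b rule: less_induct)
    case (less i)
    consider "i < q" | "i = q" | "q < i" by linarith
    then show ?case
    proof cases
      case 1
      then show ?thesis using low_power_vanish[OF 1 _ swap_fixed, of "q\<^sup>2 - 1" a b c] by simp
    next
      case 2
      then show ?thesis using test_2_extended[of a b c] by (simp add: mult.assoc)
    next
      case 3
      then have "i - Suc q < i" "i - q < i" using q_ge2 by auto
      note IH = less[OF this(1), of a "Suc b"] less[OF this(2), of "Suc a" b]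
      have "i = Suc q + (i - Suc q)" "i - q = Suc (i - Suc q)" using 3 by auto
      then have i: "vX ^ i = vX ^ q * vX * vX ^ (i - Suc q)" "vX ^ (i - q) = vX * vX ^ (i - Suc q)"
        by (metis power_Suc power_add power_Suc2)+
      have E: "vX ^ q * vX = vX * E1 - E0" by (simp add: D1_def D0_def algebra_simps)
      have "vY * vX * WY * vX ^ i * WY ^ 0 * (Z ^ (q\<^sup>2 - 1) * (E1 ^ a * E0 ^ b) * VV ^ c)
        = vY * vX * WY * vX ^ (i - q) * WY ^ 0 * (Z ^ (q\<^sup>2 - 1) * (E1 ^ Suc a * E0 ^ b) * VV ^ c)
        - vY * vX * WY * vX ^ (i - Suc q) * WY ^ 0 * (Z ^ (q\<^sup>2 - 1) * (E1 ^ a * E0 ^ Suc b) * VV ^ c)"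
        unfolding i E by (simp add: algebra_simps)
      then show ?thesis using IH by (simp add: phi_diff)
    qed
  qed
next
  case (Suc j)
  have "WY ^ Suc j = WY ^ j * E1 - vX ^ q * WY ^ j" by (simp add: D1_def algebra_simps)
  then have eq: "vY * vX * WY * vX ^ i * WY ^ Suc j * (Z ^ (q\<^sup>2 - 1) * (E1 ^ a * E0 ^ b) * VV ^ c)
     = vY * vX * WY * vX ^ i * WY ^ j * (Z ^ (q\<^sup>2 - 1) * (E1 ^ Suc a * E0 ^ b) * VV ^ c)
     - vY * vX * WY * vX ^ (i + q) * WY ^ j * (Z ^ (q\<^sup>2 - 1) * (E1 ^ a * E0 ^ b) * VV ^ c)"
    by (simp only: power_add) (simp add: algebra_simps)
  show ?case unfolding eq phi_diff Suc by simp
qed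

text \<open>
  $V_2(X,Z)^q = V_3 + W V_2(X,Z)$ lowers the power of $V_2(X,Z)$ to at most $q - 1$, where
  \<open>low_VZ_vanish\<close> and \<open>replace_top_Z_power\<close> apply.
\<close>

lemma rank2_vanish: "\<phi> (vX * WY * (vY * X ^ i * WY ^ j * VV ^ c3) * Z ^ (q - 1) * VZ ^ c) = 0"
proof (induction c arbitrary: j c3 rule: less_induct)
  case (less c)
  consider "c < q - 1" | "c = q - 1" | "q \<le> c" by linarith
  then show ?case
  proof cases
    case 1 then show ?thesis by (intro low_VZ_vanish) auto
  next
    case 2
    let ?e = "vY * X ^ i * WY ^ j * VV ^ c3"
    have "\<phi> (vX * WY * ?e * Z ^ (q - 1) * VZ ^ c) = \<phi> (vX * WY * ?e * Z ^ (q\<^sup>2 - 1))"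
      unfolding 2 by (rule replace_top_Z_power[symmetric]) auto
    also have "\<dots> = 0"
    proof (cases "(q - 1) dvd i")
      case True
      then obtain i' where i: "i = (q - 1) * i'" by blast
      show ?thesis using rank2_aux[of i' j 0 0 c3] unfolding i power_mult by (simp add: mult_ac)
    next
      case False
      then have "\<not> (q - 1) dvd (q - 1) + i" by simp
      then show ?thesis by (rule torus_X[rotated]) (simp add: torus_simps mult_ac)
    qed
    finally show ?thesis .
  next
    case 3
    have "VZ ^ c = VZ ^ (c - q) * VZ ^ q" using 3 by (simp flip: power_add)
    also have "\<dots> = VV * VZ ^ (c - q) + WY * VZ ^ Suc (c - q)" unfolding VV_rule by (simp add: algebra_simps)
    finally have eq: "vX * WY * (vY * X ^ i * WY ^ j * VV ^ c3) * Z ^ (q - 1) * VZ ^ c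
      = vX * WY * (vY * X ^ i * WY ^ j * VV ^ Suc c3) * Z ^ (q - 1) * VZ ^ (c - q)
      + vX * WY * (vY * X ^ i * WY ^ Suc j * VV ^ c3) * Z ^ (q - 1) * VZ ^ Suc (c - q)"
      by (simp add: algebra_simps)
    have "c - q < c" "Suc (c - q) < c" using 3 q_ge2 by auto
    then show ?thesis unfolding eq phi_add by (simp only: less) simp
  qed
qed

text \<open>
  $Y^q = V_2(X,Y) + X^{q-1}Y$ lowers the power of $Y$ to at most $q - 1$, and lower powers vanish.
  What remains has rank 1 or 2 according to whether $V_2(X,Y)$ occurs.
\<close>

lemma multiple_vX_vanish_aux: "\<phi> (vX * (X ^ i * VY ^ j * Z ^ (q - 1) * VZ ^ c) * Y ^ n) = 0"
proof (induction n arbitrary: i j rule: less_induct)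
  case (less n)
  consider "n < q - 1" | "n = q - 1" | "q \<le> n" by linarith
  then show ?case
  proof cases
    case 1 then show ?thesis by (intro low_Y_vanish) auto
  next
    case 2
    show ?thesis
    proof (cases "(q - 1) dvd j")
      case True
      then obtain j' where j: "j = (q - 1) * j'" by blast
      show ?thesis
      proof (cases j')
        case 0
        then show ?thesis using rank1_vanish[of i c] by (simp add: j 2 mult_ac)
      next
        case (Suc k)
        then have "VY ^ j = WY * WY ^ k" by (simp only: j power_mult power_Suc)
        then show ?thesis using rank2_vanish[of i k 0 c] by (simp add: 2 mult_ac)
      qed
    next
      case False
      then have "\<not> (q - 1) dvd (q - 1) + j" by simp
      then show ?thesis unfolding 2 by (rule torus_Y[rotated]) (simp add: torus_simps mult_ac)
    qed
  next
    case 3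
    have "Y ^ n = Y ^ (n - q) * Y ^ q" using 3 by (simp flip: power_add)
    also have "\<dots> = VY * Y ^ (n - q) + vX * Y ^ Suc (n - q)" unfolding VY_rule by (simp add: algebra_simps)
    finally have eq: "vX * (X ^ i * VY ^ j * Z ^ (q - 1) * VZ ^ c) * Y ^ n
      = vX * (X ^ i * VY ^ Suc j * Z ^ (q - 1) * VZ ^ c) * Y ^ (n - q)
      + vX * (X ^ (i + (q - 1)) * VY ^ j * Z ^ (q - 1) * VZ ^ c) * Y ^ Suc (n - q)"
      by (simp only: power_add) (simp add: algebra_simps)
    have "n - q < n" "Suc (n - q) < n" using 3 q_ge2 by auto
    then show ?thesis unfolding eq phi_add by (simp only: less) simp
  qed
qed

lemma multiple_vX_vanish: "\<phi> (vX * (X ^ i * Y ^ n * VZ ^ c) * Z ^ k) = 0"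
proof (induction k arbitrary: i c rule: less_induct)
  case (less k)
  consider "k < q - 1" | "k = q - 1" | "q \<le> k" by linarith
  then show ?case
  proof cases
    case 1 then show ?thesis by (intro low_Z_vanish) auto
  next
    case 2
    show ?thesis using multiple_vX_vanish_aux[of i 0 c n] by (simp add: 2 mult_ac)
  next
    case 3
    have "Z ^ k = Z ^ (k - q) * Z ^ q" using 3 by (simp flip: power_add)
    also have "\<dots> = VZ * Z ^ (k - q) + vX * Z ^ Suc (k - q)" unfolding VZ_rule by (simp add: algebra_simps)
    finally have eq: "vX * (X ^ i * Y ^ n * VZ ^ c) * Z ^ k
      = vX * (X ^ i * Y ^ n * VZ ^ Suc c) * Z ^ (k - q)
      + vX * (X ^ (i + (q - 1)) * Y ^ n * VZ ^ c) * Z ^ Suc (k - q)"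
      by (simp only: power_add) (simp add: algebra_simps)
    have "k - q < k" "Suc (k - q) < k" using 3 q_ge2 by auto
    then show ?thesis unfolding eq phi_add by (simp only: less) simp
  qed
qed

lemma multiple_X_vanish: "i > 0 \<Longrightarrow> \<phi> (X ^ i * Y ^ j * Z ^ k) = 0"
proof (cases "(q - 1) dvd i")
  case True
  assume "i > 0"
  with True have "q - 1 \<le> i" by (simp add: dvd_imp_le)
  then have "X ^ i = vX * X ^ (i - (q - 1))" by (simp flip: power_add)
  then show ?thesis using multiple_vX_vanish[of "i - (q - 1)" j 0 k] by (simp add: mult_ac)
next
  case False
  then show ?thesis by (rule torus_X[rotated]) (simp add: torus_simps mult_ac)
qed

lemma monomial_vanish: "\<phi> (X ^ i * Y ^ j * Z ^ k) = 0"
proof (cases "i > 0")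
  case True then show ?thesis by (rule multiple_X_vanish)
next
  case i: False
  show ?thesis
  proof (cases "j > 0")
    case True
    have "psubst swap_subst (X ^ i * Y ^ j * Z ^ k) = X ^ j * Y ^ i * Z ^ k"
      by (simp add: psubst_simps swap_subst_def mult_ac)
    then show ?thesis using multiple_X_vanish[OF True, of i k] phi_swap[of "X ^ i * Y ^ j * Z ^ k"] by simp
  next
    case j: False
    show ?thesis
    proof (cases "(q - 1) dvd k")
      case True
      then obtain l where k: "k = (q - 1) * l" by blast
      show ?thesis
      proof (cases "l \<le> qint q m")
        case True then show ?thesis using test_0[OF True] i j k by simp
      next
        case False
        then have "q ^ m \<le> k" using multiple_less_power_iff[OF q_ge2, of l m] by (simp add: k)
        then have "Z ^ k \<in> truncation_ideal (q ^ m)" by (intro J_Var) auto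
        then show ?thesis using i j phi_J by simp
      qed
    next
      case False
      then show ?thesis by (rule torus_Z[rotated]) (simp add: torus_simps mult_ac)
    qed
  qed
qed

text \<open>
  The coinvariants are spanned by the test polynomials: a functional that vanishes on these
  vanishes on all monomials.
\<close>

lemma phi_vanishes:
  assumes "f \<in> carrier (S_ring 3)"
  shows "\<phi> f = 0"
proof (induction f rule: mpoly_induct)
  case (single t c)
  then have "Poly_Mapping.keys t \<subseteq> {..<3}" using assms by (auto simp: in_S_ring)
  then have "Poly_Mapping.single t (1::'a) = (\<Prod>i<3. Var i ^ Poly_Mapping.lookup t i)"
    unfolding monomial_Var[of t, symmetric]
    by (intro prod.mono_neutral_left) (auto simp: in_keys_iff)
  also have "{..<3::nat} = {0, 1, 2}" by auto
  finally have "Poly_Mapping.single t c = Const c * (X ^ Poly_Mapping.lookup t 0 * Y ^ Poly_Mapping.lookup t 1 * Z ^ Poly_Mapping.lookup t 2)"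
    using mult_single[of 0 c t 1] by (simp add: Const_def mult.assoc)
  then show ?case by (simp add: phi_Const monomial_vanish)
qed (simp_all add: phi_add)

end

section \<open>Explicit Dickson invariants and delta operators\<close>

lemma det_2x2:
  fixes M :: "nat \<times> nat \<Rightarrow> 'b::comm_ring_1"
  shows "Determinant.det (mat 2 2 M) = M (0,0) * M (1,1) - M (0,1) * M (1,0)"
proof -
  have "Determinant.det (mat 2 2 M) = (\<Sum>j<2. mat 2 2 M $$ (0,j) * cofactor (mat 2 2 M) 0 j)"
    by (rule laplace_expansion_row) auto
  also have "{..<2} = {0, 1::nat}" by auto
  finally have "Determinant.det (mat 2 2 M) = (\<Sum>j\<in>{0, 1}. mat 2 2 M $$ (0,j) * cofactor (mat 2 2 M) 0 j)" .
  moreover have "cofactor (mat 2 2 M) 0 0 = M (1,1)" "cofactor (mat 2 2 M) 0 1 = - M (1,0)"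
    unfolding cofactor_def by (subst det_single; simp add: mat_delete_def One_nat_def)+
  ultimately show ?thesis by (simp add: algebra_simps)
qed

lemma det_3x3:
  fixes M :: "nat \<times> nat \<Rightarrow> 'b::comm_ring_1"
  shows "Determinant.det (mat 3 3 M) = M (2,0) * (M (0,1) * M (1,2) - M (0,2) * M (1,1))
    - M (2,1) * (M (0,0) * M (1,2) - M (0,2) * M (1,0)) + M (2,2) * (M (0,0) * M (1,1) - M (0,1) * M (1,0))"
proof -
  have del: "mat_delete (mat 3 3 M) 2 j = mat 2 2 (\<lambda>(r, c). M (r, if c < j then c else Suc c))" for j
    by (rule eq_matI) (auto simp: mat_delete_def)
  have "Determinant.det (mat 3 3 M) = (\<Sum>j<3. mat 3 3 M $$ (2,j) * cofactor (mat 3 3 M) 2 j)"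
    by (rule laplace_expansion_row) auto
  then show ?thesis
    unfolding cofactor_def del det_2x2 sum_3 by (simp add: One_nat_def numeral_2_eq_2 algebra_simps)
qed

lemma infinite_mpoly: "infinite (UNIV :: 'a::comm_semiring_1 mpoly set)"
proof -
  have "inj (Var :: nat \<Rightarrow> 'a mpoly)"
    by (rule injI) (metis lookup_Var_1 zero_neq_one)
  then show ?thesis using finite_imageD infinite_UNIV_nat by (metis finite_subset subset_UNIV)
qed

text \<open>
  There are infinitely many polynomials, so univariate polynomials over them are determined by
  their values. The Dickson invariants are coefficients of such a polynomial and can thus be read
  off from \<open>dickson_prod\<close>, its evaluated form.
\<close>

lemma poly_eqI_mpoly:
  fixes p r :: "'a::field mpoly poly"
  assumes "\<And>t. poly p t = poly r t" shows "p = r"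
proof (rule ccontr)
  assume "p \<noteq> r"
  then have "finite {t. poly (p - r) t = 0}" by (intro poly_roots_finite) simp
  moreover have "{t. poly (p - r) t = 0} = UNIV" using assms by simp
  ultimately show False using infinite_mpoly by metis
qed

lemma drop_var_to_fract: "drop_var j (to_fract f) = to_fract (psubst (\<lambda>k. Var (skip j k)) f)"
  using drop_var_Fract[of j f 1] by (simp add: to_fract_def)

context finite_field_polynomials
begin

text \<open>
  As polynomials in $A$ both sides are monic of degree $q$ and have the $q$ roots $\lambda B$.
\<close>

lemma prod_scalar_translates: "(\<Prod>b\<in>(UNIV :: 'a set). A + Const b * B) = A ^ q - B ^ (q - 1) * A"
proof (cases "B = 0")
  case True
  then show ?thesis using q_ge2 by (simp add: q_def power_0_left)
next
  case False
  define P where "P = (\<Prod>b\<in>(UNIV :: 'a set). [:Const b * B, 1:])"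
  define R where "R = monom 1 q - monom (B ^ (q - 1)) 1"
  have "degree P = q" unfolding P_def by (simp add: degree_prod_eq_sum_degree q_def)
  moreover have "lead_coeff P = 1" unfolding P_def lead_coeff_prod by simp
  ultimately have degP: "degree P = q" "coeff P q = 1" by auto
  have degR: "degree R = q" "coeff R q = 1"
  proof -
    have "degree (- monom (B ^ (q - 1)) 1) < degree (monom (1 :: 'a mpoly) q)"
      using q_ge2 degree_monom_le[of "B ^ (q - 1)" 1] by (simp add: degree_monom_eq)
    then have "degree (monom 1 q + - monom (B ^ (q - 1)) 1) = degree (monom (1 :: 'a mpoly) q)"
      by (rule degree_add_eq_left)
    then have "degree R = degree (monom (1 :: 'a mpoly) q)" by (simp add: R_def)
    then show "degree R = q" by (simp add: degree_monom_eq)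
    show "coeff R q = 1" using q_ge2 by (simp add: R_def)
  qed
  have "P = R"
  proof (rule ccontr)
    assume ne: "P \<noteq> R"
    have deg: "degree (P - R) < q"
    proof -
      have "degree (P - R) \<le> q" using degP degR by (intro degree_diff_le) auto
      moreover have "coeff (P - R) q = 0" using degP degR by simp
      ultimately show ?thesis using ne by (metis leading_coeff_0_iff le_neq_implies_less right_minus_eq)
    qed
    have roots: "(\<lambda>b. Const b * B) ` UNIV \<subseteq> {t. poly (P - R) t = 0}"
    proof clarify
      fix b :: 'a
      have "poly P (Const b * B) = 0"
        unfolding P_def poly_prod
        by (rule prod_zero[OF _ bexI[of _ "- b"]]) (auto simp: Const_uminus)
      moreover have "poly R (Const b * B) = 0"
        by (simp add: R_def poly_monom power_mult_distrib power_q[of B])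
      ultimately show "poly (P - R) (Const b * B) = 0" by simp
    qed
    have card: "card ((\<lambda>b. Const b * B) ` (UNIV :: 'a set)) = q"
    proof -
      have "inj (\<lambda>b. Const b * B)"
        using False by (auto simp: inj_def Const_def dest!: injD[OF inj_single])
      then show ?thesis by (simp add: card_image q_def)
    qed
    have ne': "P - R \<noteq> 0" using ne by simp
    have "q \<le> degree (P - R)"
      using order.trans[OF card_mono[OF poly_roots_finite[OF ne'] roots] card_poly_roots_bound[OF ne']] by (simp only: card)
    then have "q < q" using deg by (rule le_less_trans)
    then show False by simp
  qed
  then have "poly P A = poly R A" by simp
  moreover have "poly P A = (\<Prod>b\<in>(UNIV :: 'a set). A + Const b * B)"
    by (simp add: P_def poly_prod add.commute)
  ultimately show ?thesis by (simp add: R_def poly_monom)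
qed

definition dickson_prod :: "nat \<Rightarrow> 'a mpoly \<Rightarrow> 'a mpoly" where
  "dickson_prod s t = (\<Prod>l\<in>carrier_vec s. t + (\<Sum>j<s. Const (l $ j) * Var j))"

lemma dickson_prod_0: "dickson_prod 0 t = t"
proof -
  have "carrier_vec 0 = {0\<^sub>v 0 :: 'a vec}" by auto
  then show ?thesis by (simp add: dickson_prod_def)
qed

lemma dickson_prod_Suc_aux:
  "dickson_prod (Suc s) t = (\<Prod>b\<in>UNIV. dickson_prod s (t + Const b * Var s))"
proof -
  let ?v = "\<lambda>(b, l :: 'a vec). vec (Suc s) (\<lambda>i. if i < s then l $ i else b)"
  have bij: "bij_betw ?v (UNIV \<times> carrier_vec s) (carrier_vec (Suc s))"
  proof (rule bij_betw_byWitness[where f' = "\<lambda>l. (l $ s, vec s (\<lambda>i. l $ i))"])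
    show "\<forall>l\<in>carrier_vec (Suc s). ?v (l $ s, vec s (\<lambda>i. l $ i)) = l"
      by (auto intro!: eq_vecI simp: less_Suc_eq)
  qed (auto intro!: eq_vecI)
  have "(\<Prod>b\<in>UNIV. dickson_prod s (t + Const b * Var s))
     = (\<Prod>(b, l)\<in>UNIV \<times> carrier_vec s. t + Const b * Var s + (\<Sum>j<s. Const (l $ j) * Var j))"
    unfolding dickson_prod_def by (rule prod.cartesian_product)
  also have "\<dots> = (\<Prod>x\<in>UNIV \<times> carrier_vec s. t + (\<Sum>j<Suc s. Const (?v x $ j) * Var j))"
    by (rule prod.cong) (auto simp: algebra_simps)
  also have "\<dots> = dickson_prod (Suc s) t"
    unfolding dickson_prod_def by (rule prod.reindex_bij_betw[OF bij])
  finally show ?thesis ..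
qed

text \<open>
  Taking the product over the last coordinate at the end gives a product of $q$ translates,
  provided that the product over the others is linear in \<open>t\<close>.
\<close>

lemma dickson_prod_Suc:
  assumes "\<And>a b. dickson_prod s (a + b) = dickson_prod s a + dickson_prod s b"
    "\<And>c a. dickson_prod s (Const c * a) = Const c * dickson_prod s a"
  shows "dickson_prod (Suc s) t = dickson_prod s t ^ q - dickson_prod s (Var s) ^ (q - 1) * dickson_prod s t"
  unfolding dickson_prod_Suc_aux assms by (rule prod_scalar_translates)

lemma dickson_prod_1: "dickson_prod 1 t = V2 X t"
  using dickson_prod_Suc[of 0 t] by (simp add: dickson_prod_0 V2_def One_nat_def)

lemma dickson_prod_2: "dickson_prod 2 t = V3 X Y t"
  using dickson_prod_Suc[of 1 t] unfolding dickson_prod_1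
  by (simp add: V2_add V2_smult V3_eq_V2 numeral_2_eq_2 One_nat_def)

lemma dickson_prod_3: "dickson_prod 3 t = V3 X Y t ^ q - VV ^ (q - 1) * V3 X Y t"
  using dickson_prod_Suc[of 2 t] unfolding dickson_prod_2
  by (simp add: V3_add V3_smult)

lemma dickson_eq_coeff:
  assumes "\<And>t. dickson_prod s t = poly P t"
  shows "dickson s i = (- 1) ^ (s - i) * coeff P (q ^ i)"
proof -
  have "(\<Prod>l\<in>carrier_vec s. [:\<Sum>j<s. Const (l $ j) * Var j, 1:]) = P"
    by (rule poly_eqI_mpoly) (simp add: assms[symmetric] dickson_prod_def poly_prod add.commute)
  then show ?thesis by (simp add: dickson_def q_def)
qed

lemma q_powers_distinct: "q \<noteq> 1" "q\<^sup>2 \<noteq> q" "q\<^sup>2 \<noteq> 1" "q ^ 3 \<noteq> q\<^sup>2" "q ^ 3 \<noteq> q" "q \<noteq> q\<^sup>2" "1 \<noteq> q\<^sup>2"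
  "q ^ 3 \<noteq> 1" "1 \<noteq> q ^ 3" "q\<^sup>2 \<noteq> q ^ 3" "q \<noteq> q ^ 3"
  using q_ge2 by (auto simp: power2_eq_square power3_eq_cube)

lemma dickson_1_0: "dickson 1 0 = vX"
proof -
  have "dickson 1 0 = (- 1) ^ (1 - 0) * coeff (monom 1 q - monom vX 1) (q ^ 0)"
    by (rule dickson_eq_coeff) (simp add: dickson_prod_1 poly_monom V2_def)
  then show ?thesis using q_powers_distinct by simp
qed

lemma dickson_2: "dickson 2 1 = E1" "dickson 2 0 = E0"
proof -
  have *: "dickson 2 i = (- 1) ^ (2 - i) * coeff (monom 1 (q\<^sup>2) - monom E1 q + monom E0 1) (q ^ i)" for i
    by (rule dickson_eq_coeff) (simp add: dickson_prod_2 poly_monom V3_def)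
  show "dickson 2 1 = E1" "dickson 2 0 = E0"
    using *[of 1] *[of 0] q_powers_distinct by simp_all
qed

lemma dickson_3_2: "dickson 3 2 = VV ^ (q - 1) + E1 ^ q"
proof -
  let ?W = "VV ^ (q - 1)"
  have "dickson 3 2 = (- 1) ^ (3 - 2) * coeff (monom 1 (q ^ 3) - monom (?W + E1 ^ q) (q\<^sup>2) + monom (E0 ^ q + ?W * E1) q - monom (?W * E0) 1) (q ^ 2)"
  proof (rule dickson_eq_coeff)
    fix t
    have "V3 X Y t ^ q = (t ^ q\<^sup>2 - E1 * t ^ q + E0 * t) ^ q" by (simp add: V3_def)
    also have "\<dots> = t ^ (q ^ 3) - E1 ^ q * t ^ (q\<^sup>2) + E0 ^ q * t ^ q"
      by (simp add: frob_add1 frob_diff1 power_mult_distrib power2_eq_square power3_eq_cube mult.assoc flip: power_mult)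
    finally show "dickson_prod 3 t = poly (monom 1 (q ^ 3) - monom (?W + E1 ^ q) (q\<^sup>2) + monom (E0 ^ q + ?W * E1) q - monom (?W * E0) 1) t"
      unfolding dickson_prod_3 by (simp add: poly_monom V3_def[of X Y t] algebra_simps)
  qed
  then show ?thesis using q_powers_distinct by simp
qed

lemma delta_1: "delta 1 m (to_fract f) = to_fract (X ^ (q ^ m - 1) * psubst (\<lambda>k. Var (skip 0 k)) f)"
proof -
  have N: "q ^ m = Suc (q ^ m - 1)" using q_ge2 by simp
  have "X ^ (q ^ m) = X * X ^ (q ^ m - 1)" by (subst N) simp
  then show ?thesis
    unfolding delta_def using Var_neq_0[of 0]
    by (subst (1 2) det_single) (simp_all add: drop_var_to_fract q_def[symmetric])
qed

text \<open>
  The hypothesis is the numerator determinant divided by the denominator $L$: it characterises the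
  quotient without division.
\<close>

lemma delta_2:
  assumes "L * p = X * Y ^ (q ^ m) * psubst (\<lambda>k. Var (skip 1 k)) f - Y * X ^ (q ^ m) * psubst (\<lambda>k. Var (skip 0 k)) f"
  shows "delta 2 m (to_fract f) = to_fract p"
proof -
  have "to_fract L * to_fract p = to_fract (X * Y ^ (q ^ m) * psubst (\<lambda>k. Var (skip 1 k)) f - Y * X ^ (q ^ m) * psubst (\<lambda>k. Var (skip 0 k)) f)"
    unfolding assms[symmetric] by simp
  moreover have "to_fract L \<noteq> 0" using L2_neq_0[of 0 1] by simp
  ultimately show ?thesis
    unfolding delta_def det_2x2
    by (simp add: drop_var_to_fract q_def[symmetric] L2_def field_simps)
qed

text \<open>
  $F(Z)/V_3$ where $F(t) = t^N - \alpha_m t^q - \beta_m t$ is the additive polynomial with the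
  roots $X$, $Y$, the determinants in $\delta_3(1)$ being $L F(Z)$ and $L V_3$. Division of
  \<open>power_qn_V3\<close> by $V_3$ gives the quotient.
\<close>

definition delta3_poly :: "nat \<Rightarrow> 'a mpoly" where
  "delta3_poly m = (\<Sum>j<m - 1. alpha (m - 1 - j) X Y ^ (q ^ Suc j) * VV ^ (q ^ j - 1))"

lemma VV_delta3_poly:
  assumes "m \<ge> 1"
  shows "VV * delta3_poly m = Z ^ (q ^ m) - alpha m X Y * Z ^ q - beta m X Y * Z"
proof -
  obtain n where m: "m = Suc n" using assms by (cases m) auto
  have "VV * delta3_poly m = (\<Sum>j<n. alpha (n - j) X Y ^ (q ^ Suc j) * VV ^ (q ^ j))"
    unfolding delta3_poly_def sum_distrib_left
  proof (rule sum.cong)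
    fix j
    have "q ^ j = Suc (q ^ j - 1)" using q_ge2 by simp
    then have "VV ^ (q ^ j) = VV * VV ^ (q ^ j - 1)" by (metis power_Suc)
    then show "VV * (alpha (m - 1 - j) X Y ^ q ^ Suc j * VV ^ (q ^ j - 1)) = alpha (n - j) X Y ^ (q ^ Suc j) * VV ^ (q ^ j)"
      by (simp add: m)
  qed (simp add: m)
  then show ?thesis using power_qn_V3[of X Y Z n] L2_neq_0[of 0 1] by (simp add: m)
qed

lemma VV_neq_0: "VV \<noteq> 0"
proof
  assume *: "VV = 0"
  have "psubst (Var(0 := 0, 1 := 0)) VV = Z ^ (q\<^sup>2)"
    using q_ge2 by (simp add: psubst_simps V3_def D1_def D0_def V2_def power_0_left)
  then show False using * Var_neq_0[of 2] by simp
qed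

lemma delta_3_1:
  assumes "m \<ge> 1"
  shows "delta 3 m 1 = to_fract (delta3_poly m)"
proof -
  have drop: "drop_var j (1 :: 'a mpoly fract) = 1" for j
    using drop_var_to_fract[of j 1] by simp
  let ?N = "q ^ m"
  let ?n = "X ^ ?N * (Y * Z ^ q - Z * Y ^ q) - Y ^ ?N * (X * Z ^ q - Z * X ^ q) + Z ^ ?N * (X * Y ^ q - Y * X ^ q)"
  let ?d = "X ^ (q\<^sup>2) * (Y * Z ^ q - Z * Y ^ q) - Y ^ (q\<^sup>2) * (X * Z ^ q - Z * X ^ q) + Z ^ (q\<^sup>2) * (X * Y ^ q - Y * X ^ q)"
  have L: "L2 X Y \<noteq> 0" using L2_neq_0[of 0 1] by simp
  have pow: "X ^ (q ^ k) = alpha k X Y * X ^ q + beta k X Y * X" "Y ^ (q ^ k) = alpha k X Y * Y ^ q + beta k X Y * Y" if "k \<ge> 1" for k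
    using power_qn_linear_left[OF L that] power_qn_linear_right[OF L that] .
  have n: "?n = L * (Z ^ ?N - alpha m X Y * Z ^ q - beta m X Y * Z)"
    unfolding pow[OF assms] L2_def by (simp add: algebra_simps)
  have be2: "beta 2 X Y = - E0" by (simp add: beta_def alpha_1)
  have pow2: "X ^ (q\<^sup>2) = E1 * X ^ q - E0 * X" "Y ^ (q\<^sup>2) = E1 * Y ^ q - E0 * Y"
    using pow[of 2] by (simp_all add: be2 D1_eq_alpha)
  have d: "?d = L * VV"
    unfolding pow2 V3_def L2_def by (simp add: algebra_simps)
  have "to_fract ?n / to_fract ?d = to_fract (delta3_poly m)"
    unfolding n d VV_delta3_poly[OF assms, symmetric] using L VV_neq_0 by simp
  moreover have "delta 3 m 1 = to_fract ?n / to_fract ?d"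
    unfolding delta_def det_3x3 drop by (simp add: q_def[symmetric])
  ultimately show ?thesis by simp
qed

end

section \<open>Invariance of the six families\<close>

lemma Const_eq_0_iff [simp]: "Const (c :: 'a::zero) = 0 \<longleftrightarrow> c = 0"
  by (metis Const_0 Const_def lookup_single_eq lookup_zero)

context finite_field_polynomials
begin

abbreviation vZ :: "'a mpoly" where "vZ \<equiv> Z ^ (q - 1)"
abbreviation swap :: "'a mpoly \<Rightarrow> 'a mpoly" where "swap \<equiv> psubst swap_subst"
abbreviation S3 :: "'a mpoly set" where "S3 \<equiv> carrier (S_ring 3)"

lemma swap_vars: "swap_subst 0 = Y" "swap_subst 1 = X" "swap_subst 2 = Z"
  by (simp_all add: swap_subst_def)

lemma S3_Var [simp, intro]: "X \<in> S3" "Y \<in> S3" "Z \<in> S3" by (auto intro!: S_Var)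

lemma S_diff: "f \<in> carrier (S_ring n) \<Longrightarrow> g \<in> carrier (S_ring n) \<Longrightarrow> f - g \<in> (carrier (S_ring n) :: 'a mpoly set)"
  using S_add[of f n "- g"] S_uminus[of g n] by simp

lemma S3_alpha: "a \<in> S3 \<Longrightarrow> b \<in> S3 \<Longrightarrow> alpha n a b \<in> S3"
  unfolding alpha_def by (intro S_sum S_mult S_power)
lemma S3_V2: "a \<in> S3 \<Longrightarrow> b \<in> S3 \<Longrightarrow> V2 a b \<in> S3"
  unfolding V2_def by (intro S_diff S_mult S_power)
lemma S3_D1: "a \<in> S3 \<Longrightarrow> b \<in> S3 \<Longrightarrow> D1 a b \<in> S3"
  unfolding D1_def by (intro S_add S_mult S_power S3_V2)
lemma S3_D0: "a \<in> S3 \<Longrightarrow> b \<in> S3 \<Longrightarrow> D0 a b \<in> S3"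
  unfolding D0_def by (intro S_add S_mult S_power S3_V2)
lemma S3_V3: "a \<in> S3 \<Longrightarrow> b \<in> S3 \<Longrightarrow> c \<in> S3 \<Longrightarrow> V3 a b c \<in> S3"
  unfolding V3_def by (intro S_add S_diff S_mult S_power S3_D1 S3_D0)
lemmas S3_intros = S_add S_mult S_power S_1 S_0 S_diff S_sum S3_alpha S3_V2 S3_D1 S3_D0 S3_V3 S3_Var

lemma power_add_dvd: "(B :: 'a mpoly) dvd (A + B) ^ n - A ^ n"
  using diff_power_eq_sum[of "A + B" "n - 1" A] by (cases n) auto

text \<open>
  \<open>stable_mod_X\<close> and \<open>swap_divisible\<close> serve to control $\delta_2(f)$.
  Its numerator is $f \cdot (XY^N - X^NY) - X^NY(\mathrm{swap} f - f)$, so if $\mathrm{swap} f - f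
  = (Y^{q-1} - X^{q-1})h$ then $\delta_2(f) = \alpha_m f - X^{N-1}h$. For this to be invariant
  modulo $X^N$ under $Y \mapsto cY + aX$ and $Z \mapsto cZ + aX$ it is enough that $h$ is
  invariant modulo $X$. Both sets are closed under sums and products and so can be checked on
  generators.
\<close>

definition stable_mod_X :: "'a mpoly set" where
  "stable_mod_X = {h \<in> S3. \<forall>i\<in>{1, 2}. \<forall>c a. c \<noteq> 0 \<longrightarrow> X dvd psubst (elementary_subst i c 0 a) h - h}"

lemma stable_mod_X_add: "h \<in> stable_mod_X \<Longrightarrow> k \<in> stable_mod_X \<Longrightarrow> h + k \<in> stable_mod_X"
  by (auto simp: stable_mod_X_def psubst_add S_add add_diff_add)

lemma stable_mod_X_mult:
  assumes "h \<in> stable_mod_X" "k \<in> stable_mod_X" shows "h * k \<in> stable_mod_X"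
proof -
  have "X dvd psubst s (h * k) - h * k" if "X dvd psubst s h - h" "X dvd psubst s k - k" for s
  proof -
    have "psubst s (h * k) - h * k = (psubst s h - h) * psubst s k + h * (psubst s k - k)"
      by (simp add: psubst_mult algebra_simps)
    then show ?thesis using that by simp
  qed
  then show ?thesis using assms by (auto simp: stable_mod_X_def S_mult)
qed

lemma stable_mod_X_0: "0 \<in> stable_mod_X" and stable_mod_X_1: "1 \<in> stable_mod_X"
  by (auto simp: stable_mod_X_def S_0 S_1)

lemma stable_mod_X_vars: "vX \<in> stable_mod_X" "vY \<in> stable_mod_X" "vZ \<in> stable_mod_X"
proof -
  have *: "X dvd (Const c * b + Const a * X) ^ (q - 1) - b ^ (q - 1)" if "c \<noteq> 0" for a c b
    using power_add_dvd[of "Const a * X" "Const c * b" "q - 1"] that by (metis Const_q1 dvd_mult_right)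
  show "vX \<in> stable_mod_X" "vY \<in> stable_mod_X" "vZ \<in> stable_mod_X"
    using * by (auto simp: stable_mod_X_def psubst_power elementary_subst_def intro!: S_power)
qed

definition swap_divisible :: "'a mpoly set" where
  "swap_divisible = {f \<in> stable_mod_X. swap f \<in> stable_mod_X \<and> (\<exists>h\<in>stable_mod_X. swap f - f = (vY - vX) * h)}"

lemma swap_divisible_mult:
  assumes "f \<in> swap_divisible" "g \<in> swap_divisible" shows "f * g \<in> swap_divisible"
proof -
  from assms obtain h k where h: "h \<in> stable_mod_X" "swap f - f = (vY - vX) * h"
    and k: "k \<in> stable_mod_X" "swap g - g = (vY - vX) * k" by (auto simp: swap_divisible_def)
  have "swap (f * g) - f * g = (swap f - f) * swap g + f * (swap g - g)"
    by (simp add: psubst_mult algebra_simps)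
  also have "\<dots> = (vY - vX) * (h * swap g + f * k)"
    unfolding h k by (simp add: algebra_simps)
  finally show ?thesis using assms h(1) k(1)
    by (auto simp: swap_divisible_def psubst_mult intro!: stable_mod_X_mult stable_mod_X_add bexI[of _ "h * swap g + f * k"])
qed

lemma swap_divisible_add:
  assumes "f \<in> swap_divisible" "g \<in> swap_divisible" shows "f + g \<in> swap_divisible"
proof -
  from assms obtain h k where h: "h \<in> stable_mod_X" "swap f - f = (vY - vX) * h"
    and k: "k \<in> stable_mod_X" "swap g - g = (vY - vX) * k" by (auto simp: swap_divisible_def)
  have "swap (f + g) - (f + g) = (swap f - f) + (swap g - g)"
    by (simp add: psubst_add)
  also have "\<dots> = (vY - vX) * (h + k)"
    unfolding h k by (simp add: algebra_simps)
  finally show ?thesis using assms h(1) k(1)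
    by (auto simp: swap_divisible_def psubst_add intro!: stable_mod_X_add bexI[of _ "h + k"])
qed

lemma swap_divisible_0: "0 \<in> swap_divisible" and swap_divisible_1: "1 \<in> swap_divisible"
  using stable_mod_X_0 stable_mod_X_1 by (auto simp: swap_divisible_def intro: bexI[of _ 0])

lemma swap_divisible_vX: "vX \<in> swap_divisible" and swap_divisible_vZ: "vZ \<in> swap_divisible"
  using stable_mod_X_0 stable_mod_X_1 stable_mod_X_vars
  by (auto simp: swap_divisible_def psubst_power swap_subst_def intro: bexI[of _ 1] bexI[of _ 0])

lemma swap_divisible_power: "h \<in> swap_divisible \<Longrightarrow> h ^ n \<in> swap_divisible"
  by (induction n) (auto intro: swap_divisible_1 swap_divisible_mult)

lemma swap_divisible_sum: "(\<And>i. i \<in> A \<Longrightarrow> f i \<in> swap_divisible) \<Longrightarrow> sum f A \<in> swap_divisible"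
  by (induction A rule: infinite_finite_induct) (auto intro: swap_divisible_0 swap_divisible_add)

lemma swap_divisible_alpha: "alpha n X Z \<in> swap_divisible"
  unfolding alpha_def
  by (intro swap_divisible_sum swap_divisible_mult swap_divisible_power swap_divisible_vX swap_divisible_vZ)

lemma swap_divisible_D1: "D1 X Z \<in> swap_divisible"
  unfolding D1_eq_alpha by (rule swap_divisible_alpha)

lemma delta2_poly_exists:
  assumes "f \<in> swap_divisible"
  obtains h p where "h \<in> stable_mod_X" "p = alpha m X Y * f - X ^ (q ^ m - 1) * h"
    "L * p = X * Y ^ (q ^ m) * f - Y * X ^ (q ^ m) * swap f"
proof -
  from assms obtain h where h: "h \<in> stable_mod_X" "swap f - f = (vY - vX) * h" by (auto simp: swap_divisible_def)
  have N: "X ^ (q ^ m) = X ^ (q ^ m - 1) * X"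
    using q_ge2 power_Suc2[of X "q ^ m - 1"] by simp
  have "L * (alpha m X Y * f - X ^ (q ^ m - 1) * h) = (L * alpha m X Y) * f - X ^ (q ^ m - 1) * X * Y * ((vY - vX) * h)"
    by (simp add: algebra_simps L2_eq)
  also have "\<dots> = X * Y ^ (q ^ m) * f - Y * X ^ (q ^ m) * swap f"
    unfolding L2_alpha h(2)[symmetric] N[symmetric] by (simp add: algebra_simps)
  finally show ?thesis using h(1) that by blast
qed

text \<open>
  The polynomials of $S(3)$ whose class is in $R^{P(2,1)}$, by
  \<open>Q_class_invariant_iff\<close>.
\<close>

definition P21_invariant :: "nat \<Rightarrow> 'a mpoly \<Rightarrow> bool" where
  "P21_invariant m p \<longleftrightarrow> p \<in> S3 \<and> fixes_mod (q ^ m) p swap_subst \<and>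
    (\<forall>c a. c \<noteq> 0 \<longrightarrow> fixes_mod (q ^ m) p (elementary_subst 1 c 0 a)) \<and>
    (\<forall>c a. c \<noteq> 0 \<longrightarrow> fixes_mod (q ^ m) p (elementary_subst 2 c 0 a))"

lemma P21_invariant_exact:
  assumes "p \<in> S3" "swap p = p"
    "\<And>c a. c \<noteq> 0 \<Longrightarrow> psubst (elementary_subst 1 c 0 a) p = p"
    "\<And>c a. c \<noteq> 0 \<Longrightarrow> psubst (elementary_subst 2 c 0 a) p = p"
  shows "P21_invariant m p"
  using assms by (simp add: P21_invariant_def fixes_mod_def)

text \<open>
  $\alpha_n$ is a quotient of two determinants that are both multiplied by $c$.
\<close>

lemma alpha_translate:
  assumes "c \<noteq> 0" "i \<noteq> j"
  shows "alpha n (Var i) (Const c * Var j + Const a * Var i) = alpha n (Var i) (Var j)"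
proof -
  let ?b = "Const c * Var j + Const a * Var i"
  have L2: "L2 (Var i) ?b = Const c * L2 (Var i) (Var j)"
    by (simp add: L2_eq_V2 V2_add V2_smult V2_self)
  have "L2 (Var i) ?b * alpha n (Var i) ?b = Const c * (L2 (Var i) (Var j) * alpha n (Var i) (Var j))"
    unfolding L2_alpha by (simp add: frob_add power_mult_distrib algebra_simps)
  then have "(Const c * L2 (Var i) (Var j)) * alpha n (Var i) ?b = (Const c * L2 (Var i) (Var j)) * alpha n (Var i) (Var j)"
    unfolding L2 by (simp add: mult_ac)
  moreover have "Const c * L2 (Var i) (Var j :: 'a mpoly) \<noteq> 0"
    using assms L2_neq_0[OF assms(2)] by simp
  ultimately show ?thesis by simp
qed

lemma swap_L2: "swap L = - L"
  by (simp add: psubst_L2 swap_subst_def L2_swap[of Y X])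

text \<open>
  $\delta_2(f)$ is exactly invariant under the interchange, being a quotient of two alternating
  polynomials. The other generators fix $X$, $\alpha_m$ and $f$ and move $h$ by a multiple of $X$,
  which $X^{N-1}$ turns into an element of the ideal.
\<close>

lemma delta2_invariant:
  assumes f: "f \<in> stable_mod_X" and h: "h \<in> stable_mod_X" and p: "p = alpha m X Y * f - X ^ (q ^ m - 1) * h"
    and Lp: "L * p = X * Y ^ (q ^ m) * f - Y * X ^ (q ^ m) * swap f"
    and T: "\<And>c a. c \<noteq> 0 \<Longrightarrow> psubst (elementary_subst 1 c 0 a) f = f"
    and U: "\<And>c a. c \<noteq> 0 \<Longrightarrow> psubst (elementary_subst 2 c 0 a) f = f"
  shows "P21_invariant m p"
proof -
  have S: "p \<in> S3" unfolding p using f h by (intro S3_intros) (auto simp: stable_mod_X_def)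
  have sw2: "swap (swap f) = f"
  proof -
    have "(\<lambda>i. swap (swap_subst i)) = Var" by (auto simp: swap_subst_def fun_eq_iff)
    then show ?thesis by (simp add: psubst_psubst)
  qed
  have "swap L * swap p = - (L * p)"
    unfolding psubst_mult[symmetric] Lp by (simp add: psubst_simps sw2 swap_vars)
  then have "L * swap p = L * p" by (simp add: swap_L2)
  then have "swap p = p" using L2_neq_0[of 0 1] by simp
  then have 1: "fixes_mod (q ^ m) p swap_subst" by (simp add: fixes_mod_def)
  have N: "X ^ (q ^ m) = X ^ (q ^ m - 1) * X"
    using q_ge2 power_Suc2[of X "q ^ m - 1"] by simp
  have 2: "fixes_mod (q ^ m) p (elementary_subst i c 0 a)" if c: "c \<noteq> 0" and i: "i = 1 \<or> i = 2" for i c a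
  proof -
    let ?s = "elementary_subst i c 0 a"
    have "X dvd psubst ?s h - h" using h i c by (auto simp: stable_mod_X_def)
    then obtain k where k: "psubst ?s h - h = X * k" by (rule dvdE)
    have "psubst ?s (alpha m X Y) = alpha m X Y"
      using i alpha_translate[OF c, of 0 1 m a] by (auto simp: psubst_alpha elementary_subst_def)
    moreover have "psubst ?s X = X" using i by (auto simp: elementary_subst_def)
    moreover have "psubst ?s f = f" using i T[OF c] U[OF c] by auto
    ultimately have "psubst ?s p - p = - (X ^ (q ^ m - 1) * (psubst ?s h - h))"
      unfolding p by (simp add: psubst_diff psubst_mult psubst_power algebra_simps)
    also have "psubst ?s h - h = X * k" by (rule k)
    also have "- (X ^ (q ^ m - 1) * (X * k)) = - (X ^ (q ^ m) * k)" unfolding N by (simp add: mult_ac)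
    also have "\<dots> \<in> truncation_ideal (q ^ m)" by (intro J_uminus J_mult_right J_Var) auto
    finally show ?thesis by (simp add: fixes_mod_def)
  qed
  show ?thesis using S 1 2 by (simp add: P21_invariant_def)
qed

definition basis_poly :: "nat \<Rightarrow> index \<Rightarrow> 'a mpoly" where
  "basis_poly m k = (THE p. to_fract p = basis_fun m k)"

lemma basis_poly_eqI:
  assumes "to_fract p = basis_fun m k" shows "basis_poly m k = p"
  unfolding basis_poly_def
proof (rule the_equality)
  fix r :: "'a mpoly" assume "to_fract r = basis_fun m k"
  then have "to_fract r = to_fract p" unfolding assms .
  then show "r = p" by (rule to_fract_eq_iff[THEN iffD1])
qed (rule assms)

lemma basis_class_eq: "basis_class m k = Q_class m 3 (basis_poly m k)"
  by (simp add: basis_class_def basis_poly_def)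

abbreviation E32 :: "'a mpoly" where "E32 \<equiv> VV ^ (q - 1) + E1 ^ q"

lemma basis_poly_1: "basis_poly m (Fam1 i1 i2 i) = E1 ^ i1 * E0 ^ i2 * E32 ^ i"
  by (rule basis_poly_eqI) (simp add: dickson_2 dickson_3_2 del: to_fract_mult)

lemma basis_poly_2: "m \<ge> 1 \<Longrightarrow> basis_poly m (Fam2 i1 i2) = E1 ^ i1 * E0 ^ i2 * delta3_poly m"
  by (rule basis_poly_eqI) (simp add: dickson_2 delta_3_1)

lemma skip_simps: "skip 1 0 = 0" "skip 0 0 = 1" "skip 1 1 = 2" "skip 0 1 = 2"
  by (simp_all add: skip_def)

text \<open>
  The argument of $\delta_2$ in families 3 and 4, in the variables $X$, $Z$ that remain when $Y$
  is omitted. The extra value $i = [m-1]_q$ stands for the inner $\delta_2(1)$ of family 4, which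
  is $\alpha_m$; it continues the sequence because its degree in $Z$ is that of $Q_{2,1}^i$.
\<close>

definition delta2_arg :: "nat \<Rightarrow> nat \<Rightarrow> nat \<Rightarrow> 'a mpoly" where
  "delta2_arg m i1 i = vX ^ i1 * (if i < qint q (m - 1) then D1 X Z ^ i else alpha m X Z)"

lemma delta2_arg_divisible: "delta2_arg m i1 i \<in> swap_divisible"
  unfolding delta2_arg_def
  by (auto intro!: swap_divisible_mult swap_divisible_power swap_divisible_vX swap_divisible_alpha swap_divisible_D1)

lemma delta2_arg_fixed:
  assumes "c \<noteq> 0"
  shows "psubst (elementary_subst 1 c 0 a) (delta2_arg m i1 i) = delta2_arg m i1 i"
    "psubst (elementary_subst 2 c 0 a) (delta2_arg m i1 i) = delta2_arg m i1 i"
  using alpha_translate[OF assms, of 0 2 m a] D1_translate[OF assms, of X Z a]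
  by (simp_all add: delta2_arg_def psubst_simps elementary_subst_def)

lemma delta2_poly_props:
  assumes "\<And>p. L * p = X * Y ^ (q ^ m) * delta2_arg m i1 i - Y * X ^ (q ^ m) * swap (delta2_arg m i1 i)
    \<Longrightarrow> basis_fun m k = to_fract p"
  shows "P21_invariant m (basis_poly m k)"
    "L * basis_poly m k \<in> truncation_ideal (q ^ m)"
    "\<exists>h. basis_poly m k = alpha m X Y * delta2_arg m i1 i - X ^ (q ^ m - 1) * h"
proof -
  obtain h p where hp: "h \<in> stable_mod_X" "p = alpha m X Y * delta2_arg m i1 i - X ^ (q ^ m - 1) * h"
    "L * p = X * Y ^ (q ^ m) * delta2_arg m i1 i - Y * X ^ (q ^ m) * swap (delta2_arg m i1 i)"
    using delta2_poly_exists[OF delta2_arg_divisible, of m m i1 i] .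
  have eq: "basis_poly m k = p" by (rule basis_poly_eqI) (rule assms[OF hp(3), symmetric])
  show "P21_invariant m (basis_poly m k)" unfolding eq
    using delta2_arg_divisible[of m i1 i]
    by (intro delta2_invariant[OF _ hp] delta2_arg_fixed) (auto simp: swap_divisible_def)
  show "L * basis_poly m k \<in> truncation_ideal (q ^ m)"
    unfolding eq hp(3) mult.commute[of X] mult.commute[of Y] mult.assoc by (intro J_diff J_mult_right J_Var) auto
  show "\<exists>h. basis_poly m k = alpha m X Y * delta2_arg m i1 i - X ^ (q ^ m - 1) * h" unfolding eq by (rule exI[of _ h]) (rule hp(2))
qed

lemma basis_fun_3:
  assumes "i < qint q (m - 1)" "L * p = X * Y ^ (q ^ m) * delta2_arg m i1 i - Y * X ^ (q ^ m) * swap (delta2_arg m i1 i)"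
  shows "basis_fun m (Fam3 i1 i) = to_fract p"
proof -
  have "basis_fun m (Fam3 i1 i) = delta 2 m (to_fract (vX ^ i1 * E1 ^ i))"
    by (simp add: dickson_1_0 dickson_2 del: to_fract_mult)
  also have "\<dots> = to_fract p"
    by (rule delta_2) (use assms in \<open>simp add: delta2_arg_def psubst_simps skip_simps swap_subst_def\<close>)
  finally show ?thesis .
qed

lemma basis_fun_4:
  assumes "L * p = X * Y ^ (q ^ m) * delta2_arg m i1 (qint q (m - 1)) - Y * X ^ (q ^ m) * swap (delta2_arg m i1 (qint q (m - 1)))"
  shows "basis_fun m (Fam4 i1) = to_fract p"
proof -
  have "delta 2 m 1 = to_fract (alpha m X Y)"
    using delta_2[of "alpha m X Y" m 1] by (simp add: L2_alpha mult.commute)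
  then have "basis_fun m (Fam4 i1) = delta 2 m (to_fract (vX ^ i1 * alpha m X Y))"
    by (simp add: dickson_1_0)
  also have "\<dots> = to_fract p"
    by (rule delta_2) (use assms in \<open>simp add: delta2_arg_def psubst_simps skip_simps swap_subst_def\<close>)
  finally show ?thesis .
qed

lemma basis_poly_5: "basis_poly m (Fam5 i) = X ^ (q ^ m - 1) * Y ^ (q ^ m - 1) * vZ ^ i"
  by (rule basis_poly_eqI) (simp add: dickson_1_0 delta_1 psubst_simps skip_simps mult.assoc del: to_fract_mult)

lemma basis_poly_6: "basis_poly m Fam6 = X ^ (q ^ m - 1) * Y ^ (q ^ m - 1) * Z ^ (q ^ m - 1)"
proof (rule basis_poly_eqI)
  have "delta 1 m 1 = to_fract (X ^ (q ^ m - 1))" using delta_1[of m 1] by simp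
  then show "to_fract (X ^ (q ^ m - 1) * Y ^ (q ^ m - 1) * Z ^ (q ^ m - 1)) = basis_fun m Fam6"
    by (simp add: delta_1 psubst_simps skip_simps mult.assoc del: to_fract_mult)
qed

text \<open>
  The interchange fixes the monomial. Every other generator changes $Y^{N-1}$ or $Z^n$ by a
  multiple of $X$, which $X^{N-1}$ turns into an element of the ideal.
\<close>

lemma monomial_invariant:
  assumes "(q - 1) dvd n"
  shows "P21_invariant m (X ^ (q ^ m - 1) * Y ^ (q ^ m - 1) * Z ^ n)"
proof -
  let ?N1 = "q ^ m - 1"
  let ?p = "X ^ ?N1 * Y ^ ?N1 * Z ^ n"
  obtain k where n: "n = (q - 1) * k" using assms by blast
  have N1: "?N1 = (q - 1) * qint q m" using qint_eq[OF q_ge2, of m] by simp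
  have cn: "(Const c * b) ^ n = b ^ n" "(Const c * b) ^ ?N1 = b ^ ?N1" if "c \<noteq> 0" for c and b :: "'a mpoly"
    using that by (simp_all only: n N1 power_mult Const_q1[OF that])
  have *: "X ^ ?N1 * g - X ^ ?N1 * h \<in> truncation_ideal (q ^ m)" if dvd: "X dvd g - h" for g h
  proof -
    obtain k where "g - h = X * k" using dvd by blast
    then have "X ^ ?N1 * g - X ^ ?N1 * h = X ^ Suc ?N1 * k" by (simp add: algebra_simps flip: right_diff_distrib)
    also have "\<dots> \<in> truncation_ideal (q ^ m)" by (intro J_mult_right J_Var) auto
    finally show ?thesis .
  qed
  have dvd: "X dvd (Const c * b + Const a * X) ^ n - b ^ n" "X dvd (Const c * b + Const a * X) ^ ?N1 - b ^ ?N1"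
    if "c \<noteq> 0" for c a and b :: "'a mpoly"
    using power_add_dvd[of "Const a * X" "Const c * b"] cn[OF that] by (metis dvd_mult_right)+
  have 1: "fixes_mod (q ^ m) ?p swap_subst"
    by (simp add: fixes_mod_def psubst_simps swap_subst_def mult_ac)
  have 2: "fixes_mod (q ^ m) ?p (elementary_subst 1 c 0 a)" if "c \<noteq> 0" for c a
  proof -
    have "X dvd ((Const c * Y + Const a * X) ^ ?N1 - Y ^ ?N1) * Z ^ n"
      using dvd(2)[OF that] by (rule dvd_mult2)
    then show ?thesis using *[of "(Const c * Y + Const a * X) ^ ?N1 * Z ^ n" "Y ^ ?N1 * Z ^ n"]
      by (simp add: fixes_mod_def psubst_simps elementary_subst_def left_diff_distrib mult.assoc)
  qed
  have 3: "fixes_mod (q ^ m) ?p (elementary_subst 2 c 0 a)" if "c \<noteq> 0" for c a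
  proof -
    have "X dvd Y ^ ?N1 * ((Const c * Z + Const a * X) ^ n - Z ^ n)"
      using dvd(1)[OF that] by (rule dvd_mult)
    then show ?thesis using *[of "Y ^ ?N1 * (Const c * Z + Const a * X) ^ n" "Y ^ ?N1 * Z ^ n"]
      by (simp add: fixes_mod_def psubst_simps elementary_subst_def right_diff_distrib mult.assoc)
  qed
  have "?p \<in> S3" by (intro S3_intros)
  then show ?thesis using 1 2 3 by (simp add: P21_invariant_def)
qed

text \<open>
  $V_3$ and $F(Z) = V_3 \delta_3(1)$ are multiplied by the same scalar $c$, because $F$ is
  additive and $F(X) = 0$.
\<close>

lemma delta3_poly_fixed:
  assumes m: "m \<ge> 1" and T: "psubst s X = X" and U: "psubst s (alpha m X Y) = alpha m X Y" "psubst s (beta m X Y) = beta m X Y"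
     "psubst s VV = Const c * VV" and Z: "psubst s Z = Const c * Z + Const a * X" and c: "c \<noteq> 0"
  shows "psubst s (delta3_poly m) = delta3_poly m"
proof -
  have "Const c * VV * psubst s (delta3_poly m) = psubst s (VV * delta3_poly m)"
    by (simp add: psubst_mult U)
  also have "\<dots> = (Const c * Z + Const a * X) ^ (q ^ m) - alpha m X Y * (Const c * Z + Const a * X) ^ q - beta m X Y * (Const c * Z + Const a * X)"
    unfolding VV_delta3_poly[OF m] by (simp add: psubst_diff psubst_mult psubst_power U Z del: psubst_Var)
  also have "\<dots> = Const c * (VV * delta3_poly m) + Const a * (X ^ (q ^ m) - alpha m X Y * X ^ q - beta m X Y * X)"
    unfolding VV_delta3_poly[OF m] by (simp add: frob_add frob_add1 power_mult_distrib algebra_simps)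
  also have "X ^ (q ^ m) - alpha m X Y * X ^ q - beta m X Y * X = 0"
    using power_qn_linear_left[of X Y m] L2_neq_0[of 0 1] m by simp
  finally have "Const c * VV * psubst s (delta3_poly m) = Const c * VV * delta3_poly m" by (simp add: mult.assoc)
  then show ?thesis using VV_neq_0 c by simp
qed

lemma generator_fixed:
  assumes c: "c \<noteq> 0"
  shows "psubst (elementary_subst 1 c 0 a) E1 = E1" "psubst (elementary_subst 1 c 0 a) E0 = E0"
    "psubst (elementary_subst 1 c 0 a) VV = VV" "psubst (elementary_subst 2 c 0 a) E1 = E1" "psubst (elementary_subst 2 c 0 a) E0 = E0"
    "psubst (elementary_subst 2 c 0 a) VV = Const c * VV" "swap E1 = E1" "swap E0 = E0" "swap VV = VV"
    "psubst (elementary_subst 1 c 0 a) (alpha n X Y) = alpha n X Y" "psubst (elementary_subst 2 c 0 a) (alpha n X Y) = alpha n X Y"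
    "swap (alpha n X Y) = alpha n X Y"
  using D1_swap[of Y X] D0_swap[of Y X] V3_swap[of Y X Z] alpha_swap[of n Y X] alpha_translate[OF c, of 0 1 n a]
  by (simp_all add: psubst_simps swap_subst_def elementary_subst_def D1_translate[OF c] D0_translate[OF c] V3_translate[OF c]
      V3_add V3_smult V3_left)

lemma delta3_poly_invariant:
  assumes m: "m \<ge> 1" and c: "c \<noteq> 0"
  shows "psubst (elementary_subst 1 c 0 a) (delta3_poly m) = delta3_poly m"
    "psubst (elementary_subst 2 c 0 a) (delta3_poly m) = delta3_poly m" "swap (delta3_poly m) = delta3_poly m"
proof -
  show "psubst (elementary_subst 1 c 0 a) (delta3_poly m) = delta3_poly m"
    by (rule delta3_poly_fixed[OF m, where c = 1 and a = 0])
      (simp_all add: generator_fixed[OF c] beta_def psubst_mult psubst_uminus psubst_power, simp_all add: elementary_subst_def)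
  show "psubst (elementary_subst 2 c 0 a) (delta3_poly m) = delta3_poly m"
    by (rule delta3_poly_fixed[OF m, where c = c and a = a])
      (simp_all add: generator_fixed[OF c] beta_def psubst_mult psubst_uminus psubst_power c, simp_all add: elementary_subst_def)
  show "swap (delta3_poly m) = delta3_poly m"
    by (simp add: delta3_poly_def psubst_sum psubst_mult psubst_power generator_fixed[OF c])
qed

lemma S3_delta3_poly: "delta3_poly m \<in> S3"
  unfolding delta3_poly_def by (intro S3_intros)

lemma basis_poly_invariant:
  assumes m: "m \<ge> 1" and k: "k \<in> indices q m"
  shows "P21_invariant m (basis_poly m k)"
proof (cases k)
  case (Fam1 i1 i2 i)
  have "(Const c * VV) ^ (q - 1) = VV ^ (q - 1)" if "c \<noteq> 0" for c using Const_q1[OF that] .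
  then show ?thesis unfolding Fam1 basis_poly_1
    by (intro P21_invariant_exact S3_intros) (simp_all add: generator_fixed generator_fixed(7-9)[of 1] psubst_add psubst_mult psubst_power)
next
  case (Fam2 i1 i2)
  show ?thesis unfolding Fam2 basis_poly_2[OF m]
    by (intro P21_invariant_exact S3_intros S3_delta3_poly)
      (simp_all add: generator_fixed generator_fixed(7-9)[of 1] psubst_mult psubst_power delta3_poly_invariant[OF m] delta3_poly_invariant(3)[OF m, of 1])
next
  case (Fam3 i1 i)
  then have "i < qint q (m - 1)" using k by (auto simp: indices_def)
  then show ?thesis unfolding Fam3 by (rule delta2_poly_props(1)[OF basis_fun_3])
next
  case (Fam4 i1)
  show ?thesis unfolding Fam4 by (rule delta2_poly_props(1)[OF basis_fun_4])
next
  case (Fam5 i)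
  then show ?thesis unfolding Fam5 basis_poly_5 power_mult[symmetric] by (intro monomial_invariant) simp
next
  case Fam6
  have "q ^ m - 1 = (q - 1) * qint q m" using qint_eq[OF q_ge2, of m] by simp
  then have "(q - 1) dvd (q ^ m - 1)" by simp
  then show ?thesis unfolding Fam6 basis_poly_6 by (rule monomial_invariant)
qed

end

section \<open>Leading coefficients in the third variable\<close>

text \<open>
  The degree in $Z$ of a polynomial in all variables is encoded by bounds, so that $0$ needs no
  special value.
\<close>

definition degZ_le :: "nat \<Rightarrow> 'a::comm_ring_1 mpoly \<Rightarrow> bool" where
  "degZ_le d f \<longleftrightarrow> (\<forall>t\<in>Poly_Mapping.keys f. Poly_Mapping.lookup t 2 \<le> d)"

definition degZ_less :: "nat \<Rightarrow> 'a::comm_ring_1 mpoly \<Rightarrow> bool" where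
  "degZ_less d f \<longleftrightarrow> (\<forall>t\<in>Poly_Mapping.keys f. Poly_Mapping.lookup t 2 < d)"

definition monicZ :: "nat \<Rightarrow> 'a::comm_ring_1 mpoly \<Rightarrow> bool" where
  "monicZ d f \<longleftrightarrow> degZ_less d (f - Var 2 ^ d)"

lemma degZ_less_add: "degZ_less d f \<Longrightarrow> degZ_less d g \<Longrightarrow> degZ_less d (f + g)"
  unfolding degZ_less_def using Poly_Mapping.keys_add[of f g] by blast
lemma degZ_le_add: "degZ_le d f \<Longrightarrow> degZ_le d g \<Longrightarrow> degZ_le d (f + g)"
  unfolding degZ_le_def using Poly_Mapping.keys_add[of f g] by blast
lemma degZ_le_uminus: "degZ_le d f \<Longrightarrow> degZ_le d (- f)"
  by (simp add: degZ_le_def)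
lemma degZ_le_diff: "degZ_le d f \<Longrightarrow> degZ_le d g \<Longrightarrow> degZ_le d (f - g)"
  using degZ_le_add[of d f "- g"] degZ_le_uminus[of d g] by simp
lemma degZ_le_mult:
  assumes "degZ_le d f" "degZ_le e g" shows "degZ_le (d + e) (f * g)"
  unfolding degZ_le_def
proof
  fix t assume "t \<in> Poly_Mapping.keys (f * g)"
  then obtain u v where "t = u + v" "u \<in> Poly_Mapping.keys f" "v \<in> Poly_Mapping.keys g"
    using keys_mult[of f g] by blast
  then show "Poly_Mapping.lookup t 2 \<le> d + e"
    using assms by (auto simp: degZ_le_def lookup_add intro: add_mono)
qed
lemma degZ_less_mult:
  assumes "degZ_less d f" "degZ_le e g" shows "degZ_less (d + e) (f * g)"
  unfolding degZ_less_def
proof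
  fix t assume "t \<in> Poly_Mapping.keys (f * g)"
  then obtain u v where "t = u + v" "u \<in> Poly_Mapping.keys f" "v \<in> Poly_Mapping.keys g"
    using keys_mult[of f g] by blast
  then show "Poly_Mapping.lookup t 2 < d + e"
    using assms by (auto simp: degZ_less_def degZ_le_def lookup_add intro: add_less_le_mono)
qed
lemma degZ_le_mono: "degZ_le d f \<Longrightarrow> d \<le> e \<Longrightarrow> degZ_le e f"
  by (auto simp: degZ_le_def)
lemma degZ_less_if_le: "degZ_le d f \<Longrightarrow> d < e \<Longrightarrow> degZ_less e f"
  by (auto simp: degZ_le_def degZ_less_def)
lemma degZ_le_if_less: "degZ_less d f \<Longrightarrow> degZ_le d f"
  by (auto simp: degZ_le_def degZ_less_def)
lemma degZ_le_Var: "degZ_le (if i = 2 then 1 else 0) (Var i)"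
  by (auto simp: degZ_le_def Var_def lookup_single when_def)
lemma degZ_le_Const: "degZ_le 0 (Const c)"
  by (auto simp: degZ_le_def Const_def)
lemma degZ_le_power: "degZ_le d f \<Longrightarrow> degZ_le (n * d) (f ^ n)"
  using degZ_le_Const[of 1] by (induction n) (auto dest: degZ_le_mult)
lemma degZ_le_0: "degZ_le d 0" by (simp add: degZ_le_def)
lemma degZ_le_sum: "(\<And>i. i \<in> A \<Longrightarrow> degZ_le d (f i)) \<Longrightarrow> degZ_le d (sum f A)"
  by (induction A rule: infinite_finite_induct) (auto intro: degZ_le_0 degZ_le_add)
lemma degZ_le_0_mult: "degZ_le 0 f \<Longrightarrow> degZ_le d g \<Longrightarrow> degZ_le d (f * g)"
  using degZ_le_mult[of 0 f d g] by simp
lemma degZ_le_0_power: "degZ_le 0 f \<Longrightarrow> degZ_le 0 (f ^ n)"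
  using degZ_le_power[of 0 f n] by simp
lemma degZ_le_Z_power: "degZ_le n (Var 2 ^ n)"
  using degZ_le_power[OF degZ_le_Var[of 2], of n] by simp
lemma degZ_le_XY: "degZ_le 0 (Var 0)" "degZ_le 0 (Var 1)" using degZ_le_Var[of 0] degZ_le_Var[of 1] by simp_all

lemma monicZ_imp_le: "monicZ d f \<Longrightarrow> degZ_le d f"
  using degZ_le_add[OF degZ_le_if_less degZ_le_Z_power, of d "f - Var 2 ^ d"] by (simp add: monicZ_def)

lemma monicZ_add_lower: "monicZ d f \<Longrightarrow> degZ_less d g \<Longrightarrow> monicZ d (f + g)"
  using degZ_less_add[of d "f - Var 2 ^ d" g] by (simp add: monicZ_def algebra_simps)

lemma monicZ_Z: "monicZ d (Var 2 ^ d)" by (simp add: monicZ_def degZ_less_def)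

lemma monicZ_mult:
  assumes "monicZ d f" "monicZ e g" shows "monicZ (d + e) (f * g)"
proof -
  have "f * g - Var 2 ^ (d + e) = (f - Var 2 ^ d) * g + (g - Var 2 ^ e) * Var 2 ^ d"
    by (simp add: algebra_simps power_add)
  moreover have "degZ_less (d + e) ((f - Var 2 ^ d) * g)"
    using assms monicZ_imp_le by (intro degZ_less_mult) (auto simp: monicZ_def)
  moreover have "degZ_less (e + d) ((g - Var 2 ^ e) * Var 2 ^ d)"
    using assms degZ_le_Z_power by (intro degZ_less_mult) (auto simp: monicZ_def)
  ultimately show ?thesis by (simp add: monicZ_def degZ_less_add add.commute)
qed

lemma monicZ_power: "monicZ d f \<Longrightarrow> monicZ (n * d) (f ^ n)"
  using monicZ_Z[of 0] by (induction n) (auto dest: monicZ_mult)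

text \<open>
  The largest $Z$-degree comes from $B_n G_n$ alone, and as it is below $N$ the reduction modulo
  $Z^N$ does not interfere. So $B_n$ is in the ideal, and one descends.
\<close>

lemma extract_coefficients:
  fixes B G :: "nat \<Rightarrow> 'a::comm_ring_1 mpoly"
  assumes "\<And>i. i \<le> n \<Longrightarrow> monicZ (d * i) (G i)" "\<And>i. i \<le> n \<Longrightarrow> degZ_le 0 (B i)" "d > 0" "d * n < N"
    and "(\<Sum>i\<le>n. B i * G i) \<in> truncation_ideal N" and "i \<le> n"
  shows "B i \<in> truncation_ideal N"
  using assms
proof (induction n)
  case 0
  then have "monicZ 0 (G 0)" by simp
  then have "G 0 - Var 2 ^ 0 = 0" by (simp add: monicZ_def degZ_less_def)
  then show ?case using 0 by simp
next
  case (Suc n)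
  let ?n = "Suc n" and ?J = "truncation_ideal N :: 'a mpoly set"
  have top: "B ?n \<in> ?J"
  proof (rule ccontr)
    assume "B ?n \<notin> ?J"
    then obtain t where t: "t \<in> Poly_Mapping.keys (B ?n)" "\<And>i. i < 3 \<Longrightarrow> Poly_Mapping.lookup t i < N"
      by (auto simp: truncation_ideal_def not_le)
    let ?t = "t + Poly_Mapping.single 2 (d * ?n)"
    have t2: "Poly_Mapping.lookup t 2 = 0" using t(1) Suc.prems(2)[of ?n] by (auto simp: degZ_le_def)
    define r where "r = (\<Sum>i\<le>n. B i * G i) + B ?n * (G ?n - Var 2 ^ (d * ?n))"
    have "degZ_less (d * ?n) r"
      unfolding r_def
    proof (intro degZ_less_add)
      have "degZ_le (d * n) (\<Sum>i\<le>n. B i * G i)"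
      proof (rule degZ_le_sum)
        fix i assume i: "i \<in> {..n}"
        then have "degZ_le (d * i) (B i * G i)"
          using Suc.prems(1)[of i] Suc.prems(2)[of i] by (intro degZ_le_0_mult) (auto intro: monicZ_imp_le)
        then show "degZ_le (d * n) (B i * G i)" using i by (auto intro: degZ_le_mono)
      qed
      then show "degZ_less (d * ?n) (\<Sum>i\<le>n. B i * G i)"
        by (rule degZ_less_if_le) (use Suc.prems(3) in simp)
      show "degZ_less (d * ?n) (B ?n * (G ?n - Var 2 ^ (d * ?n)))"
        using degZ_less_mult[of "d * ?n" "G ?n - Var 2 ^ (d * ?n)" 0 "B ?n"] Suc.prems(1)[of ?n] Suc.prems(2)[of ?n]
        by (simp add: monicZ_def mult.commute)
    qed
    then have "?t \<notin> Poly_Mapping.keys r" by (auto simp: degZ_less_def lookup_add)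
    moreover have "(\<Sum>i\<le>?n. B i * G i) = B ?n * Poly_Mapping.single (Poly_Mapping.single 2 (d * ?n)) 1 + r"
      by (simp add: r_def algebra_simps flip: Var_power)
    moreover have "Poly_Mapping.lookup (\<Sum>i\<le>?n. B i * G i) ?t = 0"
    proof (rule J_lookup[OF Suc.prems(5)])
      fix i :: nat assume "i < 3"
      then show "Poly_Mapping.lookup ?t i < N"
        using t(2)[of i] t2 Suc.prems(4) by (auto simp: lookup_add lookup_single when_def)
    qed
    ultimately have "Poly_Mapping.lookup (B ?n) t = 0"
      using lookup_mult_single[of "B ?n" "Poly_Mapping.single 2 (d * ?n)" 1 t] by (simp add: lookup_add in_keys_iff)
    then show False using t(1) by (simp add: in_keys_iff)
  qed
  show ?case
  proof (cases "i = ?n")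
    case True then show ?thesis using top by simp
  next
    case False
    have "(\<Sum>i\<le>?n. B i * G i) - B ?n * G ?n \<in> ?J"
      by (rule J_diff[OF Suc.prems(5) J_mult_right[OF top]])
    then have "(\<Sum>i\<le>n. B i * G i) \<in> ?J" by simp
    moreover have "d * n < N" using Suc.prems(4) by simp
    ultimately show ?thesis using Suc.IH Suc.prems False by auto
  qed
qed

section \<open>Independence of the monomials indexed by Delta\<close>

text \<open>
  A spanning family that is not larger than an independent one is independent. Over a finite
  field: expressing the independent elements by the spanning ones gives an injective map between
  coefficient families, which by counting is bijective; a relation between the spanning elements
  would contradict injectivity.
\<close>

lemma spanning_independent:
  fixes v :: "'i \<Rightarrow> 'a::{field,finite} mpoly" and e :: "'j \<Rightarrow> 'a mpoly"
  assumes fin: "finite I" "finite K" and card: "card I \<le> card K"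
    and span: "\<And>j. j \<in> K \<Longrightarrow> \<exists>g. e j - (\<Sum>i\<in>I. Const (g i) * v i) \<in> truncation_ideal N"
    and indep: "\<And>h j. (\<Sum>j\<in>K. Const (h j) * e j) \<in> truncation_ideal N \<Longrightarrow> j \<in> K \<Longrightarrow> h j = 0"
    and rel: "(\<Sum>i\<in>I. Const (g i) * v i) \<in> truncation_ideal N" and i: "i \<in> I"
  shows "g i = 0"
proof -
  let ?J = "truncation_ideal N :: 'a mpoly set"
  let ?V = "\<lambda>g. \<Sum>i\<in>I. Const (g i) * v i" and ?E = "\<lambda>h. \<Sum>j\<in>K. Const (h j) * e j"
  obtain s where s: "\<And>j. j \<in> K \<Longrightarrow> e j - ?V (s j) \<in> ?J" using span by metis
  define S where "S h = restrict (\<lambda>i. \<Sum>j\<in>K. h j * s j i) I" for h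
  have S: "?E h - ?V (S h) \<in> ?J" for h
  proof -
    have Const_sum: "Const (\<Sum>j\<in>K. f j) = (\<Sum>j\<in>K. Const (f j) :: 'a mpoly)" for f
      by (induction K rule: infinite_finite_induct) (simp_all add: Const_add)
    have "?V (S h) = (\<Sum>i\<in>I. \<Sum>j\<in>K. Const (h j) * (Const (s j i) * v i))"
      by (rule sum.cong) (simp_all add: S_def Const_sum Const_mult sum_distrib_right mult.assoc)
    also have "\<dots> = (\<Sum>j\<in>K. Const (h j) * ?V (s j))"
      by (subst sum.swap) (simp add: sum_distrib_left)
    finally have "?E h - ?V (S h) = (\<Sum>j\<in>K. Const (h j) * (e j - ?V (s j)))"
      by (simp add: right_diff_distrib sum_subtractf)
    then show ?thesis using s by (auto intro: J_sum J_mult)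
  qed
  let ?PK = "PiE K (\<lambda>_. UNIV :: 'a set)" and ?PI = "PiE I (\<lambda>_. UNIV :: 'a set)"
  have E_diff: "?E (\<lambda>j. h j - h' j) = ?E h - ?E h'" for h h'
    by (simp add: Const_diff left_diff_distrib sum_subtractf)
  have V_diff: "?V (\<lambda>j. h j - h' j) = ?V h - ?V h'" for h h'
    by (simp add: Const_diff left_diff_distrib sum_subtractf)
  have inj': "h j = h' j" if "?V (S h) - ?V (S h') \<in> ?J" "j \<in> K" for h h' j
  proof -
    have "?E h - ?E h' = (?E h - ?V (S h)) - (?E h' - ?V (S h')) + (?V (S h) - ?V (S h'))" by simp
    also have "\<dots> \<in> ?J" by (intro J_add J_diff S that)
    finally have "?E (\<lambda>j. h j - h' j) \<in> ?J" unfolding E_diff .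
    from indep[of "\<lambda>j. h j - h' j", OF this that(2)] show ?thesis by simp
  qed
  have inj: "inj_on S ?PK"
  proof (rule inj_onI)
    fix h h' assume h: "h \<in> ?PK" "h' \<in> ?PK" "S h = S h'"
    then have "?V (S h) - ?V (S h') = 0" by simp
    then have "?V (S h) - ?V (S h') \<in> ?J" by (simp only: J_0)
    then have "h j = h' j" if "j \<in> K" for j using that by (rule inj')
    then show "h = h'" using h by (intro PiE_ext) auto
  qed
  have sub: "S ` ?PK \<subseteq> ?PI" by (auto simp: S_def)
  have "card ?PI \<le> card ?PK"
  proof -
    have "CARD('a) ^ card I \<le> CARD('a) ^ card K"
      using card zero_less_card_finite[where ?'a = 'a] by (intro power_increasing) (simp_all only: Suc_leI One_nat_def)
    then show ?thesis using fin by (simp add: card_PiE)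
  qed
  then have "S ` ?PK = ?PI"
    using sub fin card_image[OF inj] by (intro card_seteq) (auto intro: finite_PiE)
  \<comment> \<open>Surjectivity yields $h$ with $S(h) = S(0) + g$. The given relation makes the combinations of both congruent, so $h = 0$ by injectivity.\<close>
  moreover have "restrict (\<lambda>i. S (\<lambda>_. 0) i + g i) I \<in> ?PI" by simp
  ultimately obtain h where h: "S h = restrict (\<lambda>i. S (\<lambda>_. 0) i + g i) I" by (metis imageE)
  have "?V (S h) = ?V (S (\<lambda>_. 0)) + ?V g"
    unfolding h by (simp add: Const_add distrib_right sum.distrib cong: sum.cong)
  then have "?V (S h) - ?V (S (\<lambda>_. 0)) = ?V g" by simp
  then have "?V (S h) - ?V (S (\<lambda>_. 0)) \<in> ?J" using rel by (simp only:)
  then have "h j = 0" if "j \<in> K" for j using that by (rule inj')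
  then have "S h = S (\<lambda>_. 0)" by (simp add: S_def)
  then have "S (\<lambda>_. 0) i = S (\<lambda>_. 0) i + g i" using h i by (metis restrict_apply')
  then show ?thesis by simp
qed

lemma lookup_XY:
  "Poly_Mapping.lookup (Var 0 ^ i * Var 1 ^ j :: 'a::comm_semiring_1 mpoly) (Poly_Mapping.single 0 a + Poly_Mapping.single 1 b)
    = (if i = a \<and> j = b then 1 else 0)"
proof -
  have "Poly_Mapping.single (0::nat) i + Poly_Mapping.single 1 j = Poly_Mapping.single 0 a + Poly_Mapping.single 1 (b :: nat)
     \<longleftrightarrow> i = a \<and> j = b" (is "?l = ?r \<longleftrightarrow> _")
  proof
    assume eq: "?l = ?r"
    have "Poly_Mapping.lookup ?l 0 = Poly_Mapping.lookup ?r 0" "Poly_Mapping.lookup ?l 1 = Poly_Mapping.lookup ?r 1"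
      by (simp_all only: eq)
    then show "i = a \<and> j = b" by (simp add: lookup_add lookup_single when_def)
  qed simp
  then show ?thesis by (auto simp: Var_power mult_single lookup_single when_def)
qed

lemma J_lookup_XY:
  assumes "f \<in> truncation_ideal N" "a < N" "b < N"
  shows "Poly_Mapping.lookup f (Poly_Mapping.single 0 a + Poly_Mapping.single 1 b) = 0"
  by (rule J_lookup[OF assms(1)]) (use assms(2,3) in \<open>auto simp: lookup_add lookup_single when_def\<close>)

context finite_field_polynomials
begin

text \<open>
  The number of pairs with $[l]_q \le b < [l+1]_q$ is at most $([m-1]_q - [l]_q)q^l$, and the sum
  of these bounds over $l < m - 1$ is $(N-1)(N-q)/((q^2-1)(q^2-q))$.
\<close>

lemma card_Delta2:
  assumes m: "m \<ge> 2"
  shows "finite (Delta2 q m)" "card (Delta2 q m) * ((q\<^sup>2 - 1) * (q\<^sup>2 - q)) \<le> (q ^ m - 1) * (q ^ m - q)"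
proof -
  define n where "n = m - 1"
  have mn: "m = Suc n" using m by (simp add: n_def)
  let ?U = "\<Union>l<n. {..<qint q n - qint q l} \<times> {qint q l..<qint q (Suc l)}"
  have sub: "Delta2 q m \<subseteq> ?U"
  proof clarify
    fix a b assume "(a, b) \<in> Delta2 q m"
    then obtain l1 l2 where l: "l1 \<le> m - 2" "l2 \<le> l1" "a < qint q (Suc l1) - qint q l2" "qint q l2 \<le> b" "b < qint q (Suc l2)"
      unfolding Delta2_iff[OF q_ge2] by blast
    moreover have "qint q (Suc l1) \<le> qint q n" using l(1) m by (intro qint_mono[OF q_ge2]) (simp add: n_def)
    moreover have "l2 < n" using l m by (simp add: n_def)
    ultimately show "(a, b) \<in> ?U" by (intro UN_I[of l2]) auto
  qed
  have fin: "finite ?U" by simp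
  then show "finite (Delta2 q m)" using sub by (rule finite_subset[rotated])
  have "card (Delta2 q m) \<le> card ?U" by (rule card_mono[OF fin sub])
  also have "\<dots> \<le> (\<Sum>l<n. card ({..<qint q n - qint q l} \<times> {qint q l..<qint q (Suc l)}))"
    by (rule card_UN_le) simp
  also have "\<dots> = (\<Sum>l<n. (qint q n - qint q l) * q ^ l)"
    by (rule sum.cong) (simp_all add: card_cartesian_product qint_Suc(1)[OF q_ge2])
  finally have le: "card (Delta2 q m) \<le> (\<Sum>l<n. (qint q n - qint q l) * q ^ l)" .
  let ?q = "int q"
  have closed: "(?q\<^sup>2 - 1) * (\<Sum>l<k. (?q ^ n - ?q ^ l) * ?q ^ l) = ?q ^ n * (?q ^ k - 1) * (?q + 1) - ((?q ^ k)\<^sup>2 - 1)" for k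
  proof (induction k)
    case (Suc k)
    have step: "(?q\<^sup>2 - 1) * (\<Sum>l<Suc k. (?q ^ n - ?q ^ l) * ?q ^ l)
      = (?q\<^sup>2 - 1) * (\<Sum>l<k. (?q ^ n - ?q ^ l) * ?q ^ l) + (?q\<^sup>2 - 1) * ((?q ^ n - ?q ^ k) * ?q ^ k)"
      by (simp add: distrib_left)
    show ?case unfolding step Suc.IH by (simp add: algebra_simps power2_eq_square)
  qed simp
  have "int ((q - 1) * (\<Sum>l<n. (qint q n - qint q l) * q ^ l)) = (\<Sum>l<n. (?q ^ n - ?q ^ l) * ?q ^ l)"
  proof -
    have "int ((q - 1) * ((qint q n - qint q l) * q ^ l)) = (?q ^ n - ?q ^ l) * ?q ^ l" if "l < n" for l
    proof -
      have "(q - 1) * (qint q n - qint q l) = q ^ n - q ^ l"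
        using qint_eq[OF q_ge2, of n] qint_eq[OF q_ge2, of l] by (simp add: diff_mult_distrib2)
      moreover have "q ^ l \<le> q ^ n" using that q_ge2 by (intro power_increasing) auto
      ultimately have "(q - 1) * ((qint q n - qint q l) * q ^ l) = (q ^ n - q ^ l) * q ^ l" "q ^ l \<le> q ^ n"
        by (simp_all only: mult.assoc[symmetric])
      then show ?thesis by (simp only: of_nat_mult of_nat_diff of_nat_power)
    qed
    then show ?thesis unfolding sum_distrib_left of_nat_sum by (intro sum.cong refl) (simp only: lessThan_iff)
  qed
  then have "int ((q - 1) * (\<Sum>l<n. (qint q n - qint q l) * q ^ l)) * (?q\<^sup>2 - 1) * ?q
      = ?q * ((?q\<^sup>2 - 1) * (\<Sum>l<n. (?q ^ n - ?q ^ l) * ?q ^ l))"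
    by (simp only: mult_ac)
  also have "\<dots> = (?q ^ m - 1) * (?q ^ m - ?q)"
    unfolding closed by (simp add: mn algebra_simps power2_eq_square)
  finally have "int ((q - 1) * (\<Sum>l<n. (qint q n - qint q l) * q ^ l)) * (?q\<^sup>2 - 1) * ?q = (?q ^ m - 1) * (?q ^ m - ?q)" .
  moreover have "int (q\<^sup>2 - 1) = ?q\<^sup>2 - 1" "int (q ^ m - 1) = ?q ^ m - 1" "int (q ^ m - q) = ?q ^ m - ?q"
  proof -
    have q1: "1 \<le> q" using q_ge2 by simp
    have "q \<le> q ^ m" by (rule self_le_power[OF q1]) (simp add: mn)
    with one_le_power[OF q1, of 2] one_le_power[OF q1, of m]
    have "1 \<le> q\<^sup>2" "1 \<le> q ^ m" "q \<le> q ^ m" by simp_all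
    then show "int (q\<^sup>2 - 1) = ?q\<^sup>2 - 1" "int (q ^ m - 1) = ?q ^ m - 1" "int (q ^ m - q) = ?q ^ m - ?q"
      by (simp_all only: of_nat_diff of_nat_power of_nat_1)
  qed
  moreover have "q\<^sup>2 - q = (q - 1) * q" by (simp add: power2_eq_square diff_mult_distrib)
  ultimately have "int ((\<Sum>l<n. (qint q n - qint q l) * q ^ l) * ((q\<^sup>2 - 1) * (q\<^sup>2 - q))) = int ((q ^ m - 1) * (q ^ m - q))"
    by (simp only: of_nat_mult mult_ac)
  then have "(\<Sum>l<n. (qint q n - qint q l) * q ^ l) * ((q\<^sup>2 - 1) * (q\<^sup>2 - q)) = (q ^ m - 1) * (q ^ m - q)"
    by (simp only: of_nat_eq_iff)
  then show "card (Delta2 q m) * ((q\<^sup>2 - 1) * (q\<^sup>2 - q)) \<le> (q ^ m - 1) * (q ^ m - q)"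
    using mult_le_mono1[OF le] by metis
qed

text \<open>
  $L X^iY^j = X^{i+1}Y^{j+q} - X^{i+q}Y^{j+1}$. The first monomial is outside the ideal and has
  the larger exponent of $Y$, so the coefficients vanish one after the other, starting with the
  largest $j$.
\<close>

lemma L_monomials_independent:
  assumes rel: "(\<Sum>(i, j)\<in>{..<q ^ m - 1} \<times> {..<q ^ m - q}. Const (h (i, j)) * (L * (X ^ i * Y ^ j))) \<in> truncation_ideal (q ^ m)"
    and ij: "i < q ^ m - 1" "j < q ^ m - q"
  shows "h (i, j) = 0"
proof -
  let ?M = "{..<q ^ m - 1} \<times> {..<q ^ m - q}"
  have "h (i, j) = 0" if "i < q ^ m - 1" "j < q ^ m - q" for i j
    using that
  proof (induction "q ^ m - j" arbitrary: i j rule: less_induct)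
    case less
    let ?t = "Poly_Mapping.single 0 (i + 1) + Poly_Mapping.single 1 (j + q)"
    have "0 = Poly_Mapping.lookup (\<Sum>(i, j)\<in>?M. Const (h (i, j)) * (L * (X ^ i * Y ^ j))) ?t"
      using less.prems q_ge2 by (intro J_lookup_XY[OF rel, symmetric]) auto
    also have "\<dots> = (\<Sum>(i', j')\<in>?M. h (i', j') * Poly_Mapping.lookup (L * (X ^ i' * Y ^ j')) ?t)"
      by (simp add: lookup_sum lookup_Const_mult split_beta)
    also have "\<dots> = (\<Sum>x\<in>?M. if x = (i, j) then h (i, j) else 0)"
    proof (rule sum.cong[OF refl])
      fix x assume "x \<in> ?M"
      then obtain i' j' where x: "x = (i', j')" and "i' < q ^ m - 1" "j' < q ^ m - q" by auto
      have "L * (X ^ i' * Y ^ j') = X ^ (i' + 1) * Y ^ (j' + q) - X ^ (i' + q) * Y ^ (j' + 1)"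
        by (simp add: L2_def power_add algebra_simps)
      then have "Poly_Mapping.lookup (L * (X ^ i' * Y ^ j')) ?t
        = (if i' + 1 = i + 1 \<and> j' + q = j + q then 1 else 0) - (if i' + q = i + 1 \<and> j' + 1 = j + q then 1 else 0)"
        by (simp only: lookup_minus lookup_XY)
      moreover have "h (i', j') = 0" if "j' + 1 = j + q"
      proof (rule less.hyps)
        have "j < j'" using that q_ge2 by linarith
        then show "q ^ m - j' < q ^ m - j" using \<open>j' < q ^ m - q\<close> by linarith
      qed fact+
      ultimately show "(case x of (i', j') \<Rightarrow> h (i', j') * Poly_Mapping.lookup (L * (X ^ i' * Y ^ j')) ?t)
          = (if x = (i, j) then h (i, j) else 0)"
        unfolding x by auto
    qed
    also have "\<dots> = h (i, j)" using less.prems by (simp add: sum.delta)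
    finally show ?case by simp
  qed
  then show ?thesis using ij .
qed

lemma X_power_reduce: "X ^ (q\<^sup>2 - 1) = vX * E1 - E0"
proof -
  have "q\<^sup>2 - 1 = (q - 1) * (q + 1)" using q_ge2 by (simp add: power2_eq_square algebra_simps)
  then have "X ^ (q\<^sup>2 - 1) = vX * vX ^ q" by (simp only: power_mult) (simp add: power_add mult.commute)
  then show ?thesis by (simp add: D1_def D0_def algebra_simps)
qed

lemma Y_power_reduce: "Y ^ (q\<^sup>2 - q) = E1 - (\<Sum>l<q. vY ^ (q - Suc l) * vX ^ Suc l)"
proof -
  have "q\<^sup>2 - q = (q - 1) * q" using q_ge2 by (simp add: power2_eq_square algebra_simps)
  then have "Y ^ (q\<^sup>2 - q) = vY ^ q" by (simp only: power_mult)
  moreover have "E1 = vY ^ q + (\<Sum>l<q. vY ^ (q - Suc l) * vX ^ Suc l)"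
    unfolding D1_sum lessThan_Suc_atMost[symmetric] sum.lessThan_Suc_shift by simp
  ultimately show ?thesis by simp
qed

text \<open>
  The polynomials in $X$, $Y$ are generated as a module over the Dickson algebra by the $X^nY^k$
  with $n < q^2 - 1$ and $k < q^2 - q$, because of the two monic equations
  \<open>X_power_reduce\<close> and \<open>Y_power_reduce\<close>. After multiplication by $L$ the
  Dickson monomials can be restricted to $\Delta^m_2$.
\<close>

lemma Delta2_monomials_span:
  assumes m: "m \<ge> 2"
    and add: "\<And>f g. P f \<Longrightarrow> P g \<Longrightarrow> P (f + g)" and scale: "\<And>c f. P f \<Longrightarrow> P (Const c * f)"
    and J: "\<And>f. f \<in> truncation_ideal (q ^ m) \<Longrightarrow> P f"
    and gen: "\<And>n k a b. n < q\<^sup>2 - 1 \<Longrightarrow> k < q\<^sup>2 - q \<Longrightarrow> (a, b) \<in> Delta2 q m \<Longrightarrow> P (L * (X ^ n * Y ^ k) * (E1 ^ a * E0 ^ b))"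
  shows "P (L * (X ^ n * Y ^ k) * (E1 ^ a * E0 ^ b))"
proof -
  have neg: "P (- f)" if "P f" for f using scale[OF that, of "- 1"] by (simp add: Const_uminus)
  have diff: "P (f - g)" if "P f" "P g" for f g using add[OF that(1) neg[OF that(2)]] by simp
  have sum: "P (\<Sum>l\<in>A. f l)" if "\<And>l. l \<in> A \<Longrightarrow> P (f l)" for A :: "nat set" and f
    using that by (induction A rule: infinite_finite_induct) (auto intro: add J)
  show ?thesis
  proof (induction k arbitrary: n a b rule: less_induct)
    case (less k)
    note IHk = less
    show ?case
    proof (cases "k < q\<^sup>2 - q")
      case True
      show ?thesis
      proof (induction n arbitrary: a b rule: less_induct)
        case (less n)
        show ?case
        proof (cases "n < q\<^sup>2 - 1")
          case n: True
          show ?thesis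
            by (rule reduce_to_Delta2[OF m]) (use add scale J gen[OF n True] in auto)
        next
          case False
          let ?n = "n - (q\<^sup>2 - 1)"
          have "q < q\<^sup>2" using q_ge2 by (simp add: power2_eq_square)
          then have lt: "?n + (q - 1) < n" "?n < n" using False q_ge2 by auto
          have Xn: "X ^ n = X ^ ?n * (vX * E1 - E0)"
            unfolding X_power_reduce[symmetric] using False by (simp flip: power_add)
          have "L * (X ^ n * Y ^ k) * (E1 ^ a * E0 ^ b) =
             L * (X ^ (?n + (q - 1)) * Y ^ k) * (E1 ^ Suc a * E0 ^ b) - L * (X ^ ?n * Y ^ k) * (E1 ^ a * E0 ^ Suc b)"
            unfolding Xn power_add by (simp add: algebra_simps)
          then show ?thesis using diff[OF less[OF lt(1), of "Suc a" b] less[OF lt(2), of a "Suc b"]] by (simp only:)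
        qed
      qed
    next
      case False
      let ?k = "k - (q\<^sup>2 - q)"
      have q2: "q\<^sup>2 - q = (q - 1) * q" using q_ge2 by (simp add: power2_eq_square algebra_simps)
      have Yk: "Y ^ k = Y ^ ?k * (E1 - (\<Sum>l<q. vY ^ (q - Suc l) * vX ^ Suc l))"
        unfolding Y_power_reduce[symmetric] using False by (simp flip: power_add)
      have eq: "L * (X ^ n * Y ^ k) * (E1 ^ a * E0 ^ b) = L * (X ^ n * Y ^ ?k) * (E1 ^ Suc a * E0 ^ b)
         - (\<Sum>l<q. L * (X ^ (n + (q - 1) * Suc l) * Y ^ (?k + (q - 1) * (q - Suc l))) * (E1 ^ a * E0 ^ b))"
        unfolding Yk by (simp only: power_add power_mult) (simp add: right_diff_distrib left_diff_distrib sum_distrib_left sum_distrib_right mult_ac)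
      have lower: "P (L * (X ^ (n + (q - 1) * Suc l) * Y ^ (?k + (q - 1) * (q - Suc l))) * (E1 ^ a * E0 ^ b))" if "l < q" for l
      proof (rule IHk)
        have "(q - 1) * (q - Suc l) \<le> (q - 1) * (q - 1)" by (intro mult_le_mono2) simp
        also have "\<dots> < (q - 1) * q" using q_ge2 by simp
        finally show "?k + (q - 1) * (q - Suc l) < k" using False q2 by linarith
      qed
      have "P (L * (X ^ n * Y ^ ?k) * (E1 ^ Suc a * E0 ^ b))"
      proof (rule IHk)
        have "0 < (q - 1) * q" using q_ge2 by simp
        then show "?k < k" using False q2 by linarith
      qed
      then show ?thesis unfolding eq by (intro diff sum lower) (simp_all only: lessThan_iff)
    qed
  qed
qed

text \<open>
  The products $L X^nY^k Q_{2,1}^aQ_{2,0}^b$ of \<open>Delta2_monomials_span\<close> span the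
  $LX^iY^j$ of \<open>L_monomials_independent\<close> and by \<open>card_Delta2\<close> are not
  more numerous, hence independent. The case $n = k = 0$ is what is needed.
\<close>

lemma Delta2_independent:
  assumes m: "m \<ge> 2" and rel: "L * (\<Sum>(a, b)\<in>Delta2 q m. Const (c (a, b)) * (E1 ^ a * E0 ^ b)) \<in> truncation_ideal (q ^ m)"
    and ab: "(a, b) \<in> Delta2 q m"
  shows "c (a, b) = 0"
proof -
  let ?B = "{..<q\<^sup>2 - 1} \<times> {..<q\<^sup>2 - q}" and ?D = "Delta2 q m"
  let ?I = "?B \<times> ?D" and ?K = "{..<q ^ m - 1} \<times> {..<q ^ m - q}"
  define v where "v = (\<lambda>((n, k), (a, b)). L * (X ^ n * Y ^ k) * (E1 ^ a * E0 ^ b))"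
  define e where "e = (\<lambda>(i, j). L * (X ^ i * Y ^ j))"
  define g where "g = (\<lambda>((n :: nat, k :: nat), p). if n = 0 \<and> k = 0 then c p else 0)"
  have fin: "finite ?I" "finite ?K" using card_Delta2(1)[OF m] by auto
  have card: "card ?I \<le> card ?K"
    using card_Delta2(2)[OF m] unfolding card_cartesian_product card_lessThan by (simp only: mult.commute)
  let ?P = "\<lambda>f. \<exists>g. f - (\<Sum>i\<in>?I. Const (g i) * v i) \<in> truncation_ideal (q ^ m)"
  have span: "?P (e j)" for j
  proof -
    have "?P (L * (X ^ fst j * Y ^ snd j) * (E1 ^ 0 * E0 ^ 0))"
    proof (rule Delta2_monomials_span[OF m, where P = ?P])
      fix f g assume "?P f" "?P g"
      then obtain h k where "f - (\<Sum>i\<in>?I. Const (h i) * v i) \<in> truncation_ideal (q ^ m)"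
        "g - (\<Sum>i\<in>?I. Const (k i) * v i) \<in> truncation_ideal (q ^ m)" by blast
      then have "(f - (\<Sum>i\<in>?I. Const (h i) * v i)) + (g - (\<Sum>i\<in>?I. Const (k i) * v i)) \<in> truncation_ideal (q ^ m)"
        by (rule J_add)
      then have "f + g - (\<Sum>i\<in>?I. Const (h i + k i) * v i) \<in> truncation_ideal (q ^ m)"
        by (simp add: Const_add distrib_right sum.distrib algebra_simps)
      then show "?P (f + g)" by (rule exI[of _ "\<lambda>i. h i + k i"])
    next
      fix c f assume "?P f"
      then obtain h where "f - (\<Sum>i\<in>?I. Const (h i) * v i) \<in> truncation_ideal (q ^ m)" by blast
      then have "Const c * (f - (\<Sum>i\<in>?I. Const (h i) * v i)) \<in> truncation_ideal (q ^ m)" by (rule J_mult)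
      then have "Const c * f - (\<Sum>i\<in>?I. Const (c * h i) * v i) \<in> truncation_ideal (q ^ m)"
        by (simp add: Const_mult right_diff_distrib sum_distrib_left mult.assoc)
      then show "?P (Const c * f)" by (rule exI[of _ "\<lambda>i. c * h i"])
    next
      fix f :: "'a mpoly" assume "f \<in> truncation_ideal (q ^ m)"
      then show "?P f" by (intro exI[of _ "\<lambda>_. 0"]) simp
    next
      fix n k a b assume "n < q\<^sup>2 - 1" "k < q\<^sup>2 - q" "(a, b) \<in> Delta2 q m"
      then have mem: "((n, k), (a, b)) \<in> ?I" by simp
      have "(\<Sum>i\<in>?I. Const (if i = ((n, k), (a, b)) then 1 else 0) * v i) = (\<Sum>i\<in>?I. if i = ((n, k), (a, b)) then v ((n, k), (a, b)) else 0)"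
        by (rule sum.cong) auto
      also have "\<dots> = v ((n, k), (a, b))" using mem fin by (simp add: sum.delta')
      finally have "L * (X ^ n * Y ^ k) * (E1 ^ a * E0 ^ b) - (\<Sum>i\<in>?I. Const (if i = ((n, k), (a, b)) then 1 else 0) * v i) = 0"
        by (simp add: v_def)
      then show "?P (L * (X ^ n * Y ^ k) * (E1 ^ a * E0 ^ b))"
        by (intro exI[of _ "\<lambda>i. if i = ((n, k), (a, b)) then 1 else 0"]) (simp only: J_0)
    qed
    then show ?thesis by (simp add: e_def split_beta)
  qed
  have indep: "h j = 0" if "(\<Sum>j\<in>?K. Const (h j) * e j) \<in> truncation_ideal (q ^ m)" "j \<in> ?K" for h :: "nat \<times> nat \<Rightarrow> 'a" and j
    using L_monomials_independent[where h = h and m = m and i = "fst j" and j = "snd j"] that by (auto simp: e_def split_beta)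
  have "(\<Sum>i\<in>?I. Const (g i) * v i) = (\<Sum>x\<in>?B. \<Sum>p\<in>?D. Const (g (x, p)) * v (x, p))"
    by (simp add: sum.cartesian_product)
  also have "\<dots> = (\<Sum>x\<in>?B. if x = (0, 0) then \<Sum>p\<in>?D. Const (c p) * v ((0, 0), p) else 0)"
  proof (rule sum.cong[OF refl])
    fix x :: "nat \<times> nat"
    have "g (x, p) = (if x = (0, 0) then c p else 0)" for p by (cases x) (simp add: g_def)
    then show "(\<Sum>p\<in>?D. Const (g (x, p)) * v (x, p)) = (if x = (0, 0) then \<Sum>p\<in>?D. Const (c p) * v ((0, 0), p) else 0)"
      by simp
  qed
  also have "\<dots> = (\<Sum>p\<in>?D. Const (c p) * v ((0, 0), p))"
  proof -
    have "1 < q * q" "q < q * q" using q_ge2 by (simp_all add: less_1_mult)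
    then have "(0, 0) \<in> ?B" by (simp add: power2_eq_square)
    then show ?thesis by (simp only: sum.delta finite_cartesian_product finite_lessThan if_True)
  qed
  also have "\<dots> = L * (\<Sum>(a, b)\<in>?D. Const (c (a, b)) * (E1 ^ a * E0 ^ b))"
    by (simp add: v_def sum_distrib_left split_beta mult_ac)
  finally have rel': "(\<Sum>i\<in>?I. Const (g i) * v i) \<in> truncation_ideal (q ^ m)" using rel by simp
  have "1 < q * q" "q < q * q" using q_ge2 by (simp_all add: less_1_mult)
  then have mem: "((0, 0), (a, b)) \<in> ?I" using ab by (simp add: power2_eq_square)
  have "g ((0, 0), (a, b)) = 0"
  proof (rule spanning_independent[where g = g and v = v and e = e and I = ?I and K = ?K and N = "q ^ m"])
    show "h j = 0" if "(\<Sum>j\<in>?K. Const (h j) * e j) \<in> truncation_ideal (q ^ m)" "j \<in> ?K" for h j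
      using that by (rule indep)
  qed (rule fin(1) fin(2) card span rel' mem)+
  then show ?thesis by (simp add: g_def)
qed

section \<open>Linear independence of the six families\<close>

text \<open>
  The families are paired so that the extra family is the last value of an index: $\delta_3(1)$
  continues the powers of $Q_{3,2}$ to $i = [m-2]_q$, and so on. The elements of one pair have
  equally spaced degrees in $Z$.
\<close>

definition fam12 :: "nat \<Rightarrow> (nat \<times> nat) \<times> nat \<Rightarrow> index" where
  "fam12 m = (\<lambda>((a, b), i). if i < qint q (m - 2) then Fam1 a b i else Fam2 a b)"
definition fam34 :: "nat \<Rightarrow> nat \<times> nat \<Rightarrow> index" where
  "fam34 m = (\<lambda>(i1, i). if i < qint q (m - 1) then Fam3 i1 i else Fam4 i1)"
definition fam56 :: "nat \<Rightarrow> nat \<Rightarrow> index" where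
  "fam56 m i = (if i < qint q m then Fam5 i else Fam6)"

definition I12 where "I12 m = Delta2 q m \<times> {..qint q (m - 2)}"
definition I34 where "I34 m = {..<qint q m} \<times> {..qint q (m - 1)}"
definition I56 where "I56 m = {..qint q m}"

lemma indices_iff:
  "Fam1 a b i \<in> indices q m \<longleftrightarrow> (a, b) \<in> Delta2 q m \<and> i < qint q (m - 2)"
  "Fam2 a b \<in> indices q m \<longleftrightarrow> (a, b) \<in> Delta2 q m"
  "Fam3 i1 i \<in> indices q m \<longleftrightarrow> i1 < qint q m \<and> i < qint q (m - 1)"
  "Fam4 i1 \<in> indices q m \<longleftrightarrow> i1 < qint q m"
  "Fam5 i \<in> indices q m \<longleftrightarrow> i < qint q m"
  "Fam6 \<in> indices q m"
  unfolding indices_def by blast+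

lemma indices_eq: "indices q m = fam12 m ` I12 m \<union> fam34 m ` I34 m \<union> fam56 m ` I56 m"
proof
  show "indices q m \<subseteq> fam12 m ` I12 m \<union> fam34 m ` I34 m \<union> fam56 m ` I56 m"
  proof
    fix k assume "k \<in> indices q m"
    then show "k \<in> fam12 m ` I12 m \<union> fam34 m ` I34 m \<union> fam56 m ` I56 m"
      unfolding indices_def
    proof (elim UnE CollectE exE conjE singletonE)
      fix i1 i2 i assume "k = Fam1 i1 i2 i" "(i1, i2) \<in> Delta2 q m" "i < qint q (m - 2)"
      then have "k = fam12 m ((i1, i2), i)" "((i1, i2), i) \<in> I12 m" by (auto simp: fam12_def I12_def)
      then show ?thesis by blast
    next
      fix i1 i2 assume "k = Fam2 i1 i2" "(i1, i2) \<in> Delta2 q m"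
      then have "k = fam12 m ((i1, i2), qint q (m - 2))" "((i1, i2), qint q (m - 2)) \<in> I12 m" by (auto simp: fam12_def I12_def)
      then show ?thesis by blast
    next
      fix i1 i assume "k = Fam3 i1 i" "i1 < qint q m" "i < qint q (m - 1)"
      then have "k = fam34 m (i1, i)" "(i1, i) \<in> I34 m" by (auto simp: fam34_def I34_def)
      then show ?thesis by blast
    next
      fix i1 assume "k = Fam4 i1" "i1 < qint q m"
      then have "k = fam34 m (i1, qint q (m - 1))" "(i1, qint q (m - 1)) \<in> I34 m" by (auto simp: fam34_def I34_def)
      then show ?thesis by blast
    next
      fix i assume "k = Fam5 i" "i < qint q m"
      then have "k = fam56 m i" "i \<in> I56 m" by (auto simp: fam56_def I56_def)
      then show ?thesis by blast
    next
      assume "k = Fam6"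
      then have "k = fam56 m (qint q m)" "qint q m \<in> I56 m" by (auto simp: fam56_def I56_def)
      then show ?thesis by blast
    qed
  qed
next
  have "fam12 m x \<in> indices q m" if "x \<in> I12 m" for x
    using that by (cases x) (auto simp: fam12_def I12_def indices_iff)
  moreover have "fam34 m x \<in> indices q m" if "x \<in> I34 m" for x
    using that by (cases x) (auto simp: fam34_def I34_def indices_iff)
  moreover have "fam56 m x \<in> indices q m" for x
    by (auto simp: fam56_def indices_iff)
  ultimately show "fam12 m ` I12 m \<union> fam34 m ` I34 m \<union> fam56 m ` I56 m \<subseteq> indices q m"
    by blast
qed

lemma inj_fam: "inj_on (fam12 m) (I12 m)" "inj_on (fam34 m) (I34 m)" "inj_on (fam56 m) (I56 m)"
  by (auto simp: inj_on_def fam12_def fam34_def fam56_def I12_def I34_def I56_def split: if_splits)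

lemma sum_indices:
  assumes m: "m \<ge> 2"
  shows "(\<Sum>k\<in>indices q m. f k) = (\<Sum>x\<in>I12 m. f (fam12 m x)) + (\<Sum>x\<in>I34 m. f (fam34 m x)) + (\<Sum>x\<in>I56 m. f (fam56 m x))"
proof -
  have fin: "finite (I12 m)" "finite (I34 m)" "finite (I56 m)"
    using card_Delta2(1)[OF m] by (auto simp: I12_def I34_def I56_def)
  have disj: "fam12 m ` I12 m \<inter> fam34 m ` I34 m = {}" "(fam12 m ` I12 m \<union> fam34 m ` I34 m) \<inter> fam56 m ` I56 m = {}"
    by (auto simp: fam12_def fam34_def fam56_def split: if_splits)
  have "(\<Sum>k\<in>indices q m. f k) = sum f (fam12 m ` I12 m) + sum f (fam34 m ` I34 m) + sum f (fam56 m ` I56 m)"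
    unfolding indices_eq using fin disj by (simp add: sum.union_disjoint)
  then show ?thesis by (simp add: sum.reindex[OF inj_fam(1)] sum.reindex[OF inj_fam(2)] sum.reindex[OF inj_fam(3)])
qed

lemma finite_indices: "m \<ge> 2 \<Longrightarrow> finite (indices q m)"
  using card_Delta2(1)[of m] by (simp add: indices_eq I12_def I34_def I56_def)

lemma degZ_le_V2: "degZ_le 0 VY" "degZ_le 0 E1" "degZ_le 0 E0" "degZ_le 0 L" "degZ_le 0 (alpha n X Y)"
proof -
  show V: "degZ_le 0 VY" unfolding V2_def by (intro degZ_le_diff degZ_le_0_mult degZ_le_0_power degZ_le_XY)
  show "degZ_le 0 E1" unfolding D1_def by (intro degZ_le_add degZ_le_0_power V degZ_le_XY)
  show "degZ_le 0 E0" unfolding D0_def by (intro degZ_le_0_mult degZ_le_0_power V degZ_le_XY)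
  show "degZ_le 0 L" unfolding L2_def by (intro degZ_le_diff degZ_le_0_mult degZ_le_0_power degZ_le_XY)
  show "degZ_le 0 (alpha n X Y)" unfolding alpha_def by (intro degZ_le_sum degZ_le_0_mult degZ_le_0_power degZ_le_XY)
qed

lemma q_less_q2: "q < q\<^sup>2" "1 < q\<^sup>2" using q_ge2 by (simp_all add: power2_eq_square less_1_mult)

lemma monicZ_VV: "monicZ (q\<^sup>2) VV"
proof -
  have "degZ_le q (E0 * Z - E1 * Z ^ q)"
    using q_ge2 degZ_le_mono[OF degZ_le_Z_power[of 1], of q]
    by (intro degZ_le_diff degZ_le_0_mult degZ_le_V2 degZ_le_Z_power) simp
  then have "degZ_less (q\<^sup>2) (E0 * Z - E1 * Z ^ q)" using q_less_q2 by (intro degZ_less_if_le) auto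
  then have "monicZ (q\<^sup>2) (Z ^ (q\<^sup>2) + (E0 * Z - E1 * Z ^ q))" by (rule monicZ_add_lower[OF monicZ_Z])
  then show ?thesis by (simp add: V3_def algebra_simps)
qed

lemma monicZ_E32: "monicZ ((q - 1) * q\<^sup>2) E32"
proof (rule monicZ_add_lower[OF monicZ_power[OF monicZ_VV]])
  show "degZ_less ((q - 1) * q\<^sup>2) (E1 ^ q)"
    using q_ge2 by (intro degZ_less_if_le[OF degZ_le_0_power[OF degZ_le_V2(2)]]) simp
qed

lemma monicZ_delta3_poly:
  assumes "m \<ge> 2"
  shows "monicZ ((q ^ (m - 2) - 1) * q\<^sup>2) (delta3_poly m)"
proof -
  obtain n where m: "m = Suc (Suc n)" using assms by (metis add_2_eq_Suc le_Suc_ex)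
  have "delta3_poly m = VV ^ (q ^ n - 1) + (\<Sum>j<n. alpha (Suc n - j) X Y ^ (q ^ Suc j) * VV ^ (q ^ j - 1))"
    by (simp add: delta3_poly_def m alpha_1 add.commute)
  moreover have "monicZ ((q ^ n - 1) * q\<^sup>2) (VV ^ (q ^ n - 1) + (\<Sum>j<n. alpha (Suc n - j) X Y ^ (q ^ Suc j) * VV ^ (q ^ j - 1)))"
  proof (rule monicZ_add_lower[OF monicZ_power[OF monicZ_VV]])
    show "degZ_less ((q ^ n - 1) * q\<^sup>2) (\<Sum>j<n. alpha (Suc n - j) X Y ^ (q ^ Suc j) * VV ^ (q ^ j - 1))"
    proof (cases n)
      case 0 then show ?thesis by (simp add: degZ_less_def)
    next
      case (Suc k)
      have "degZ_le ((q ^ k - 1) * q\<^sup>2) (\<Sum>j<n. alpha (Suc n - j) X Y ^ (q ^ Suc j) * VV ^ (q ^ j - 1))"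
      proof (rule degZ_le_sum)
        fix j assume "j \<in> {..<n}"
        then have "q ^ j \<le> q ^ k" using q_ge2 Suc by (intro power_increasing) auto
        then have "(q ^ j - 1) * q\<^sup>2 \<le> (q ^ k - 1) * q\<^sup>2" by (intro mult_le_mono1) simp
        then show "degZ_le ((q ^ k - 1) * q\<^sup>2) (alpha (Suc n - j) X Y ^ (q ^ Suc j) * VV ^ (q ^ j - 1))"
          by (intro degZ_le_0_mult degZ_le_0_power degZ_le_V2 degZ_le_mono[OF degZ_le_power[OF monicZ_imp_le[OF monicZ_VV]]])
      qed
      moreover have "(q ^ k - 1) * q\<^sup>2 < (q ^ n - 1) * q\<^sup>2"
      proof -
        have "q ^ k < q ^ n" "0 < q ^ k" using q_ge2 Suc by (auto intro: power_strict_increasing)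
        then have "q ^ k - 1 < q ^ n - 1" by linarith
        then show ?thesis using q_ge2 by simp
      qed
      ultimately show ?thesis by (rule degZ_less_if_le)
    qed
  qed
  ultimately show ?thesis by (simp add: m)
qed

text \<open>
  The factors that contain $Z$ in families 1 and 2. Their degrees are $(q-1)q^2i$ for all $i \le
  [m-2]_q$.
\<close>

definition Z_factor_12 :: "nat \<Rightarrow> nat \<Rightarrow> 'a mpoly" where
  "Z_factor_12 m i = (if i < qint q (m - 2) then E32 ^ i else delta3_poly m)"

lemma basis_poly_fam12:
  assumes "m \<ge> 1"
  shows "basis_poly m (fam12 m ((a, b), i)) = E1 ^ a * E0 ^ b * Z_factor_12 m i"
  by (simp add: fam12_def Z_factor_12_def basis_poly_1 basis_poly_2[OF assms])

lemma monicZ_Z_factor_12: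
  assumes "m \<ge> 2" "i \<le> qint q (m - 2)"
  shows "monicZ ((q - 1) * q\<^sup>2 * i) (Z_factor_12 m i)"
proof (cases "i < qint q (m - 2)")
  case True
  then show ?thesis using monicZ_power[OF monicZ_E32, of i] by (simp add: Z_factor_12_def mult_ac)
next
  case False
  then have "i = qint q (m - 2)" using assms by simp
  moreover have "q ^ (m - 2) - 1 = (q - 1) * qint q (m - 2)" using qint_eq[OF q_ge2, of "m - 2"] by simp
  ultimately show ?thesis using monicZ_delta3_poly[OF assms(1)] by (simp add: Z_factor_12_def mult_ac)
qed

text \<open>
  The factors that contain $Z$ in families 3 and 4, up to the term with $X^{N-1}$. Their degrees
  are $(q-1)qi$ for all $i \le [m-1]_q$.
\<close>

definition Z_factor_34 :: "nat \<Rightarrow> nat \<Rightarrow> 'a mpoly" where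
  "Z_factor_34 m i = (if i < qint q (m - 1) then D1 X Z ^ i else alpha m X Z)"

lemma monicZ_alpha:
  assumes "n \<ge> 1" shows "monicZ ((q - 1) * (qint q n - 1)) (alpha n X Z)"
proof -
  obtain k where k: "qint q n = Suc k" using qint_mono[OF q_ge2 assms] qint_1[OF q_ge2] by (cases "qint q n") (auto simp: One_nat_def)
  have "alpha n X Z = Z ^ ((q - 1) * k) + (\<Sum>j<k. vZ ^ (k - Suc j) * vX ^ Suc j)"
    unfolding alpha_def k sum.lessThan_Suc_shift by (simp add: power_mult)
  moreover have "degZ_less ((q - 1) * k) (\<Sum>j<k. vZ ^ (k - Suc j) * vX ^ Suc j)"
  proof (cases k)
    case 0 then show ?thesis by (simp add: degZ_less_def)
  next
    case (Suc l)
    have "degZ_le ((q - 1) * l) (\<Sum>j<k. vZ ^ (k - Suc j) * vX ^ Suc j)"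
    proof (rule degZ_le_sum)
      fix j
      have "degZ_le ((q - 1) * (k - Suc j)) (vX ^ Suc j * vZ ^ (k - Suc j))"
        unfolding power_mult[symmetric] by (intro degZ_le_0_mult degZ_le_Z_power degZ_le_0_power degZ_le_XY)
      moreover have "(q - 1) * (k - Suc j) \<le> (q - 1) * l" using Suc by (intro mult_le_mono2) simp
      ultimately show "degZ_le ((q - 1) * l) (vZ ^ (k - Suc j) * vX ^ Suc j)"
        unfolding mult.commute[of "vZ ^ (k - Suc j)"] by (rule degZ_le_mono)
    qed
    then show ?thesis using q_ge2 Suc by (intro degZ_less_if_le) auto
  qed
  ultimately have "monicZ ((q - 1) * k) (alpha n X Z)" using monicZ_add_lower[OF monicZ_Z] by simp
  then show ?thesis by (simp add: k)
qed

lemma monicZ_Z_factor_34: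
  assumes "m \<ge> 1" "i \<le> qint q (m - 1)"
  shows "monicZ ((q - 1) * q * i) (Z_factor_34 m i)"
proof (cases "i < qint q (m - 1)")
  case True
  have "monicZ (i * ((q - 1) * q)) (D1 X Z ^ i)"
    using monicZ_alpha[of 2] by (intro monicZ_power) (simp add: D1_eq_alpha qint_2[OF q_ge2])
  then show ?thesis using True by (simp add: Z_factor_34_def mult_ac)
next
  case False
  then have i: "i = qint q (m - 1)" using assms by simp
  have "qint q m = Suc (q * qint q (m - 1))" using qint_Suc(2)[OF q_ge2, of "m - 1"] assms by simp
  then show ?thesis using monicZ_alpha[OF assms(1)] False by (simp add: Z_factor_34_def i mult_ac)
qed

text \<open>
  $L \delta_2(f)$ is the numerator of $\delta_2(f)$, both terms of which contain $X^N$ or $Y^N$.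
  In families 5 and 6 the factor $X^{N-1}$ meets the factor $X$ of $L$.
\<close>

lemma L_annihilates:
  assumes "m \<ge> 1"
  shows "L * basis_poly m (fam34 m x) \<in> truncation_ideal (q ^ m)"
    "L * basis_poly m (fam56 m i) \<in> truncation_ideal (q ^ m)"
proof -
  show "L * basis_poly m (fam34 m x) \<in> truncation_ideal (q ^ m)"
  proof (cases "snd x < qint q (m - 1)")
    case True
    have "L * basis_poly m (Fam3 (fst x) (snd x)) \<in> truncation_ideal (q ^ m)"
      by (rule delta2_poly_props(2)[OF basis_fun_3[OF True]])
    then show ?thesis using True by (simp add: fam34_def split_beta)
  next
    case False
    have "L * basis_poly m (Fam4 (fst x)) \<in> truncation_ideal (q ^ m)"
      by (rule delta2_poly_props(2)[OF basis_fun_4])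
    then show ?thesis using False by (simp add: fam34_def split_beta)
  qed
next
  have "L * (X ^ (q ^ m - 1) * Y ^ (q ^ m - 1) * Z ^ k) \<in> truncation_ideal (q ^ m)" for k
  proof -
    have "L * (X ^ (q ^ m - 1) * Y ^ (q ^ m - 1) * Z ^ k)
       = X ^ Suc (q ^ m - 1) * ((vY - vX) * Y * Y ^ (q ^ m - 1) * Z ^ k)"
      by (simp add: L2_eq mult_ac)
    also have "\<dots> \<in> truncation_ideal (q ^ m)" by (intro J_mult_right J_Var) auto
    finally show ?thesis .
  qed
  note * = this
  show "L * basis_poly m (fam56 m i) \<in> truncation_ideal (q ^ m)"
    using *[of "(q - 1) * i"] *[of "q ^ m - 1"] unfolding power_mult
    by (simp add: fam56_def basis_poly_5 basis_poly_6)
qed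

lemma N_bounds:
  assumes "m \<ge> 2"
  shows "(q - 1) * q\<^sup>2 * qint q (m - 2) < q ^ m" "(q - 1) * q * qint q (m - 1) < q ^ m" "(q - 1) * qint q m < q ^ m"
proof -
  obtain n where m: "m = Suc (Suc n)" using assms by (metis add_2_eq_Suc le_Suc_ex)
  have "(q - 1) * qint q k < q ^ k" for k using qint_eq[OF q_ge2, of k] by linarith
  then have *: "c * ((q - 1) * qint q k) < c * q ^ k" if "c > 0" for c k using that by simp
  show "(q - 1) * q\<^sup>2 * qint q (m - 2) < q ^ m" using *[of "q\<^sup>2" n] q_ge2 by (simp add: m power2_eq_square mult_ac)
  show "(q - 1) * q * qint q (m - 1) < q ^ m" using *[of q "Suc n"] q_ge2 by (simp add: m mult_ac)
  show "(q - 1) * qint q m < q ^ m" using *[of 1 m] by simp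
qed

text \<open>
  The coefficient of the $i$-th $Z$-factor is $L$ times a combination of Dickson monomials.
\<close>

lemma fam12_independent:
  assumes m: "m \<ge> 2"
    and rel: "(\<Sum>x\<in>I12 m. Const (c x) * (L * basis_poly m (fam12 m x))) \<in> truncation_ideal (q ^ m)"
    and ab: "(a, b) \<in> Delta2 q m" "i \<le> qint q (m - 2)"
  shows "c ((a, b), i) = 0"
proof -
  define B where "B i = L * (\<Sum>(a, b)\<in>Delta2 q m. Const (c ((a, b), i)) * (E1 ^ a * E0 ^ b))" for i
  have "(\<Sum>x\<in>I12 m. Const (c x) * (L * basis_poly m (fam12 m x)))
    = (\<Sum>p\<in>Delta2 q m. \<Sum>i\<le>qint q (m - 2). Const (c (p, i)) * (L * basis_poly m (fam12 m (p, i))))"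
    unfolding I12_def by (simp add: sum.cartesian_product)
  also have "\<dots> = (\<Sum>i\<le>qint q (m - 2). \<Sum>p\<in>Delta2 q m. Const (c (p, i)) * (L * basis_poly m (fam12 m (p, i))))"
    by (rule sum.swap)
  also have "\<dots> = (\<Sum>i\<le>qint q (m - 2). B i * Z_factor_12 m i)"
  proof (rule sum.cong[OF refl])
    fix i
    have "B i * Z_factor_12 m i = (\<Sum>p\<in>Delta2 q m. L * (case p of (a, b) \<Rightarrow> Const (c ((a, b), i)) * (E1 ^ a * E0 ^ b)) * Z_factor_12 m i)"
      unfolding B_def by (simp only: sum_distrib_left sum_distrib_right)
    also have "\<dots> = (\<Sum>p\<in>Delta2 q m. Const (c (p, i)) * (L * basis_poly m (fam12 m (p, i))))"
      using m by (intro sum.cong refl) (auto simp: basis_poly_fam12 mult_ac)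
    finally show "(\<Sum>p\<in>Delta2 q m. Const (c (p, i)) * (L * basis_poly m (fam12 m (p, i)))) = B i * Z_factor_12 m i" ..
  qed
  finally have "(\<Sum>i\<le>qint q (m - 2). B i * Z_factor_12 m i) \<in> truncation_ideal (q ^ m)" using rel by simp
  then have "B i \<in> truncation_ideal (q ^ m)"
  proof (rule extract_coefficients[where d = "(q - 1) * q\<^sup>2", rotated 4])
    show "monicZ ((q - 1) * q\<^sup>2 * i) (Z_factor_12 m i)" if "i \<le> qint q (m - 2)" for i by (rule monicZ_Z_factor_12[OF m that])
    show "degZ_le 0 (B i)" for i
      unfolding B_def split_beta
      by (intro degZ_le_0_mult degZ_le_V2 degZ_le_sum degZ_le_Const degZ_le_0_power)
    show "(q - 1) * q\<^sup>2 > 0" using q_ge2 by simp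
  qed (use ab N_bounds[OF m] in auto)
  then show ?thesis
    unfolding B_def using Delta2_independent[OF m, of "\<lambda>p. c (p, i)"] ab by blast
qed

text \<open>
  Multiplication by $X$ removes the term $X^{N-1}h$ from $\delta_2(f) = \alpha_m f - X^{N-1}h$.
  The coefficient of the $i$-th $Z$-factor is then $X \alpha_m \sum_{i_1} c_{i_1,i} X^{(q-1)i_1}$,
  and $\alpha_m$ is monic in $Y$ of degree $N - q$.
\<close>

lemma fam34_independent:
  assumes m: "m \<ge> 2"
    and rel: "(\<Sum>x\<in>I34 m. Const (c x) * (X * basis_poly m (fam34 m x))) \<in> truncation_ideal (q ^ m)"
    and i: "i1 < qint q m" "i \<le> qint q (m - 1)"
  shows "c (i1, i) = 0"
proof -
  let ?J = "truncation_ideal (q ^ m) :: 'a mpoly set"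
  define A where "A i = (\<Sum>i1<qint q m. Const (c (i1, i)) * vX ^ i1)" for i
  define B where "B i = X * alpha m X Y * A i" for i
  have diff: "X * basis_poly m (fam34 m x) - X * alpha m X Y * (vX ^ fst x * Z_factor_34 m (snd x)) \<in> ?J" if "x \<in> I34 m" for x
  proof -
    have "\<exists>h. basis_poly m (fam34 m x) = alpha m X Y * delta2_arg m (fst x) (snd x) - X ^ (q ^ m - 1) * h"
    proof (cases "snd x < qint q (m - 1)")
      case True
      have "\<exists>h. basis_poly m (Fam3 (fst x) (snd x)) = alpha m X Y * delta2_arg m (fst x) (snd x) - X ^ (q ^ m - 1) * h"
        by (rule delta2_poly_props(3)[OF basis_fun_3[OF True]])
      then show ?thesis using True by (simp add: fam34_def split_beta)
    next
      case False
      then have "snd x = qint q (m - 1)" using that by (auto simp: I34_def)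
      moreover have "\<exists>h. basis_poly m (Fam4 (fst x)) = alpha m X Y * delta2_arg m (fst x) (qint q (m - 1)) - X ^ (q ^ m - 1) * h"
        by (rule delta2_poly_props(3)[OF basis_fun_4])
      ultimately show ?thesis by (simp add: fam34_def split_beta)
    qed
    then obtain h where h: "basis_poly m (fam34 m x) = alpha m X Y * delta2_arg m (fst x) (snd x) - X ^ (q ^ m - 1) * h" ..
    have arg: "delta2_arg m (fst x) (snd x) = vX ^ fst x * Z_factor_34 m (snd x)"
      by (simp add: delta2_arg_def Z_factor_34_def)
    have "X * basis_poly m (fam34 m x) - X * alpha m X Y * (vX ^ fst x * Z_factor_34 m (snd x)) = - (X ^ Suc (q ^ m - 1) * h)"
      unfolding h arg by (simp add: algebra_simps)
    also have "\<dots> \<in> ?J" by (intro J_uminus J_mult_right J_Var) auto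
    finally show ?thesis .
  qed
  have "(\<Sum>x\<in>I34 m. Const (c x) * (X * basis_poly m (fam34 m x))) -
     (\<Sum>x\<in>I34 m. Const (c x) * (X * basis_poly m (fam34 m x) - X * alpha m X Y * (vX ^ fst x * Z_factor_34 m (snd x)))) \<in> ?J"
    by (intro J_diff[OF rel] J_sum J_mult[OF diff])
  also have "(\<Sum>x\<in>I34 m. Const (c x) * (X * basis_poly m (fam34 m x))) -
     (\<Sum>x\<in>I34 m. Const (c x) * (X * basis_poly m (fam34 m x) - X * alpha m X Y * (vX ^ fst x * Z_factor_34 m (snd x))))
     = (\<Sum>x\<in>I34 m. Const (c x) * (X * alpha m X Y * (vX ^ fst x * Z_factor_34 m (snd x))))"
    unfolding sum_subtractf[symmetric] right_diff_distrib[symmetric] by simp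
  also have "\<dots> = (\<Sum>i1<qint q m. \<Sum>i\<le>qint q (m - 1). Const (c (i1, i)) * (X * alpha m X Y * (vX ^ i1 * Z_factor_34 m i)))"
    unfolding I34_def by (simp add: sum.cartesian_product split_beta)
  also have "\<dots> = (\<Sum>i\<le>qint q (m - 1). \<Sum>i1<qint q m. Const (c (i1, i)) * (X * alpha m X Y * (vX ^ i1 * Z_factor_34 m i)))"
    by (rule sum.swap)
  also have "\<dots> = (\<Sum>i\<le>qint q (m - 1). B i * Z_factor_34 m i)"
    unfolding B_def A_def sum_distrib_left sum_distrib_right by (intro sum.cong refl) (simp only: mult_ac)
  finally have "(\<Sum>i\<le>qint q (m - 1). B i * Z_factor_34 m i) \<in> ?J" .
  then have "B i \<in> ?J"
  proof (rule extract_coefficients[where d = "(q - 1) * q", rotated 4])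
    show "monicZ ((q - 1) * q * i) (Z_factor_34 m i)" if "i \<le> qint q (m - 1)" for i using m by (intro monicZ_Z_factor_34 that) simp
    show "degZ_le 0 (B i)" for i
      unfolding B_def A_def
      by (intro degZ_le_0_mult degZ_le_V2 degZ_le_sum degZ_le_Const degZ_le_0_power degZ_le_XY)
    show "(q - 1) * q > 0" using q_ge2 by simp
  qed (use i N_bounds[OF m] in auto)
  moreover obtain K where K: "qint q m = Suc K" using i by (cases "qint q m") auto
  have "(q - 1) * Suc K < q ^ m" using N_bounds(3)[OF m] by (simp add: K)
  then have lt: "1 + (q - 1) * i1 < q ^ m" "(q - 1) * K < q ^ m"
  proof -
    have "(q - 1) * Suc i1 \<le> (q - 1) * Suc K" using i(1) by (intro mult_le_mono2) (simp add: K)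
    then have "(q - 1) * Suc i1 < q ^ m" using \<open>(q - 1) * Suc K < q ^ m\<close> by (rule le_less_trans)
    then have "(q - 1) * i1 + (q - 1) < q ^ m" by (simp add: add.commute)
    then show "1 + (q - 1) * i1 < q ^ m" using q_ge2 by linarith
    show "(q - 1) * K < q ^ m" using \<open>(q - 1) * Suc K < q ^ m\<close> by simp
  qed
  ultimately have "Poly_Mapping.lookup (B i) (Poly_Mapping.single 0 (1 + (q - 1) * i1) + Poly_Mapping.single 1 ((q - 1) * K)) = 0"
    using lt by (intro J_lookup_XY) auto
  moreover have "B i = (\<Sum>k<Suc K. \<Sum>j<Suc K. Const (c (j, i)) * (X ^ (1 + (q - 1) * (j + k)) * Y ^ ((q - 1) * (K - k))))"
  proof -
    have "B i = X * (\<Sum>k<Suc K. vY ^ (K - k) * vX ^ k) * (\<Sum>j<Suc K. Const (c (j, i)) * vX ^ j)"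
      unfolding B_def A_def alpha_def K by simp
    also have "\<dots> = (\<Sum>k<Suc K. \<Sum>j<Suc K. X * (vY ^ (K - k) * vX ^ k) * (Const (c (j, i)) * vX ^ j))"
      by (simp only: sum_distrib_left sum_distrib_right mult.assoc) (rule sum.swap)
    also have "\<dots> = (\<Sum>k<Suc K. \<Sum>j<Suc K. Const (c (j, i)) * (X ^ (1 + (q - 1) * (j + k)) * Y ^ ((q - 1) * (K - k))))"
      unfolding add_mult_distrib2 power_add power_mult power_one_right by (intro sum.cong refl) (simp only: mult_ac)
    finally show ?thesis .
  qed
  ultimately have "0 = (\<Sum>k<Suc K. \<Sum>j<Suc K. c (j, i) * (if 1 + (q - 1) * (j + k) = 1 + (q - 1) * i1 \<and> (q - 1) * (K - k) = (q - 1) * K then 1 else 0))"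
    by (simp only: lookup_sum lookup_Const_mult lookup_XY)
  also have "\<dots> = (\<Sum>k<Suc K. if k = 0 then (\<Sum>j<Suc K. if j = i1 then c (i1, i) else 0) else 0)"
  proof (intro sum.cong refl)
    fix k assume k: "k \<in> {..<Suc K}"
    have inner: "c (j, i) * (if 1 + (q - 1) * (j + k) = 1 + (q - 1) * i1 \<and> (q - 1) * (K - k) = (q - 1) * K then 1 else 0)
      = (if k = 0 then (if j = i1 then c (i1, i) else 0) else 0)" for j
    proof -
      have "1 + (q - 1) * (j + k) = 1 + (q - 1) * i1 \<longleftrightarrow> j + k = i1" "(q - 1) * (K - k) = (q - 1) * K \<longleftrightarrow> K - k = K"
        using q_ge2 by auto
      moreover have "K - k = K \<longleftrightarrow> k = 0 \<or> K = 0" by auto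
      ultimately show ?thesis using k by (cases "k = 0") auto
    qed
    show "(\<Sum>j<Suc K. c (j, i) * (if 1 + (q - 1) * (j + k) = 1 + (q - 1) * i1 \<and> (q - 1) * (K - k) = (q - 1) * K then 1 else 0))
       = (if k = 0 then (\<Sum>j<Suc K. if j = i1 then c (i1, i) else 0) else 0)"
      unfolding inner by (cases "k = 0") (simp_all only: simp_thms if_True if_False sum.neutral_const)
  qed
  also have "\<dots> = c (i1, i)" using i(1) by (simp add: K sum.delta del: sum.lessThan_Suc)
  finally show ?thesis by simp
qed

lemma fam56_independent:
  assumes m: "m \<ge> 2"
    and rel: "(\<Sum>i\<in>I56 m. Const (c i) * basis_poly m (fam56 m i)) \<in> truncation_ideal (q ^ m)"
    and i: "i \<le> qint q m"
  shows "c i = 0"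
proof -
  define B where "B i = Const (c i) * (X ^ (q ^ m - 1) * Y ^ (q ^ m - 1))" for i
  have "(\<Sum>i\<in>I56 m. Const (c i) * basis_poly m (fam56 m i)) = (\<Sum>i\<le>qint q m. B i * Z ^ ((q - 1) * i))"
    unfolding I56_def
  proof (rule sum.cong[OF refl])
    fix i assume "i \<in> {..qint q m}"
    then have "\<not> i < qint q m \<Longrightarrow> q ^ m - 1 = (q - 1) * i" using qint_eq[OF q_ge2, of m] by simp
    then show "Const (c i) * basis_poly m (fam56 m i) = B i * Z ^ ((q - 1) * i)"
      by (simp add: fam56_def basis_poly_5 basis_poly_6 B_def power_mult mult.assoc)
  qed
  then have "(\<Sum>i\<le>qint q m. B i * Z ^ ((q - 1) * i)) \<in> truncation_ideal (q ^ m)" using rel by simp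
  then have "B i \<in> truncation_ideal (q ^ m)"
  proof (rule extract_coefficients[where d = "q - 1", rotated 4])
    show "degZ_le 0 (B i)" for i
      unfolding B_def by (intro degZ_le_0_mult degZ_le_Const degZ_le_0_power degZ_le_XY)
    show "q - 1 > 0" using q_ge2 by simp
  qed (use i N_bounds[OF m] in \<open>auto intro: monicZ_Z\<close>)
  then have "Poly_Mapping.lookup (B i) (Poly_Mapping.single 0 (q ^ m - 1) + Poly_Mapping.single 1 (q ^ m - 1)) = 0"
    using q_ge2 by (intro J_lookup_XY) auto
  then show ?thesis by (simp add: B_def lookup_Const_mult lookup_XY)
qed

text \<open>
  Multiplying by $L$ isolates families 1 and 2; once their coefficients are known to vanish,
  multiplying by $X$ isolates families 3 and 4.
\<close>

lemma basis_poly_independent: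
  assumes m: "m \<ge> 2"
    and rel: "(\<Sum>k\<in>indices q m. Const (c k) * basis_poly m k) \<in> truncation_ideal (q ^ m)"
    and k: "k \<in> indices q m"
  shows "c k = 0"
proof -
  let ?J = "truncation_ideal (q ^ m) :: 'a mpoly set"
  let ?s = "\<lambda>fam I g. \<Sum>x\<in>I. Const (c (fam x)) * (g * basis_poly m (fam x))"
  have split: "g * (\<Sum>k\<in>indices q m. Const (c k) * basis_poly m k)
    = ?s (fam12 m) (I12 m) g + ?s (fam34 m) (I34 m) g + ?s (fam56 m) (I56 m) g" for g
    unfolding sum_indices[OF m] distrib_left sum_distrib_left by (simp only: mult.left_commute)
  have "?s (fam12 m) (I12 m) L = L * (\<Sum>k\<in>indices q m. Const (c k) * basis_poly m k) - (?s (fam34 m) (I34 m) L + ?s (fam56 m) (I56 m) L)"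
    unfolding split by simp
  also have "\<dots> \<in> ?J"
    using m by (intro J_diff J_add J_sum J_mult[OF L_annihilates(1)] J_mult[OF L_annihilates(2)] J_mult[OF rel]) auto
  finally have *: "?s (fam12 m) (I12 m) L \<in> ?J" .
  have "c (fam12 m x) = 0" if "x \<in> I12 m" for x
    using fam12_independent[OF m *, of "fst (fst x)" "snd (fst x)" "snd x"] that by (auto simp: I12_def)
  then have c12: "?s (fam12 m) (I12 m) g = 0" for g by simp
  have "X * basis_poly m (fam56 m i) \<in> ?J" for i
  proof -
    have "X * (X ^ (q ^ m - 1) * Y ^ (q ^ m - 1) * Z ^ k) = X ^ Suc (q ^ m - 1) * (Y ^ (q ^ m - 1) * Z ^ k)" for k
      by (simp add: mult_ac)
    moreover have "X ^ Suc (q ^ m - 1) * (Y ^ (q ^ m - 1) * Z ^ k) \<in> ?J" for k by (intro J_mult_right J_Var) auto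
    ultimately have "X * (X ^ (q ^ m - 1) * Y ^ (q ^ m - 1) * Z ^ k) \<in> ?J" for k by (simp only:)
    from this[of "(q - 1) * i"] this[of "q ^ m - 1"] show ?thesis
      unfolding power_mult by (simp add: fam56_def basis_poly_5 basis_poly_6)
  qed
  note X56 = this
  have "?s (fam34 m) (I34 m) X = X * (\<Sum>k\<in>indices q m. Const (c k) * basis_poly m k) - ?s (fam56 m) (I56 m) X"
    unfolding split c12 by simp
  also have "\<dots> \<in> ?J" by (intro J_diff J_sum J_mult[OF X56] J_mult[OF rel])
  finally have *: "?s (fam34 m) (I34 m) X \<in> ?J" .
  have "c (fam34 m x) = 0" if "x \<in> I34 m" for x
    using fam34_independent[OF m *, of "fst x" "snd x"] that by (auto simp: I34_def)
  then have c34: "?s (fam34 m) (I34 m) g = 0" for g by simp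
  have *: "(\<Sum>x\<in>I56 m. Const (c (fam56 m x)) * basis_poly m (fam56 m x)) \<in> ?J"
    using rel split[of 1] c12[of 1] c34[of 1] by simp
  have "c (fam56 m x) = 0" if "x \<in> I56 m" for x
    using fam56_independent[OF m *, of x] that by (auto simp: I56_def)
  then show ?thesis
    using k \<open>\<And>x. x \<in> I12 m \<Longrightarrow> c (fam12 m x) = 0\<close> \<open>\<And>x. x \<in> I34 m \<Longrightarrow> c (fam34 m x) = 0\<close>
    unfolding indices_eq by blast
qed

section \<open>Every invariant is a combination of the six families\<close>

text \<open>
  The interchange is a product of elementary substitutions.
\<close>

lemma top_coeff_swap: "top_coeff (q ^ m) (psubst swap_subst f) = top_coeff (q ^ m) (f :: 'a mpoly)"
proof -
  let ?e1 = "elementary_subst 0 1 1 1 :: nat \<Rightarrow> 'a mpoly" and ?e2 = "elementary_subst 1 1 0 (- 1) :: nat \<Rightarrow> 'a mpoly"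
    and ?e0 = "elementary_subst 0 (- 1) 1 0 :: nat \<Rightarrow> 'a mpoly"
  have "psubst swap_subst f = psubst ?e0 (psubst ?e1 (psubst ?e2 (psubst ?e1 f)))"
    unfolding psubst_psubst
    by (rule arg_cong[of _ _ "\<lambda>s. psubst s f"])
      (auto simp: fun_eq_iff swap_subst_def elementary_subst_def psubst_simps Const_uminus)
  then show ?thesis by (simp add: top_coeff_elementary_subst)
qed

lemma top_coeff_mult_invariant:
  assumes "fixes_mod (q ^ m) p s" "\<And>f. top_coeff (q ^ m) (psubst s f) = top_coeff (q ^ m) f"
  shows "top_coeff (q ^ m) (p * psubst s f) = top_coeff (q ^ m) (p * (f :: 'a mpoly))"
proof -
  have "(psubst s p - p) * psubst s f \<in> truncation_ideal (q ^ m)"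
    using assms(1) by (intro J_mult_right) (simp add: fixes_mod_def)
  then have "0 = top_coeff (q ^ m) ((psubst s p - p) * psubst s f)"
    using q_ge2 by (simp add: top_coeff_J)
  also have "(psubst s p - p) * psubst s f = psubst s (p * f) + Const (- 1) * (p * psubst s f)"
    by (simp add: psubst_mult algebra_simps Const_uminus)
  also have "top_coeff (q ^ m) \<dots> = top_coeff (q ^ m) (p * f) - top_coeff (q ^ m) (p * psubst s f)"
    by (simp only: top_coeff_add top_coeff_Const assms(2)) simp
  finally show ?thesis by simp
qed

text \<open>
  $\tau(p \cdot gf) = \tau(gp \cdot gf) = \tau(pf)$ for $g$ in $P(2,1)$.
\<close>

lemma coinvariant_functional_of_invariant:
  assumes "m \<ge> 3" "P21_invariant m p"
  shows "coinvariant_functional q m (\<lambda>f. top_coeff (q ^ m) (p * f))"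
proof
  show "m \<ge> 3" by fact
  fix f g :: "'a mpoly" and c a :: 'a
  show "top_coeff (q ^ m) (p * (f + g)) = top_coeff (q ^ m) (p * f) + top_coeff (q ^ m) (p * g)"
    by (simp add: distrib_left top_coeff_add)
  show "top_coeff (q ^ m) (p * (Const c * f)) = c * top_coeff (q ^ m) (p * f)"
    by (simp only: mult.left_commute[of p] top_coeff_Const)
  show "top_coeff (q ^ m) (p * f) = 0" if "f \<in> truncation_ideal (q ^ m)"
    using q_ge2 by (intro top_coeff_J J_mult that) simp
  show "top_coeff (q ^ m) (p * psubst swap_subst f) = top_coeff (q ^ m) (p * f)"
    using assms(2) by (intro top_coeff_mult_invariant top_coeff_swap) (simp add: P21_invariant_def)
  show "top_coeff (q ^ m) (p * psubst (elementary_subst 1 c 0 a) f) = top_coeff (q ^ m) (p * f)" if "c \<noteq> 0"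
    using assms(2) that by (intro top_coeff_mult_invariant top_coeff_elementary_subst) (simp_all add: P21_invariant_def)
  show "top_coeff (q ^ m) (p * psubst (elementary_subst 2 c 0 a) f) = top_coeff (q ^ m) (p * f)" if "c \<noteq> 0"
    using assms(2) that by (intro top_coeff_mult_invariant top_coeff_elementary_subst) (simp_all add: P21_invariant_def)
qed

text \<open>
  One test polynomial for each index; the exponents range over those in
  \<open>vanishing_functional\<close>.
\<close>

primrec test_poly :: "nat \<Rightarrow> index \<Rightarrow> 'a mpoly" where
  "test_poly m (Fam1 a b i) = vY * vX * WY * vX ^ q * Z ^ (q\<^sup>2 - 1) * (E1 ^ a * E0 ^ b) * VV ^ ((q - 1) * i)"
| "test_poly m (Fam2 a b) = vY * vX * WY * vX ^ q * Z ^ (q\<^sup>2 - 1) * (E1 ^ a * E0 ^ b) * VV ^ ((q - 1) * qint q (m - 2))"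
| "test_poly m (Fam3 i1 i) = vY * vX * vX ^ i1 * Z ^ (q - 1) * VZ ^ ((q - 1) * i)"
| "test_poly m (Fam4 i1) = vY * vX * vX ^ i1 * Z ^ (q - 1) * VZ ^ ((q - 1) * qint q (m - 1))"
| "test_poly m (Fam5 i) = Z ^ ((q - 1) * i)"
| "test_poly m Fam6 = Z ^ ((q - 1) * qint q m)"

lemma invariant_determined_by_tests:
  assumes m: "m \<ge> 3" and p: "P21_invariant m p"
    and tests: "\<And>k. k \<in> indices q m \<Longrightarrow> top_coeff (q ^ m) (p * test_poly m k) = 0"
  shows "p \<in> truncation_ideal (q ^ m)"
proof (rule top_coeff_nondegenerate)
  interpret coinvariant_functional q field_type m "\<lambda>f. top_coeff (q ^ m) (p * f)"
    by (rule coinvariant_functional_of_invariant[OF m p])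
  interpret vanishing_functional q field_type m "\<lambda>f. top_coeff (q ^ m) (p * f)"
  proof
    show "top_coeff (q ^ m) (p * Z ^ ((q - 1) * i)) = 0" if "i \<le> qint q m" for i
      using tests[of "Fam5 i"] tests[of Fam6] that by (cases "i < qint q m") (auto simp: indices_iff)
    show "top_coeff (q ^ m) (p * (vY * vX * vX ^ i * Z ^ (q - 1) * VZ ^ ((q - 1) * l))) = 0"
      if "i < qint q m" "l \<le> qint q (m - 1)" for i l
      using tests[of "Fam3 i l"] tests[of "Fam4 i"] that by (cases "l < qint q (m - 1)") (auto simp: indices_iff)
    show "top_coeff (q ^ m) (p * (vY * vX * WY * vX ^ q * Z ^ (q\<^sup>2 - 1) * (E1 ^ a * E0 ^ b) * VV ^ ((q - 1) * l))) = 0"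
      if "(a, b) \<in> Delta2 q m" "l \<le> qint q (m - 2)" for a b l
      using tests[of "Fam1 a b l"] tests[of "Fam2 a b"] that by (cases "l < qint q (m - 2)") (auto simp: indices_iff)
  qed
  show "p \<in> S3" using p by (simp add: P21_invariant_def)
  show "top_coeff (q ^ m) (p * f) = 0" if "f \<in> S3" for f using phi_vanishes[OF that] .
qed

definition combination :: "nat \<Rightarrow> (index \<Rightarrow> 'a) \<Rightarrow> 'a mpoly" where
  "combination m c = (\<Sum>k\<in>indices q m. Const (c k) * basis_poly m k)"

lemma P21_invariant_0: "P21_invariant m 0"
  by (simp add: P21_invariant_def fixes_mod_def S_0)

lemma P21_invariant_add:
  assumes "P21_invariant m f" "P21_invariant m g" shows "P21_invariant m (f + g)"
proof -
  have "fixes_mod (q ^ m) (f + g) s" if "fixes_mod (q ^ m) f s" "fixes_mod (q ^ m) g s" for s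
    using J_add[OF that[unfolded fixes_mod_def]] by (simp add: fixes_mod_def psubst_add add_diff_add)
  then show ?thesis using assms by (auto simp: P21_invariant_def S_add)
qed

lemma P21_invariant_Const:
  assumes "P21_invariant m f" shows "P21_invariant m (Const c * f)"
proof -
  have "fixes_mod (q ^ m) (Const c * f) s" if "fixes_mod (q ^ m) f s" for s
    using J_mult[OF that[unfolded fixes_mod_def], of "Const c"] by (simp add: fixes_mod_def psubst_mult right_diff_distrib)
  then show ?thesis using assms by (auto simp: P21_invariant_def S_mult S_Const)
qed

lemma P21_invariant_diff: "P21_invariant m f \<Longrightarrow> P21_invariant m g \<Longrightarrow> P21_invariant m (f - g)"
  using P21_invariant_add[of m f "Const (- 1) * g"] P21_invariant_Const[of m g "- 1"] by (simp add: Const_uminus)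

lemma P21_invariant_sum: "(\<And>k. k \<in> K \<Longrightarrow> P21_invariant m (f k)) \<Longrightarrow> P21_invariant m (sum f K)"
  by (induction K rule: infinite_finite_induct) (simp_all add: P21_invariant_0 P21_invariant_add)

lemma combination_invariant: "m \<ge> 1 \<Longrightarrow> P21_invariant m (combination m c)"
  unfolding combination_def by (intro P21_invariant_sum P21_invariant_Const basis_poly_invariant)

lemma Q_class_eq:
  assumes "p \<in> S3" "r \<in> S3"
  shows "Q_class m 3 p = Q_class m 3 r \<longleftrightarrow> p - r \<in> truncation_ideal (q ^ m)"
  using Q_class_eq_iff[OF assms, of m] S_diff[OF assms] by (simp add: I_ideal_eq q_def)

lemma carrier_Q_invariants: "carrier (Q_invariants m 3 P21) = Q_class m 3 ` {p. P21_invariant m p}"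
proof -
  have iff: "(\<forall>g\<in>P21. Q_act m 3 g (Q_class m 3 p) = Q_class m 3 p) \<longleftrightarrow> P21_invariant m p" if "p \<in> S3" for p
    using Q_class_invariant_iff[OF that, of m] that by (simp only: P21_invariant_def simp_thms)
  have "carrier (Q_invariants m 3 P21) = {A \<in> Q_class m 3 ` S3. \<forall>g\<in>P21. Q_act m 3 g A = A}"
    by (simp add: Q_invariants_def carrier_Q_ring)
  also have "\<dots> = Q_class m 3 ` {p \<in> S3. \<forall>g\<in>P21. Q_act m 3 g (Q_class m 3 p) = Q_class m 3 p}"
    by blast
  also have "{p \<in> S3. \<forall>g\<in>P21. Q_act m 3 g (Q_class m 3 p) = Q_class m 3 p} = {p. P21_invariant m p}"
  proof -
    have "p \<in> S3" if "P21_invariant m p" for p using that by (simp add: P21_invariant_def)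
    then show ?thesis using iff by blast
  qed
  finally show ?thesis .
qed

text \<open>
  The values on the test polynomials embed $R^{P(2,1)}$ into the coefficient families, and by
  independence the coefficient families embed into $R^{P(2,1)}$. All sets are finite, so the
  second map is onto.
\<close>

lemma every_invariant_is_combination:
  assumes m: "m \<ge> 3" and p: "P21_invariant m p"
  obtains c where "Q_class m 3 p = Q_class m 3 (combination m c)"
proof -
  let ?PE = "PiE (indices q m) (\<lambda>_. UNIV :: 'a set)"
  let ?V = "Q_class m 3 ` {p. P21_invariant m p}"
  have m2: "m \<ge> 2" "m \<ge> 1" using m by auto
  have finPE: "finite ?PE" using finite_indices[OF m2(1)] by (intro finite_PiE) auto
  have comb_diff: "combination m c - combination m d = combination m (\<lambda>k. c k - d k)" for c d
    by (simp add: combination_def Const_diff left_diff_distrib sum_subtractf)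
  have S: "combination m c \<in> S3" for c using combination_invariant[OF m2(2)] by (simp add: P21_invariant_def)
  have inj1: "inj_on (\<lambda>c. Q_class m 3 (combination m c)) ?PE"
  proof (rule inj_onI)
    fix c d assume cd: "c \<in> ?PE" "d \<in> ?PE" "Q_class m 3 (combination m c) = Q_class m 3 (combination m d)"
    then have "combination m (\<lambda>k. c k - d k) \<in> truncation_ideal (q ^ m)"
      using Q_class_eq[OF S S] by (simp add: comb_diff)
    then have rel: "(\<Sum>k\<in>indices q m. Const (c k - d k) * basis_poly m k) \<in> truncation_ideal (q ^ m)"
      by (simp only: combination_def)
    have "c k - d k = 0" if "k \<in> indices q m" for k
      by (rule basis_poly_independent[where c = "\<lambda>k. c k - d k", OF m2(1) rel that])
    then show "c = d" using cd by (intro PiE_ext) auto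
  qed
  define rep where "rep A = (SOME p. P21_invariant m p \<and> A = Q_class m 3 p)" for A
  have rep: "P21_invariant m (rep A)" "A = Q_class m 3 (rep A)" if "A \<in> ?V" for A
  proof -
    have "\<exists>p. P21_invariant m p \<and> A = Q_class m 3 p" using that by blast
    then have "P21_invariant m (rep A) \<and> A = Q_class m 3 (rep A)" unfolding rep_def by (rule someI_ex)
    then show "P21_invariant m (rep A)" "A = Q_class m 3 (rep A)" by auto
  qed
  define ev where "ev A = restrict (\<lambda>k. top_coeff (q ^ m) (rep A * test_poly m k)) (indices q m)" for A
  have inj2: "inj_on ev ?V"
  proof (rule inj_onI)
    fix A B assume AB: "A \<in> ?V" "B \<in> ?V" "ev A = ev B"
    have "rep A - rep B \<in> truncation_ideal (q ^ m)"
    proof (rule invariant_determined_by_tests[OF m])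
      show "P21_invariant m (rep A - rep B)" using rep(1)[OF AB(1)] rep(1)[OF AB(2)] by (rule P21_invariant_diff)
      fix k assume k: "k \<in> indices q m"
      have "ev A k = ev B k" using AB(3) by simp
      then have eq: "top_coeff (q ^ m) (rep A * test_poly m k) = top_coeff (q ^ m) (rep B * test_poly m k)"
        using k by (simp add: ev_def)
      have "(rep A - rep B) * test_poly m k = rep A * test_poly m k + Const (- 1) * (rep B * test_poly m k)"
        by (simp add: Const_uminus algebra_simps)
      then show "top_coeff (q ^ m) ((rep A - rep B) * test_poly m k) = 0"
        using eq by (simp only: top_coeff_add top_coeff_Const) simp
    qed
    then have "Q_class m 3 (rep A) = Q_class m 3 (rep B)"
      using rep(1)[OF AB(1)] rep(1)[OF AB(2)] by (subst Q_class_eq) (auto simp: P21_invariant_def)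
    then show "A = B" using rep(2)[OF AB(1)] rep(2)[OF AB(2)] by simp
  qed
  have ev_PE: "ev ` ?V \<subseteq> ?PE" by (auto simp: ev_def)
  have finV: "finite ?V" using inj2 ev_PE finPE by (meson finite_imageD finite_subset)
  have "card ?V \<le> card ?PE" using card_inj_on_le[OF inj2 ev_PE finPE] .
  moreover have "(\<lambda>c. Q_class m 3 (combination m c)) ` ?PE \<subseteq> ?V" using combination_invariant[OF m2(2)] by blast
  ultimately have eq: "(\<lambda>c. Q_class m 3 (combination m c)) ` ?PE = ?V"
    using finV card_image[OF inj1] by (intro card_seteq) auto
  have "Q_class m 3 p \<in> (\<lambda>c. Q_class m 3 (combination m c)) ` ?PE"
    unfolding eq by (rule imageI) (simp add: p)
  then obtain c where "Q_class m 3 p = Q_class m 3 (combination m c)" by (rule imageE)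
  then show ?thesis by (rule that)
qed

end

lemma zero_Q_invariants:
  "\<zero>\<^bsub>Q_invariants m n G\<^esub> = Q_class m n (0 :: 'a::{field,finite} mpoly)"
  unfolding Q_invariants_def using
    ring_hom_zero[OF Q_class_hom cring.axioms(1)[OF cring_S_ring] cring.axioms(1)[OF cring_Q_ring],
      unfolded S_ring_simps, of m n, symmetric]
  by simp

lemma (in finite_field_polynomials) lincomb_Q_invariants:
  assumes m: "m \<ge> 2" and K: "K \<subseteq> indices q m"
    and inj: "inj_on (basis_class m :: index \<Rightarrow> 'a mpoly set) (indices q m)"
  shows "module.lincomb (Q_invariants m 3 P21) a (basis_class m ` K)
    = Q_class m 3 (\<Sum>k\<in>K. Const (a (basis_class m k)) * basis_poly m k)"
proof -
  let ?V = "Q_invariants m 3 P21 :: ('a, 'a mpoly set) module"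
  interpret V: vectorspace "class_ring :: 'a ring" ?V by (rule vectorspace_Q_invariants)
  have finK: "finite K" using K finite_indices[OF m] by (rule finite_subset)
  have S: "basis_poly m k \<in> S3" if "k \<in> indices q m" for k
    using basis_poly_invariant[of m k] m that by (simp add: P21_invariant_def)
  have carr: "basis_class m k \<in> carrier ?V" if "k \<in> indices q m" for k
    unfolding carrier_Q_invariants basis_class_eq using basis_poly_invariant[of m k] m that by simp
  have smult: "a (basis_class m k) \<odot>\<^bsub>?V\<^esub> basis_class m k = Q_class m 3 (Const (a (basis_class m k)) * basis_poly m k)"
    if "k \<in> indices q m" for k
    using ring_hom_mult[OF Q_class_hom S_Const S[OF that], of m "a (basis_class m k)"]
    by (simp add: Q_invariants_def basis_class_eq)
  have zero: "\<zero>\<^bsub>?V\<^esub> = Q_class m 3 0"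
    by (rule zero_Q_invariants)
  have "finsum ?V (\<lambda>v. a v \<odot>\<^bsub>?V\<^esub> v) (basis_class m ` K)
      = finsum ?V (\<lambda>k. a (basis_class m k) \<odot>\<^bsub>?V\<^esub> basis_class m k) K"
    using inj_on_subset[OF inj K] carr K by (subst V.M.finsum_reindex) (auto simp: comp_def)
  also have "\<dots> = Q_class m 3 (\<Sum>k\<in>K. Const (a (basis_class m k)) * basis_poly m k)"
    using finK K
  proof (induction K rule: finite_induct)
    case empty then show ?case by (simp add: zero)
  next
    case (insert k K)
    have "finsum ?V (\<lambda>k. a (basis_class m k) \<odot>\<^bsub>?V\<^esub> basis_class m k) (insert k K)
       = a (basis_class m k) \<odot>\<^bsub>?V\<^esub> basis_class m k \<oplus>\<^bsub>?V\<^esub> finsum ?V (\<lambda>k. a (basis_class m k) \<odot>\<^bsub>?V\<^esub> basis_class m k) K"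
      using insert carr by (intro V.M.finsum_insert) auto
    also have "\<dots> = Q_class m 3 (Const (a (basis_class m k)) * basis_poly m k) \<oplus>\<^bsub>?V\<^esub> Q_class m 3 (\<Sum>k\<in>K. Const (a (basis_class m k)) * basis_poly m k)"
      using insert smult[of k] by simp
    also have "\<dots> = Q_class m 3 (Const (a (basis_class m k)) * basis_poly m k + (\<Sum>k\<in>K. Const (a (basis_class m k)) * basis_poly m k))"
    proof -
      have "Const (a (basis_class m k)) * basis_poly m k \<in> S3" "(\<Sum>k\<in>K. Const (a (basis_class m k)) * basis_poly m k) \<in> S3"
        using insert S by (auto intro!: S_mult S_Const S_sum)
      from ring_hom_add[OF Q_class_hom this, of m] show ?thesis by (simp add: Q_invariants_def)
    qed
    finally show ?case using insert by simp
  qed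
  finally show ?thesis unfolding V.lincomb_def .
qed

theorem proposition1p7:
  fixes m :: nat
  assumes "m \<ge> 3"
  shows "inj_on (basis_class m :: index \<Rightarrow> 'a::{field,finite} mpoly set) (indices CARD('a) m)
    \<and> vectorspace.basis (class_ring :: 'a ring) (Q_invariants m 3 P21)
        (basis_class m ` indices CARD('a) m)"
proof -
  interpret finite_field_polynomials "CARD('a)" "TYPE('a)" by standard simp
  let ?q = "CARD('a)"
  let ?I = "indices ?q m" and ?V = "Q_invariants m 3 P21 :: ('a, 'a mpoly set) module"
  interpret V: vectorspace "class_ring :: 'a ring" ?V by (rule vectorspace_Q_invariants)
  have m: "m \<ge> 2" "m \<ge> 1" using assms by auto
  have fin: "finite ?I" by (rule finite_indices[OF m(1)])
  have S: "basis_poly m k \<in> S3" if "k \<in> ?I" for k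
    using basis_poly_invariant[OF m(2) that] by (simp add: P21_invariant_def)
  have inj: "inj_on (basis_class m :: index \<Rightarrow> 'a mpoly set) ?I"
  proof (rule inj_onI, rule ccontr)
    fix k l assume kl: "k \<in> ?I" "l \<in> ?I" "(basis_class m k :: 'a mpoly set) = basis_class m l" "k \<noteq> l"
    let ?c = "\<lambda>j. if j = k then 1 else if j = l then - 1 else 0 :: 'a"
    have "basis_poly m k - basis_poly m l \<in> (truncation_ideal (?q ^ m) :: 'a mpoly set)"
      using kl(3) Q_class_eq[OF S[OF kl(1)] S[OF kl(2)]] by (simp add: basis_class_eq)
    moreover have "(\<Sum>j\<in>?I. Const (?c j) * basis_poly m j) = basis_poly m k - (basis_poly m l :: 'a mpoly)"
    proof -
      have "(\<Sum>j\<in>?I. Const (?c j) * basis_poly m j) = (\<Sum>j\<in>?I. (if j = k then basis_poly m j else 0) - (if j = l then basis_poly m j else 0) :: 'a mpoly)"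
        using kl(4) by (intro sum.cong) (auto simp: Const_uminus)
      also have "\<dots> = basis_poly m k - basis_poly m l"
        unfolding sum_subtractf using kl(1,2) fin by simp
      finally show ?thesis .
    qed
    ultimately have rel: "(\<Sum>j\<in>?I. Const (?c j) * basis_poly m j) \<in> (truncation_ideal (?q ^ m) :: 'a mpoly set)"
      by (simp only:)
    have "?c k = 0" by (rule basis_poly_independent[where c = ?c, OF m(1) rel kl(1)])
    then show False by simp
  qed
  note lin = lincomb_Q_invariants[OF m(1) _ inj]
  have carr: "basis_class m ` ?I \<subseteq> carrier ?V"
    unfolding carrier_Q_invariants using basis_poly_invariant[OF m(2)] by (auto simp: basis_class_eq)
  have zero: "\<zero>\<^bsub>?V\<^esub> = Q_class m 3 0"
    by (rule zero_Q_invariants)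
  have indpt: "\<not> V.lin_dep (basis_class m ` ?I)"
  proof
    assume "V.lin_dep (basis_class m ` ?I)"
    then obtain A a v where A: "finite A" "A \<subseteq> basis_class m ` ?I" "V.lincomb a A = \<zero>\<^bsub>?V\<^esub>" "v \<in> A" "a v \<noteq> 0"
      unfolding V.lin_dep_def by auto
    define K where "K = {k \<in> ?I. basis_class m k \<in> A}"
    have K: "K \<subseteq> ?I" "basis_class m ` K = A" using A(2) by (auto simp: K_def)
    let ?c = "\<lambda>k. if k \<in> K then a (basis_class m k) else 0"
    have sum: "(\<Sum>k\<in>?I. Const (?c k) * basis_poly m k) = (\<Sum>k\<in>K. Const (a (basis_class m k)) * basis_poly m k)"
      using K(1) fin by (intro sum.mono_neutral_cong_right) auto
    have "Q_class m 3 (\<Sum>k\<in>K. Const (a (basis_class m k)) * basis_poly m k) = Q_class m 3 0"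
      using A(3) lin[OF K(1)] unfolding K(2) zero by simp
    moreover have "(\<Sum>k\<in>K. Const (a (basis_class m k)) * basis_poly m k) \<in> S3"
      using K(1) S by (auto intro!: S_sum S_mult S_Const)
    ultimately have "(\<Sum>k\<in>K. Const (a (basis_class m k)) * basis_poly m k) \<in> truncation_ideal (?q ^ m)"
      using Q_class_eq[OF _ S_0] by simp
    then have rel: "(\<Sum>k\<in>?I. Const (?c k) * basis_poly m k) \<in> truncation_ideal (?q ^ m)" unfolding sum .
    obtain k where k: "k \<in> K" "v = basis_class m k" using A(4) K(2) by auto
    have "?c k = 0" by (rule basis_poly_independent[where c = ?c, OF m(1) rel]) (use k(1) K(1) in blast)
    then show False using k A(5) by simp
  qed
  have gen: "V.gen_set (basis_class m ` ?I)"
  proof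
    show "V.span (basis_class m ` ?I) \<subseteq> carrier ?V" by (rule V.span_is_subset2[OF carr])
    show "carrier ?V \<subseteq> V.span (basis_class m ` ?I)"
    proof
      fix A assume "A \<in> carrier ?V"
      then obtain p where p: "P21_invariant m p" "A = Q_class m 3 p" unfolding carrier_Q_invariants by blast
      obtain c where c: "Q_class m 3 p = Q_class m 3 (combination m c)"
        using every_invariant_is_combination[OF assms p(1)] .
      define a where "a B = c (the_inv_into ?I (basis_class m) B)" for B :: "'a mpoly set"
      have "a (basis_class m k) = c k" if "k \<in> ?I" for k
        unfolding a_def by (simp add: the_inv_into_f_f[OF inj that])
      then have "combination m c = (\<Sum>k\<in>?I. Const (a (basis_class m k)) * basis_poly m k)"
        unfolding combination_def by (intro sum.cong) auto
      then have "A = V.lincomb a (basis_class m ` ?I)"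
        using lin[OF order_refl, of a] c p(2) by simp
      then show "A \<in> V.span (basis_class m ` ?I)"
        unfolding V.span_def using fin by auto
    qed
  qed
  show ?thesis unfolding V.basis_def using inj indpt gen carr by blast
qed

end
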